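(* Let $(y,h,x)$ be a basis of $\mathfrak{sl}_2=\mathfrak{sl}_2(\mathbb{C})$ with $[h,y]=-2y$, $[h,x]=2x$, $[x,y]=h$. The Lie algebra $$L\Bigl(\mathbb{C}h,\ \operatorname{ad}\oplus\rho_{\mathfrak{h}}^{-},\ \mathbb{C}x\oplus\bigoplus_{i,j\in\mathbb{N}\cup\{0\}}\mathbb{C}e_{i,j}^-,\ \mathbb{C}y\oplus\bigoplus_{i,j\in\mathbb{N}\cup\{0\}}\mathbb{C}e_{i,j}^+,\ K_{\mathfrak{sl}_2}|_{\mathbb{C}h}\Bigr)$$ has the structure of a minimal graded Lie algebra $\bigoplus_{p\in\mathbb{Z}}\mathfrak{l}_p$ with local part $$\mathfrak{l}_1\simeq\mathbb{C}x\oplus\bigoplus_{i,j\in\mathbb{N}\cup\{0\}}\mathbb{C}e_{i,j}^-,\qquad \mathfrak{l}_0\simeq\mathbb{C}h,\qquad \mathfrak{l}_{-1}\simeq\mathbb{C}y\oplus\bigoplus_{i,j\in\mathbb{N}\cup\{0\}}\mathbb{C}e_{i,j}^+,$$ whose brackets are, for $i,j,k,l\in\mathbb{N}\cup\{0\}$, $$[h,y]=-2y,\quad [h,x]=2x,\quad [x,y]=h,\quad [h,e_{i,j}^-]=-ie_{i,j}^-,\quad [h,e_{i,j}^+]=ie_{i,j}^+,$$ $$[y,e_{i,j}^-]=0,\quad [x,e_{i,j}^+]=0,\quad [e_{i,j}^-,e_{k,l}^+]=\frac{-i}{2}\,\delta_{(i,j),(k,l)}\,h.$$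
   Context: Everything is over $\mathbb{C}$ (in the claim, $i$ is an index, not the imaginary unit). A graded Lie algebra is $\bigoplus_{n\in\mathbb{Z}}V_n$ with $[V_n,V_m]\subset V_{n+m}$, assumed generated by its local part $V_{-1}\oplus V_0\oplus V_1$. It is minimal if for every graded Lie algebra $\bigoplus_n V_n'$, every isomorphism of local parts $V'_{-1}\oplus V'_0\oplus V'_1\to V_{-1}\oplus V_0\oplus V_1$ extends to an epimorphism $\bigoplus_n V'_n\to\bigoplus_n V_n$. Let $\mathfrak{g}$ be a Lie algebra with a non-degenerate invariant bilinear form $B$, $\rho:\mathfrak{g}\otimes V\to V$ a representation, and $(\varrho,\mathcal{V})$ a $\mathfrak{g}$-submodule of $\operatorname{Hom}(V,\mathbb{C})$. The pentad $(\mathfrak{g},\rho,V,\mathcal{V},B)$ is standard if the canonical pairing restricted to $V\times\mathcal{V}$ is non-degenerate and there is a linear map $\Phi_\rho:V\otimes\mathcal{V}\to\mathfrak{g}$ with $B(a,\Phi_\rho(v\otimes\phi))=\langle\rho(a\otimes v),\phi\rangle=-\langle v,\varrho(a\otimes\phi)\rangle$ for all $a\in\mathfrak{g},v\in V,\phi\in\mathcal{V}$. The associated Lie algebra $L(\mathfrak{g},\rho,V,\mathcal{V},B)=\bigoplus_n V_n$ is the (unique) minimal graded Lie algebra with $V_0=\mathfrak{g}$, $V_1=V$, $V_{-1}=\mathcal{V}$ (as $\mathfrak{g}$-modules) and $[v,\phi]=\Phi_\rho(v\otimes\phi)$ for $v\in V_1,\phi\in V_{-1}$. The symbols $e_{i,j}^{\pm}$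 ($i,j\in\mathbb{N}\cup\{0\}$) are formal basis vectors. With $\mathfrak{h}=\mathbb{C}h$, the representations $\rho_{\mathfrak{h}}^{\pm}$ of $\mathfrak{h}$ on $\bigoplus_{i,j}\mathbb{C}e_{i,j}^{\pm}$ are $\rho_{\mathfrak{h}}^{+}(h\otimes e_{i,j}^+)=ie_{i,j}^+$ and $\rho_{\mathfrak{h}}^{-}(h\otimes e_{i,j}^-)=-ie_{i,j}^-$; $h$ acts on $\mathbb{C}x$ and $\mathbb{C}y$ by the adjoint action in $\mathfrak{sl}_2$. $K_{\mathfrak{sl}_2}$ is the Killing form of $\mathfrak{sl}_2$. The space $\mathbb{C}y\oplus\bigoplus_{i,j}\mathbb{C}e_{i,j}^+$ is regarded as a submodule of the dual of $\mathbb{C}x\oplus\bigoplus_{i,j}\mathbb{C}e_{i,j}^-$ through the pairing $\langle x,e_{i,j}^+\rangle=\langle e_{i,j}^-,y\rangle=0$, $\langle x,y\rangle=4$, $\langle e_{i,j}^-,e_{k,l}^+\rangle=4\delta_{(i,j),(k,l)}$. The pentad in the claim is standard. *)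

theory Defs
  imports "HOL-Analysis.Analysis" "HOL-Library.Poly_Mapping"
begin

section \<open>Complex vector spaces and Lie algebras\<close>

text \<open>
  A space is a subspace \<open>carr\<close> of an ambient complex vector space whose addition is that of the
  type and whose scalar multiplication is \<open>smul\<close>. All maps matter only on carriers.
\<close>

record 'a cspace =
  smul :: "complex \<Rightarrow> 'a \<Rightarrow> 'a"
  carr :: "'a set"

definition is_cspace :: "('a::ab_group_add, 'm) cspace_scheme \<Rightarrow> bool" where
  "is_cspace V \<longleftrightarrow> vector_space (smul V) \<and> module.subspace (smul V) (carr V)"

definition lin_map ::
  "('a::ab_group_add, 'm) cspace_scheme \<Rightarrow> ('b::ab_group_add, 'n) cspace_scheme \<Rightarrow> ('a \<Rightarrow> 'b) \<Rightarrow> bool"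
where
  "lin_map V W f \<longleftrightarrow>
     (\<forall>v\<in>carr V. f v \<in> carr W) \<and>
     (\<forall>u\<in>carr V. \<forall>v\<in>carr V. f (u + v) = f u + f v) \<and>
     (\<forall>c. \<forall>v\<in>carr V. f (smul V c v) = smul W c (f v))"

definition lin_iso ::
  "('a::ab_group_add, 'm) cspace_scheme \<Rightarrow> ('b::ab_group_add, 'n) cspace_scheme \<Rightarrow> ('a \<Rightarrow> 'b) \<Rightarrow> bool"
where
  "lin_iso V W f \<longleftrightarrow> lin_map V W f \<and> bij_betw f (carr V) (carr W)"

definition bilin_map ::
  "('a::ab_group_add, 'm) cspace_scheme \<Rightarrow> ('b::ab_group_add, 'n) cspace_scheme \<Rightarrow>
   ('c::ab_group_add, 'k) cspace_scheme \<Rightarrow> ('a \<Rightarrow> 'b \<Rightarrow> 'c) \<Rightarrow> bool"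
where
  "bilin_map U V W f \<longleftrightarrow>
     (\<forall>u\<in>carr U. lin_map V W (f u)) \<and> (\<forall>v\<in>carr V. lin_map U W (\<lambda>u. f u v))"

definition complex_line :: "complex cspace" where
  "complex_line = \<lparr>smul = (*), carr = UNIV\<rparr>"

definition nondegenerate ::
  "('a::ab_group_add, 'm) cspace_scheme \<Rightarrow> ('b::ab_group_add, 'n) cspace_scheme \<Rightarrow>
   ('a \<Rightarrow> 'b \<Rightarrow> complex) \<Rightarrow> bool"
where
  "nondegenerate V W B \<longleftrightarrow>
     (\<forall>v\<in>carr V. (\<forall>w\<in>carr W. B v w = 0) \<longrightarrow> v = 0) \<and>
     (\<forall>w\<in>carr W. (\<forall>v\<in>carr V. B v w = 0) \<longrightarrow> w = 0)"

record 'a lie_alg = "'a cspace" +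
  brkt :: "'a \<Rightarrow> 'a \<Rightarrow> 'a"

definition is_lie_alg :: "('a::ab_group_add, 'm) lie_alg_scheme \<Rightarrow> bool" where
  "is_lie_alg L \<longleftrightarrow>
     is_cspace L \<and> bilin_map L L L (brkt L) \<and>
     (\<forall>a\<in>carr L. brkt L a a = 0) \<and>
     (\<forall>a\<in>carr L. \<forall>b\<in>carr L. \<forall>c\<in>carr L.
        brkt L a (brkt L b c) + brkt L b (brkt L c a) + brkt L c (brkt L a b) = 0)"

definition lie_hom ::
  "('a::ab_group_add, 'm) lie_alg_scheme \<Rightarrow> ('b::ab_group_add, 'n) lie_alg_scheme \<Rightarrow> ('a \<Rightarrow> 'b) \<Rightarrow> bool"
where
  "lie_hom L M f \<longleftrightarrow>
     lin_map L M f \<and> (\<forall>a\<in>carr L. \<forall>b\<in>carr L. f (brkt L a b) = brkt M (f a) (f b))"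

definition lie_subalg :: "('a::ab_group_add, 'm) lie_alg_scheme \<Rightarrow> 'a set \<Rightarrow> bool" where
  "lie_subalg L S \<longleftrightarrow>
     S \<subseteq> carr L \<and> module.subspace (smul L) S \<and> (\<forall>a\<in>S. \<forall>b\<in>S. brkt L a b \<in> S)"

definition lie_generated :: "('a::ab_group_add, 'm) lie_alg_scheme \<Rightarrow> 'a set \<Rightarrow> 'a set" where
  "lie_generated L A = \<Inter>{S. lie_subalg L S \<and> A \<subseteq> S}"

definition lie_rep ::
  "('g::ab_group_add, 'm) lie_alg_scheme \<Rightarrow> ('v::ab_group_add, 'n) cspace_scheme \<Rightarrow>
   ('g \<Rightarrow> 'v \<Rightarrow> 'v) \<Rightarrow> bool"
where
  "lie_rep g V \<rho> \<longleftrightarrow>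
     bilin_map g V V \<rho> \<and>
     (\<forall>a\<in>carr g. \<forall>b\<in>carr g. \<forall>v\<in>carr V. \<rho> (brkt g a b) v = \<rho> a (\<rho> b v) - \<rho> b (\<rho> a v))"

definition is_basis :: "('a::ab_group_add, 'm) cspace_scheme \<Rightarrow> 'a set \<Rightarrow> bool" where
  "is_basis V B \<longleftrightarrow> \<not> module.dependent (smul V) B \<and> module.span (smul V) B = carr V"

text \<open>Meaningful for a finite-dimensional space only.\<close>

definition endo_trace :: "('a::ab_group_add, 'm) cspace_scheme \<Rightarrow> ('a \<Rightarrow> 'a) \<Rightarrow> complex" where
  "endo_trace V T =
     (let B = (SOME B. is_basis V B) in \<Sum>e\<in>B. module.representation (smul V) B (T e) e)"

definition killing_form :: "('a::ab_group_add, 'm) lie_alg_scheme \<Rightarrow> 'a \<Rightarrow> 'a \<Rightarrow> complex" where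
  "killing_form L a b = endo_trace L (\<lambda>u. brkt L a (brkt L b u))"


section \<open>Graded Lie algebras and minimality\<close>

record 'a graded_lie = "'a lie_alg" +
  homog :: "int \<Rightarrow> 'a set"

definition homog_space :: "('a, 'm) graded_lie_scheme \<Rightarrow> int \<Rightarrow> 'a cspace" where
  "homog_space L n = \<lparr>smul = smul L, carr = homog L n\<rparr>"

definition local_part :: "('a::ab_group_add, 'm) graded_lie_scheme \<Rightarrow> 'a cspace" where
  "local_part L = \<lparr>smul = smul L, carr = module.span (smul L) (\<Union>n\<in>{-1, 0, 1}. homog L n)\<rparr>"

text \<open>The carrier is the internal direct sum of the \<open>homog L n\<close>.\<close>

definition is_graded_lie :: "('a::ab_group_add, 'm) graded_lie_scheme \<Rightarrow> bool" where
  "is_graded_lie L \<longleftrightarrow>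
     is_lie_alg L \<and>
     (\<forall>n. module.subspace (smul L) (homog L n)) \<and>
     carr L = module.span (smul L) (\<Union>n. homog L n) \<and>
     (\<forall>N v. finite N \<and> (\<forall>n\<in>N. v n \<in> homog L n) \<and> (\<Sum>n\<in>N. v n) = 0 \<longrightarrow> (\<forall>n\<in>N. v n = 0)) \<and>
     (\<forall>n m. \<forall>a\<in>homog L n. \<forall>b\<in>homog L m. brkt L a b \<in> homog L (n + m)) \<and>
     lie_generated L (carr (local_part L)) = carr L"

text \<open>The bracket of a local part is defined only where the degrees add up to \<open>-1\<close>, \<open>0\<close> or \<open>1\<close>.\<close>

definition local_iso ::
  "('a::ab_group_add, 'm) graded_lie_scheme \<Rightarrow> ('b::ab_group_add, 'n) graded_lie_scheme \<Rightarrow>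
   ('a \<Rightarrow> 'b) \<Rightarrow> bool"
where
  "local_iso L M f \<longleftrightarrow>
     lin_iso (local_part L) (local_part M) f \<and>
     (\<forall>n\<in>{-1, 0, 1}. f ` homog L n = homog M n) \<and>
     (\<forall>n\<in>{-1, 0, 1}. \<forall>m\<in>{-1, 0, 1}. n + m \<in> {-1, 0, 1} \<longrightarrow>
        (\<forall>a\<in>homog L n. \<forall>b\<in>homog L m. f (brkt L a b) = brkt M (f a) (f b)))"

text \<open>
  HOL cannot quantify over types inside a formula, so the type \<open>'d\<close> carrying the competing graded
  Lie algebras is a parameter; a statement for arbitrary \<open>'d\<close> is minimality against all of them.
\<close>

definition minimal_graded_lie ::
  "('d::ab_group_add) itself \<Rightarrow> ('a::ab_group_add, 'm) graded_lie_scheme \<Rightarrow> bool"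
where
  "minimal_graded_lie D L \<longleftrightarrow>
     is_graded_lie L \<and>
     (\<forall>(L' :: 'd graded_lie) f. is_graded_lie L' \<and> local_iso L' L f \<longrightarrow>
        (\<exists>F. lie_hom L' L F \<and> F ` carr L' = carr L \<and> (\<forall>a\<in>carr (local_part L'). F a = f a)))"


section \<open>Standard pentads and their associated Lie algebras\<close>

text \<open>
  The submodule of the dual of \<open>pV\<close> is given as a module \<open>pW\<close> with action \<open>pvarrho\<close>, together with
  the evaluation pairing \<open>ppair v \<phi>\<close>: the map sending \<open>\<phi>\<close> to the functional \<open>\<lambda>v. ppair v \<phi>\<close> is
  the inclusion into the dual.
\<close>

record ('g, 'v, 'w) pentad =
  pg :: "'g lie_alg"
  prho :: "'g \<Rightarrow> 'v \<Rightarrow> 'v"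
  pV :: "'v cspace"
  pW :: "'w cspace"
  pvarrho :: "'g \<Rightarrow> 'w \<Rightarrow> 'w"
  ppair :: "'v \<Rightarrow> 'w \<Rightarrow> complex"
  pB :: "'g \<Rightarrow> 'g \<Rightarrow> complex"

definition is_pentad :: "('g::ab_group_add, 'v::ab_group_add, 'w::ab_group_add) pentad \<Rightarrow> bool" where
  "is_pentad P \<longleftrightarrow>
     is_lie_alg (pg P) \<and>
     bilin_map (pg P) (pg P) complex_line (pB P) \<and>
     nondegenerate (pg P) (pg P) (pB P) \<and>
     (\<forall>a\<in>carr (pg P). \<forall>b\<in>carr (pg P). \<forall>c\<in>carr (pg P).
        pB P (brkt (pg P) a b) c = pB P a (brkt (pg P) b c)) \<and>
     is_cspace (pV P) \<and> lie_rep (pg P) (pV P) (prho P) \<and>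
     is_cspace (pW P) \<and> lie_rep (pg P) (pW P) (pvarrho P) \<and>
     bilin_map (pV P) (pW P) complex_line (ppair P) \<and>
     inj_on (\<lambda>\<phi>. restrict (\<lambda>v. ppair P v \<phi>) (carr (pV P))) (carr (pW P)) \<and>
     (\<forall>a\<in>carr (pg P). \<forall>v\<in>carr (pV P). \<forall>\<phi>\<in>carr (pW P).
        ppair P v (pvarrho P a \<phi>) = - ppair P (prho P a v) \<phi>)"

text \<open>Linear maps out of the tensor product of \<open>pV\<close> and \<open>pW\<close> are rendered as bilinear maps.\<close>

definition is_Phi ::
  "('g::ab_group_add, 'v::ab_group_add, 'w::ab_group_add) pentad \<Rightarrow> ('v \<Rightarrow> 'w \<Rightarrow> 'g) \<Rightarrow> bool"
where
  "is_Phi P \<Phi> \<longleftrightarrow>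
     bilin_map (pV P) (pW P) (pg P) \<Phi> \<and>
     (\<forall>a\<in>carr (pg P). \<forall>v\<in>carr (pV P). \<forall>\<phi>\<in>carr (pW P).
        pB P a (\<Phi> v \<phi>) = ppair P (prho P a v) \<phi> \<and>
        ppair P (prho P a v) \<phi> = - ppair P v (pvarrho P a \<phi>))"

definition standard_pentad ::
  "('g::ab_group_add, 'v::ab_group_add, 'w::ab_group_add) pentad \<Rightarrow> bool"
where
  "standard_pentad P \<longleftrightarrow>
     is_pentad P \<and> nondegenerate (pV P) (pW P) (ppair P) \<and> (\<exists>\<Phi>. is_Phi P \<Phi>)"

text \<open>
  Minimality is tested here against graded Lie algebras on the type \<open>'l\<close> of \<open>L\<close> itself; for the
  type used in \<open>assoc_lie\<close> below this loses nothing, see there.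
\<close>

definition is_assoc_lie ::
  "('g::ab_group_add, 'v::ab_group_add, 'w::ab_group_add) pentad \<Rightarrow>
   ('l::ab_group_add) graded_lie \<Rightarrow> bool"
where
  "is_assoc_lie P L \<longleftrightarrow>
     standard_pentad P \<and> minimal_graded_lie TYPE('l) L \<and>
     (\<exists>\<Phi> \<iota>\<^sub>0 \<iota>\<^sub>1 \<iota>\<^sub>m.
        is_Phi P \<Phi> \<and>
        lin_iso (pg P) (homog_space L 0) \<iota>\<^sub>0 \<and>
        lin_iso (pV P) (homog_space L 1) \<iota>\<^sub>1 \<and>
        lin_iso (pW P) (homog_space L (-1)) \<iota>\<^sub>m \<and>
        (\<forall>a\<in>carr (pg P). \<forall>b\<in>carr (pg P). brkt L (\<iota>\<^sub>0 a) (\<iota>\<^sub>0 b) = \<iota>\<^sub>0 (brkt (pg P) a b)) \<and>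
        (\<forall>a\<in>carr (pg P). \<forall>v\<in>carr (pV P). brkt L (\<iota>\<^sub>0 a) (\<iota>\<^sub>1 v) = \<iota>\<^sub>1 (prho P a v)) \<and>
        (\<forall>a\<in>carr (pg P). \<forall>\<phi>\<in>carr (pW P). brkt L (\<iota>\<^sub>0 a) (\<iota>\<^sub>m \<phi>) = \<iota>\<^sub>m (pvarrho P a \<phi>)) \<and>
        (\<forall>v\<in>carr (pV P). \<forall>\<phi>\<in>carr (pW P). brkt L (\<iota>\<^sub>1 v) (\<iota>\<^sub>m \<phi>) = \<iota>\<^sub>0 (\<Phi> v \<phi>)))"

text \<open>
  The associated Lie algebra is unique up to isomorphism, and one representative is chosen. A graded
  Lie algebra with local part \<open>pW + pg + pV\<close> is spanned by iterated brackets
  \<open>[a\<^sub>1, [a\<^sub>2, \<dots>, a\<^sub>k]]\<close> with entries in \<open>pg\<close>, \<open>pV\<close>, \<open>pW\<close>, hence is linearly a quotient, and so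
  isomorphic to a subspace, of the free vector space on lists over \<open>'g + 'v + 'w\<close>. That type
  therefore hosts the associated Lie algebra and all its competitors.
\<close>

definition assoc_lie ::
  "('g::ab_group_add, 'v::ab_group_add, 'w::ab_group_add) pentad \<Rightarrow>
   (('g + 'v + 'w) list \<Rightarrow>\<^sub>0 complex) graded_lie"
where
  "assoc_lie P = (SOME L. is_assoc_lie P L)"


section \<open>The pentad of the theorem\<close>

type_synonym cmat2 = "complex^2^2"

definition mat_smul :: "complex \<Rightarrow> cmat2 \<Rightarrow> cmat2" where
  "mat_smul c A = (\<chi> i j. c * A $ i $ j)"

definition sl2 :: "cmat2 lie_alg" where
  "sl2 = \<lparr>smul = mat_smul, carr = {A. trace A = 0}, brkt = (\<lambda>A B. A ** B - B ** A)\<rparr>"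

definition line :: "cmat2 \<Rightarrow> cmat2 set" where
  "line z = {mat_smul c z | c. True}"

definition line_coord :: "cmat2 \<Rightarrow> cmat2 \<Rightarrow> complex" where
  "line_coord z u = (THE c. u = mat_smul c z)"

definition cartan :: "cmat2 \<Rightarrow> cmat2 lie_alg" where
  "cartan h = sl2\<lparr>carr := line h\<rparr>"

text \<open>
  The spaces with basis \<open>e\<^sub>i\<^sub>,\<^sub>j\<^sup>+\<close> and \<open>e\<^sub>i\<^sub>,\<^sub>j\<^sup>-\<close> are two copies of the free vector space on
  \<open>nat \<times> nat\<close>, both with \<open>(i, j)\<close>-th basis vector \<open>ebasis i j\<close>.
\<close>

type_synonym espace = "(nat \<times> nat) \<Rightarrow>\<^sub>0 complex"

definition ebasis :: "nat \<Rightarrow> nat \<Rightarrow> espace" where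
  "ebasis i j = Poly_Mapping.single (i, j) 1"

definition line_plus_espace :: "cmat2 \<Rightarrow> (cmat2 \<times> espace) cspace" where
  "line_plus_espace z =
     \<lparr>smul = (\<lambda>c (u, f). (mat_smul c u, Poly_Mapping.map ((*) c) f)), carr = line z \<times> UNIV\<rparr>"

definition rho_plus :: "cmat2 \<Rightarrow> cmat2 \<Rightarrow> espace \<Rightarrow> espace" where
  "rho_plus h a = Poly_Mapping.mapp (\<lambda>(i, j) c. line_coord h a * of_nat i * c)"

definition rho_minus :: "cmat2 \<Rightarrow> cmat2 \<Rightarrow> espace \<Rightarrow> espace" where
  "rho_minus h a = Poly_Mapping.mapp (\<lambda>(i, j) c. - (line_coord h a * of_nat i * c))"

definition sl2_pentad ::
  "cmat2 \<Rightarrow> cmat2 \<Rightarrow> cmat2 \<Rightarrow>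
   (cmat2, cmat2 \<times> espace, cmat2 \<times> espace) pentad"
where
  "sl2_pentad y h x =
     \<lparr>pg = cartan h,
      prho = (\<lambda>a (u, f). (brkt sl2 a u, rho_minus h a f)),
      pV = line_plus_espace x,
      pW = line_plus_espace y,
      pvarrho = (\<lambda>a (u, f). (brkt sl2 a u, rho_plus h a f)),
      ppair = (\<lambda>(u, f) (w, g). 4 * (line_coord x u * line_coord y w) +
                 (\<Sum>k\<in>Poly_Mapping.keys f. 4 * (Poly_Mapping.lookup f k * Poly_Mapping.lookup g k))),
      pB = killing_form sl2\<rparr>"

end

theory Submission
  imports Defs "HOL-Library.Function_Algebras"
begin

text \<open>
  A graded Lie algebra is minimal as soon as it is transitive, that is, has no nonzero graded
  subspaces that meet the local part trivially and are stable under it: the extension of a local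
  isomorphism is the subalgebra of the product generated by its graph, and the second components
  lying over \<open>0\<close> form such subspaces. It therefore suffices to find one transitive graded Lie
  algebra with the required local part on the type of the associated Lie algebra. The local part is
  realised by operators dual to those on two copies of the tensor algebra, where one of
  \<open>l\<^sub>1\<close>, \<open>l\<^sub>-\<^sub>1\<close> acts by left multiplication and the other by contraction; the graded Lie algebra
  generated by these operators has countable dimension, and dividing out its largest graded ideal
  that meets the local part trivially makes it transitive. Any two associated Lie algebras have
  isomorphic local parts because the form determines \<open>\<Phi>\<close>, so minimality against algebras on
  arbitrary types passes from the constructed algebra to the chosen one.
\<close>

section \<open>Elementary facts on Lie algebras\<close>

text \<open>\<open>assoc_lie\<close> chooses among algebras on one fixed type, so existence up to
  isomorphism is not enough: the algebra has to live on finitely supported functions over a given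
  infinite key type. This is why dimensions are counted at all, and why the quotient is realised as
  the image of a linear map with prescribed kernel that sends countably many basis vectors to
  distinct unit vectors. The obstacle in building any algebra with the given local part is that the
  generated algebra might collapse or lose its grading. Operators settle both: they act on all
  functions on words, where each is given by a formula at every word and no support has to be
  tracked; faithfulness of the local part is seen by evaluation at very short words, and the grading
  is recovered from the length of words.\<close>

locale lie_algebra =
  fixes L :: "('a::ab_group_add, 'm) lie_alg_scheme"
  assumes is_lie_alg: "is_lie_alg L"
begin

lemma is_vector_space: "vector_space (smul L)"
  using is_lie_alg by (simp add: is_lie_alg_def is_cspace_def)

sublocale vector_space "smul L"
  by (rule is_vector_space)

lemma subspace_carr: "subspace (carr L)"
  using is_lie_alg by (simp add: is_lie_alg_def is_cspace_def)

lemma brkt_closed: "a \<in> carr L \<Longrightarrow> b \<in> carr L \<Longrightarrow> brkt L a b \<in> carr L"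
  using is_lie_alg by (simp add: is_lie_alg_def bilin_map_def lin_map_def)

lemma brkt_add_right:
  "a \<in> carr L \<Longrightarrow> b \<in> carr L \<Longrightarrow> c \<in> carr L \<Longrightarrow> brkt L a (b + c) = brkt L a b + brkt L a c"
  using is_lie_alg by (simp add: is_lie_alg_def bilin_map_def lin_map_def)

lemma brkt_add_left:
  "a \<in> carr L \<Longrightarrow> b \<in> carr L \<Longrightarrow> c \<in> carr L \<Longrightarrow> brkt L (a + b) c = brkt L a c + brkt L b c"
  using is_lie_alg by (simp add: is_lie_alg_def bilin_map_def lin_map_def)

lemma brkt_scale_right:
  "a \<in> carr L \<Longrightarrow> b \<in> carr L \<Longrightarrow> brkt L a (smul L r b) = smul L r (brkt L a b)"
  using is_lie_alg by (simp add: is_lie_alg_def bilin_map_def lin_map_def)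

lemma brkt_scale_left:
  "a \<in> carr L \<Longrightarrow> b \<in> carr L \<Longrightarrow> brkt L (smul L r a) b = smul L r (brkt L a b)"
  using is_lie_alg by (simp add: is_lie_alg_def bilin_map_def lin_map_def)

lemma brkt_self: "a \<in> carr L \<Longrightarrow> brkt L a a = 0"
  using is_lie_alg by (simp add: is_lie_alg_def)

lemma brkt_zero_right: "a \<in> carr L \<Longrightarrow> brkt L a 0 = 0"
  using brkt_scale_right[of a 0 0] subspace_0[OF subspace_carr] by simp

lemma brkt_zero_left: "a \<in> carr L \<Longrightarrow> brkt L 0 a = 0"
  using brkt_scale_left[of 0 a 0] subspace_0[OF subspace_carr] by simp

lemma brkt_swap:
  assumes "a \<in> carr L" "b \<in> carr L"
  shows "brkt L a b = - brkt L b a"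
proof -
  have "brkt L (a + b) (a + b) = 0"
    using assms subspace_add[OF subspace_carr] by (simp add: brkt_self)
  then have "brkt L a b + brkt L b a = 0"
    using assms subspace_add[OF subspace_carr]
    by (simp add: brkt_add_left brkt_add_right brkt_self[OF assms(1)] brkt_self[OF assms(2)]
        add.commute)
  then show ?thesis by (simp add: eq_neg_iff_add_eq_0)
qed

lemma brkt_minus_right:
  "a \<in> carr L \<Longrightarrow> b \<in> carr L \<Longrightarrow> brkt L a (- b) = - brkt L a b"
  using brkt_scale_right[of a b "-1"] by simp

lemma brkt_diff_right:
  "a \<in> carr L \<Longrightarrow> b \<in> carr L \<Longrightarrow> c \<in> carr L \<Longrightarrow> brkt L a (b - c) = brkt L a b - brkt L a c"
  using brkt_add_right[of a b "- c"] brkt_minus_right[of a c] subspace_neg[OF subspace_carr, of c]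
  by simp

lemma jacobi:
  assumes "a \<in> carr L" "b \<in> carr L" "c \<in> carr L"
  shows "brkt L a (brkt L b c) = brkt L (brkt L a b) c + brkt L b (brkt L a c)"
proof -
  have "brkt L a (brkt L b c) + brkt L b (brkt L c a) + brkt L c (brkt L a b) = 0"
    using is_lie_alg assms by (simp add: is_lie_alg_def)
  moreover have "brkt L b (brkt L c a) = - brkt L b (brkt L a c)"
    using assms by (simp add: brkt_swap[of c a] brkt_minus_right brkt_closed)
  moreover have "brkt L c (brkt L a b) = - brkt L (brkt L a b) c"
    using assms by (simp add: brkt_swap[of c] brkt_closed)
  ultimately show ?thesis by (simp add: algebra_simps)
qed

lemma jacobi_left:
  assumes "a \<in> carr L" "b \<in> carr L" "c \<in> carr L"
  shows "brkt L (brkt L a b) c = brkt L a (brkt L b c) - brkt L b (brkt L a c)"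
  using jacobi[OF assms] by simp

lemma subspace_lie_subalg: "lie_subalg L S \<Longrightarrow> subspace S"
  by (simp add: lie_subalg_def)

lemma lie_subalg_carr: "lie_subalg L (carr L)"
  by (simp add: lie_subalg_def subspace_carr brkt_closed)

end

section \<open>Decomposition of elements of a span of subspaces\<close>

context vector_space
begin

text \<open>Two finite decompositions are added by padding both with zeros to the union of their
  index sets. The components belong to \<open>D n\<close> for every \<open>n\<close>, also outside
  \<open>N\<close>, so that later arguments need no case distinction on the index.\<close>

lemma span_UN_subspaces:
  assumes "\<And>n. subspace (D n)" and "u \<in> span (\<Union>n. D n)"
  obtains N v where "finite N" "\<And>n. v n \<in> D n" "u = (\<Sum>n\<in>N. v n)"
proof -
  let ?S = "{u. \<exists>N v. finite N \<and> (\<forall>n. v n \<in> D n) \<and> u = (\<Sum>n\<in>N. v n)}"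
  have "subspace ?S"
  proof (rule subspaceI)
    have "(\<forall>n. 0 \<in> D n)"
      using assms(1) by (simp add: subspace_0)
    then show "0 \<in> ?S"
      by (auto intro!: exI[of _ "{}"] exI[of _ "\<lambda>_. 0"])
  next
    fix x y assume "x \<in> ?S" "y \<in> ?S"
    then obtain N v M w where x: "finite N" "\<forall>n. v n \<in> D n" "x = (\<Sum>n\<in>N. v n)"
      and y: "finite M" "\<forall>n. w n \<in> D n" "y = (\<Sum>n\<in>M. w n)" by blast
    let ?z = "\<lambda>n. (if n \<in> N then v n else 0) + (if n \<in> M then w n else 0)"
    have "\<forall>n. ?z n \<in> D n"
      using x(2) y(2) assms(1) by (simp add: subspace_add subspace_0)
    moreover have "x + y = (\<Sum>n\<in>N \<union> M. ?z n)"
    proof -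
      have "x = (\<Sum>n\<in>N \<union> M. if n \<in> N then v n else 0)"
        unfolding x(3) using x(1) y(1) by (intro sum.mono_neutral_cong_left) auto
      moreover have "y = (\<Sum>n\<in>N \<union> M. if n \<in> M then w n else 0)"
        unfolding y(3) using x(1) y(1) by (intro sum.mono_neutral_cong_left) auto
      ultimately show ?thesis by (simp add: sum.distrib)
    qed
    ultimately show "x + y \<in> ?S"
      using x(1) y(1) by (intro CollectI exI[of _ "N \<union> M"] exI[of _ ?z]) auto
  next
    fix c x assume "x \<in> ?S"
    then obtain N v where x: "finite N" "\<forall>n. v n \<in> D n" "x = (\<Sum>n\<in>N. v n)" by blast
    then show "scale c x \<in> ?S"
      using assms(1)
      by (intro CollectI exI[of _ N] exI[of _ "\<lambda>n. scale c (v n)"])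
        (simp add: subspace_scale scale_sum_right)
  qed
  moreover have "(\<Union>n. D n) \<subseteq> ?S"
  proof
    fix x assume "x \<in> (\<Union>n. D n)"
    then obtain n where "x \<in> D n" by blast
    then show "x \<in> ?S"
      using assms(1)
      by (intro CollectI exI[of _ "{n}"] exI[of _ "\<lambda>k. if k = n then x else 0"])
        (simp add: subspace_0)
  qed
  ultimately have "span (\<Union>n. D n) \<subseteq> ?S" by (simp add: span_minimal)
  then show thesis using assms(2) that by blast
qed

end

section \<open>The graded subalgebra generated by a local Lie algebra\<close>

text \<open>The ambient algebra carries no grading, so the degree is an index of the relation. Rule
  \<open>step\<close> brackets only outwards, away from degree 0, and reaches only degrees of
  absolute value at least 2. Thus the local part is not enlarged by construction, and the work goes
  into showing that inward brackets stay inside.\<close>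

inductive local_gen :: "('a::ab_group_add, 'm) lie_alg_scheme \<Rightarrow> (int \<Rightarrow> 'a set) \<Rightarrow> int \<Rightarrow> 'a \<Rightarrow> bool"
  for L A where
  base: "i \<in> {-1, 0, 1} \<Longrightarrow> a \<in> A i \<Longrightarrow> local_gen L A i a"
| zero: "local_gen L A n 0"
| add: "local_gen L A n u \<Longrightarrow> local_gen L A n v \<Longrightarrow> local_gen L A n (u + v)"
| scale: "local_gen L A n u \<Longrightarrow> local_gen L A n (smul L c u)"
| step: "s \<in> {-1, 1} \<Longrightarrow> 1 \<le> s * n \<Longrightarrow> a \<in> A s \<Longrightarrow> local_gen L A n u \<Longrightarrow>
    local_gen L A (n + s) (brkt L a u)"

locale local_lie_algebra = lie_algebra L
  for L :: "('a::ab_group_add, 'm) lie_alg_scheme" +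
  fixes A :: "int \<Rightarrow> 'a set"
  assumes subspace_A: "i \<in> {-1, 0, 1} \<Longrightarrow> subspace (A i)"
    and A_subset: "i \<in> {-1, 0, 1} \<Longrightarrow> A i \<subseteq> carr L"
    and brkt_A: "i \<in> {-1, 0, 1} \<Longrightarrow> j \<in> {-1, 0, 1} \<Longrightarrow> i + j \<in> {-1, 0, 1} \<Longrightarrow>
      a \<in> A i \<Longrightarrow> b \<in> A j \<Longrightarrow> brkt L a b \<in> A (i + j)"
begin

lemma local_gen_carr: "local_gen L A n u \<Longrightarrow> u \<in> carr L"
proof (induction rule: local_gen.induct)
  case (base i a)
  then show ?case using A_subset by blast
next
  case (step s n a u)
  then have "a \<in> carr L" using A_subset[of s] by blast
  then show ?case using step.IH by (rule brkt_closed)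
qed (use subspace_carr in \<open>auto simp: subspace_0 subspace_add subspace_scale\<close>)

lemma subspace_local_gen: "subspace {u. local_gen L A n u}"
  by (rule subspaceI) (auto intro: local_gen.zero local_gen.add local_gen.scale)

lemma local_gen_diff: "local_gen L A n u \<Longrightarrow> local_gen L A n v \<Longrightarrow> local_gen L A n (u - v)"
  using subspace_diff[OF subspace_local_gen, of u n v] by simp

lemma local_gen_local: "local_gen L A n u \<Longrightarrow> n \<in> {-1, 0, 1} \<Longrightarrow> u \<in> A n"
proof (induction rule: local_gen.induct)
  case (step s n a u)
  then show ?case by (elim insertE) auto
qed (use subspace_A in \<open>auto simp: subspace_0 subspace_add subspace_scale\<close>)

text \<open>Induction over the generation of \<open>u\<close>, moving \<open>b\<close> past the
  outermost element by \<open>[b, [a, v]] = [[b, a], v] + [a, [b, v]]\<close>. For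
  \<open>i = 0\<close> and \<open>i = - s\<close> the bracket \<open>[b, a]\<close> is again local;
  for \<open>i = s\<close> the element \<open>b\<close> is just one more outward step.\<close>

lemma local_gen_brkt_local:
  assumes "local_gen L A n u" "i \<in> {-1, 0, 1}" "b \<in> A i"
  shows "local_gen L A (n + i) (brkt L b u)"
  using assms
proof (induction arbitrary: i b rule: local_gen.induct)
  case (base j a)
  show ?case
  proof (cases "i + j \<in> {-1, 0, 1}")
    case True
    then show ?thesis
      using brkt_A[OF base(3,1) True base(4,2)] local_gen.base[of "i + j"]
      by (simp add: add.commute)
  next
    \<comment> \<open>Two local degrees whose sum is not local are both 1 or both -1, so this
      bracket is an outward step.\<close>
    case False
    then have "i \<in> {-1, 1}" "1 \<le> i * j" using base(1,3) by auto
    then show ?thesis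
      using local_gen.step[of i j b A L a] local_gen.base[of j a A L] base(1,2,4) by simp
  qed
next
  case (zero n)
  then have "b \<in> carr L" using A_subset by blast
  then show ?case by (simp add: brkt_zero_right local_gen.zero)
next
  case (add n u v)
  then have "b \<in> carr L" using A_subset by blast
  then show ?case using add local_gen_carr by (simp add: brkt_add_right local_gen.add)
next
  case (scale n u c)
  then have "b \<in> carr L" using A_subset by blast
  then show ?case using scale local_gen_carr by (simp add: brkt_scale_right local_gen.scale)
next
  case (step s n a v)
  have s: "s \<in> {-1, 0, 1}" using step.hyps(1) by blast
  have carr: "b \<in> carr L" "a \<in> carr L" "v \<in> carr L"
    using A_subset[OF s] A_subset[OF step.prems(1)] step.hyps step.prems local_gen_carr by blast+
  consider "i = s" | "i = 0" | "i = - s" using step.prems(1) step.hyps(1) by auto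
  then show ?case
  proof cases
    case 1
    have "1 \<le> s * (n + s)" using step.hyps(1,2) by auto
    then show ?thesis
      using local_gen.step[of s "n + s" b A L "brkt L a v"] local_gen.step[of s n a A L v]
        step.hyps step.prems 1 by simp
  next
    case 2
    have "brkt L b a \<in> A (0 + s)"
      using brkt_A[of 0 s b a] s step.hyps(3) step.prems 2 by simp
    then have "local_gen L A (n + s) (brkt L (brkt L b a) v)"
      using local_gen.step[of s n "brkt L b a" A L v] step.hyps by simp
    moreover have "local_gen L A n (brkt L b v)"
      using step.IH[of 0 b] step.prems 2 by simp
    then have "local_gen L A (n + s) (brkt L a (brkt L b v))"
      using step.hyps by (intro local_gen.step)
    ultimately have "local_gen L A (n + s) (brkt L (brkt L b a) v + brkt L a (brkt L b v))"
      by (rule local_gen.add)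
    then show ?thesis using jacobi[of b a v] carr 2 by simp
  next
    case 3
    have i: "i \<in> {-1, 1}" using step.hyps(1) 3 by auto
    have "brkt L b a \<in> A 0"
      using brkt_A[of i s b a] s step.hyps(3) step.prems 3 by simp
    then have 1: "local_gen L A n (brkt L (brkt L b a) v)"
      using step.IH[of 0 "brkt L b a"] by simp
    have bv: "local_gen L A (n - s) (brkt L b v)"
      using step.IH[OF step.prems] 3 by simp
    \<comment> \<open>Here \<open>[b, v]\<close> has degree \<open>n - s\<close>. For
      \<open>n = s\<close> this is 0, where \<open>step\<close> does not apply; but then
      \<open>[b, v]\<close> lies in \<open>A 0\<close> and its bracket with \<open>a\<close> is
      local.\<close>
    have 2: "local_gen L A n (brkt L a (brkt L b v))"
    proof (cases "n = s")
      case True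
      then have "brkt L b v \<in> A 0" using local_gen_local[OF bv] by simp
      then have "brkt L a (brkt L b v) \<in> A (s + 0)"
        using brkt_A[OF s, of 0] s step.hyps(3) by simp
      then show ?thesis using local_gen.base[OF s] True by simp
    next
      case False
      then have "1 \<le> s * (n - s)" using step.hyps(1,2) by auto
      then show ?thesis using local_gen.step[of s "n - s" a A L "brkt L b v"] step.hyps(1,3) bv by simp
    qed
    show ?thesis using local_gen.add[OF 1 2] jacobi[of b a v] carr 3 by simp
  qed
qed

text \<open>Induction over the generation of the left factor:
  \<open>[[a, u], v] = [a, [u, v]] - [u, [a, v]]\<close> leaves only brackets with a local element
  and shorter left factors.\<close>

lemma local_gen_brkt:
  assumes "local_gen L A m u" "local_gen L A n v"
  shows "local_gen L A (m + n) (brkt L u v)"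
  using assms
proof (induction arbitrary: n v rule: local_gen.induct)
  case (base i a)
  then show ?case using local_gen_brkt_local[of n v i a] by (simp add: add.commute)
next
  case (zero m)
  then show ?case by (simp add: local_gen_carr brkt_zero_left local_gen.zero)
next
  case (add m u w)
  then show ?case
    using local_gen_carr by (simp add: brkt_add_left local_gen.add)
next
  case (scale m u c)
  then show ?case
    using local_gen_carr by (simp add: brkt_scale_left local_gen.scale)
next
  case (step s m a u)
  have s: "s \<in> {-1, 0, 1}" using step.hyps(1) by blast
  have "a \<in> carr L" "u \<in> carr L" "v \<in> carr L"
    using A_subset[OF s] step.hyps step.prems local_gen_carr by blast+
  then have "brkt L (brkt L a u) v = brkt L a (brkt L u v) - brkt L u (brkt L a v)"
    by (rule jacobi_left)
  moreover have "local_gen L A (m + n + s) (brkt L a (brkt L u v))"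
    using local_gen_brkt_local[OF step.IH[OF step.prems] s step.hyps(3)] .
  moreover have "local_gen L A (m + (n + s)) (brkt L u (brkt L a v))"
    using step.IH[OF local_gen_brkt_local[OF step.prems s step.hyps(3)]] .
  ultimately show ?case
    using local_gen_diff by (simp add: add.assoc add.commute[of n s])
qed

definition gen_carr :: "'a set" where
  "gen_carr = span (\<Union>n. {u. local_gen L A n u})"

lemma gen_carr_subset: "gen_carr \<subseteq> carr L"
  unfolding gen_carr_def using subspace_carr local_gen_carr by (intro span_minimal) auto

lemma local_gen_gen_carr: "local_gen L A n u \<Longrightarrow> u \<in> gen_carr"
  unfolding gen_carr_def by (intro span_base) auto

lemma subspace_gen_carr: "subspace gen_carr"
  unfolding gen_carr_def by (rule subspace_span)

lemma gen_carr_brkt: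
  assumes "u \<in> gen_carr" "v \<in> gen_carr"
  shows "brkt L u v \<in> gen_carr"
proof -
  \<comment> \<open>Membership in the carrier is part of the induction claim, since linearity of the
    bracket is available only there.\<close>
  have 1: "v \<in> carr L \<and> brkt L u v \<in> gen_carr" if u: "local_gen L A m u" and v: "v \<in> gen_carr"
    for m u v
    using v[unfolded gen_carr_def]
  proof (induction rule: span_induct_alt)
    case base
    then show ?case
      using local_gen_carr[OF u] subspace_0[OF subspace_carr] subspace_0[OF subspace_gen_carr]
      by (simp add: brkt_zero_right)
  next
    case (step c x y)
    then obtain n where x: "local_gen L A n x" by blast
    have "brkt L u (smul L c x + y) = smul L c (brkt L u x) + brkt L u y"
      using local_gen_carr[OF u] local_gen_carr[OF x] step subspace_scale[OF subspace_carr]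
      by (simp add: brkt_add_right brkt_scale_right)
    moreover have "brkt L u x \<in> gen_carr"
      using local_gen_brkt[OF u x] by (rule local_gen_gen_carr)
    ultimately show ?case
      using step local_gen_carr[OF x] subspace_gen_carr subspace_carr
      by (simp add: subspace_add subspace_scale)
  qed
  have v: "v \<in> carr L" using assms(2) gen_carr_subset by blast
  have "u \<in> carr L \<and> brkt L u v \<in> gen_carr"
    using assms(1)[unfolded gen_carr_def]
  proof (induction rule: span_induct_alt)
    case base
    then show ?case
      using v subspace_0[OF subspace_carr] subspace_0[OF subspace_gen_carr]
      by (simp add: brkt_zero_left)
  next
    case (step c x y)
    then obtain n where x: "local_gen L A n x" by blast
    have "brkt L (smul L c x + y) v = smul L c (brkt L x v) + brkt L y v"
      using local_gen_carr[OF x] step v subspace_scale[OF subspace_carr]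
      by (simp add: brkt_add_left brkt_scale_left)
    then show ?case
      using step 1[OF x assms(2)] local_gen_carr[OF x] subspace_gen_carr subspace_carr
      by (simp add: subspace_add subspace_scale)
  qed
  then show ?thesis by blast
qed

lemma lie_subalg_gen_carr: "lie_subalg L gen_carr"
  by (simp add: lie_subalg_def gen_carr_subset subspace_gen_carr gen_carr_brkt)

lemma local_gen_in_subalg:
  assumes "lie_subalg L S" "\<And>i. i \<in> {-1, 0, 1} \<Longrightarrow> A i \<subseteq> S" "local_gen L A n u"
  shows "u \<in> S"
  using assms(3)
proof (induction rule: local_gen.induct)
  case (base i a)
  then show ?case using assms(2) by blast
next
  case (step s n a u)
  then have "a \<in> S" using assms(2)[of s] by blast
  then show ?case using assms(1) step.IH by (simp add: lie_subalg_def)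
qed (use subspace_lie_subalg[OF assms(1)] in \<open>auto simp: subspace_0 subspace_add subspace_scale\<close>)

lemma gen_carr_minimal:
  assumes "lie_subalg L S" "\<And>i. i \<in> {-1, 0, 1} \<Longrightarrow> A i \<subseteq> S"
  shows "gen_carr \<subseteq> S"
  unfolding gen_carr_def
  using local_gen_in_subalg[OF assms] subspace_lie_subalg[OF assms(1)]
  by (intro span_minimal) auto

end

section \<open>Transitive graded Lie algebras are minimal\<close>

locale graded_lie_algebra =
  fixes L :: "('a::ab_group_add, 'm) graded_lie_scheme"
  assumes is_graded_lie: "is_graded_lie L"
begin

lemma is_lie: "is_lie_alg L"
  using is_graded_lie by (simp add: is_graded_lie_def)

sublocale lie_algebra L
  by unfold_locales (rule is_lie)

lemma subspace_homog: "subspace (homog L n)"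
  using is_graded_lie by (simp add: is_graded_lie_def)

lemma carr_eq: "carr L = span (\<Union>n. homog L n)"
  using is_graded_lie by (simp add: is_graded_lie_def)

lemma homog_subset: "homog L n \<subseteq> carr L"
  unfolding carr_eq using span_superset[of "\<Union>n. homog L n"] by blast

lemma homog_carr: "a \<in> homog L n \<Longrightarrow> a \<in> carr L"
  using homog_subset by blast

lemma brkt_homog: "a \<in> homog L n \<Longrightarrow> b \<in> homog L m \<Longrightarrow> brkt L a b \<in> homog L (n + m)"
  using is_graded_lie by (simp add: is_graded_lie_def)

lemma homog_independent:
  "finite N \<Longrightarrow> (\<And>n. n \<in> N \<Longrightarrow> v n \<in> homog L n) \<Longrightarrow> (\<Sum>n\<in>N. v n) = 0 \<Longrightarrow> n \<in> N \<Longrightarrow> v n = 0"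
  using is_graded_lie unfolding is_graded_lie_def by blast

lemma generated: "lie_generated L (carr (local_part L)) = carr L"
  using is_graded_lie by (simp add: is_graded_lie_def)

sublocale local_lie_algebra L "homog L"
  by unfold_locales (auto simp: subspace_homog homog_carr brkt_homog)

lemma carr_local_part: "carr (local_part L) = span (\<Union>n\<in>{-1, 0, 1}. homog L n)"
  by (simp add: local_part_def)

lemma smul_local_part: "smul (local_part L) = smul L"
  by (simp add: local_part_def)

lemma homog_local_part: "i \<in> {-1, 0, 1} \<Longrightarrow> a \<in> homog L i \<Longrightarrow> a \<in> carr (local_part L)"
  unfolding carr_local_part by (rule span_base) blast

lemma carr_subset_subalg:
  assumes "lie_subalg L S" "\<And>i. i \<in> {-1, 0, 1} \<Longrightarrow> homog L i \<subseteq> S"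
  shows "carr L \<subseteq> S"
proof -
  have "carr (local_part L) \<subseteq> S"
    unfolding carr_local_part using assms subspace_lie_subalg[OF assms(1)]
    by (intro span_minimal) auto
  then show ?thesis
    using assms(1) generated unfolding lie_generated_def by blast
qed

lemma gen_carr_eq: "gen_carr = carr L"
proof
  show "carr L \<subseteq> gen_carr"
    by (rule carr_subset_subalg[OF lie_subalg_gen_carr])
      (auto intro: local_gen_gen_carr local_gen.base)
qed (rule gen_carr_subset)

end

text \<open>The \<open>K n\<close> are arbitrary sets rather than subspaces: stability passes to
  spans, so for a graded Lie algebra the condition is the same, and its applications owe no closure
  proof.\<close>

definition transitive_graded :: "('a::ab_group_add, 'm) graded_lie_scheme \<Rightarrow> bool" where
  "transitive_graded L \<longleftrightarrow>
     (\<forall>K. (\<forall>n. K n \<subseteq> homog L n) \<and> (\<forall>i\<in>{-1, 0, 1}. K i \<subseteq> {0}) \<and>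
          (\<forall>i\<in>{-1, 0, 1}. \<forall>n. \<forall>a\<in>homog L i. \<forall>u\<in>K n. brkt L a u \<in> K (n + i)) \<longrightarrow>
          (\<forall>n. K n \<subseteq> {0}))"

lemma transitive_gradedD:
  assumes "transitive_graded L" "\<And>n. K n \<subseteq> homog L n" "\<And>i. i \<in> {-1, 0, 1} \<Longrightarrow> K i \<subseteq> {0}"
    and "\<And>i n a u. i \<in> {-1, 0, 1} \<Longrightarrow> a \<in> homog L i \<Longrightarrow> u \<in> K n \<Longrightarrow> brkt L a u \<in> K (n + i)"
  shows "K n \<subseteq> {0}"
  using assms(1)[unfolded transitive_graded_def, rule_format, of K n] assms(2-4) by blast

definition lie_prod ::
  "('a::ab_group_add, 'm) lie_alg_scheme \<Rightarrow> ('b::ab_group_add, 'n) lie_alg_scheme \<Rightarrow> ('a \<times> 'b) lie_alg"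
where
  "lie_prod L M =
     \<lparr>smul = (\<lambda>c p. (smul L c (fst p), smul M c (snd p))), carr = carr L \<times> carr M,
      brkt = (\<lambda>p q. (brkt L (fst p) (fst q), brkt M (snd p) (snd q)))\<rparr>"

lemma is_lie_alg_lie_prod:
  assumes "is_lie_alg L" "is_lie_alg M"
  shows "is_lie_alg (lie_prod L M)"
proof -
  interpret L: lie_algebra L by unfold_locales fact
  interpret M: lie_algebra M by unfold_locales fact
  interpret P: vector_space "\<lambda>c p. (smul L c (fst p), smul M c (snd p))"
    by unfold_locales
      (simp_all add: prod_eq_iff L.scale_right_distrib L.scale_left_distrib
        M.scale_right_distrib M.scale_left_distrib)
  have "P.subspace (carr L \<times> carr M)"
    using L.subspace_carr M.subspace_carr
    by (intro P.subspaceI)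
      (auto simp: zero_prod_def L.subspace_0 M.subspace_0 L.subspace_add M.subspace_add
        L.subspace_scale M.subspace_scale)
  then have "is_cspace (lie_prod L M)"
    by (simp add: is_cspace_def lie_prod_def P.vector_space_axioms)
  moreover have "bilin_map (lie_prod L M) (lie_prod L M) (lie_prod L M) (brkt (lie_prod L M))"
    by (auto simp: bilin_map_def lin_map_def lie_prod_def
        L.brkt_closed L.brkt_add_left L.brkt_add_right L.brkt_scale_left L.brkt_scale_right
        M.brkt_closed M.brkt_add_left M.brkt_add_right M.brkt_scale_left M.brkt_scale_right)
  moreover have "\<forall>a\<in>carr (lie_prod L M). brkt (lie_prod L M) a a = 0"
    by (auto simp: lie_prod_def L.brkt_self M.brkt_self zero_prod_def)
  moreover have "\<forall>a\<in>carr (lie_prod L M). \<forall>b\<in>carr (lie_prod L M). \<forall>c\<in>carr (lie_prod L M).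
     brkt (lie_prod L M) a (brkt (lie_prod L M) b c) +
     brkt (lie_prod L M) b (brkt (lie_prod L M) c a) +
     brkt (lie_prod L M) c (brkt (lie_prod L M) a b) = 0"
    using assms by (auto simp: lie_prod_def is_lie_alg_def zero_prod_def)
  ultimately show ?thesis by (simp add: is_lie_alg_def)
qed

text \<open>
  The extension of a local isomorphism is the relation generated by its graph in the product of the
  two algebras; transitivity makes this relation single-valued.
\<close>

lemma transitive_graded_imp_minimal:
  fixes L :: "('a::ab_group_add, 'm) graded_lie_scheme"
  assumes grL: "is_graded_lie L" and trans: "transitive_graded L"
  shows "minimal_graded_lie TYPE('d::ab_group_add) L"
  unfolding minimal_graded_lie_def
proof (intro conjI allI impI)
  show "is_graded_lie L" by fact
next
  fix L' :: "'d graded_lie" and f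
  assume "is_graded_lie L' \<and> local_iso L' L f"
  then have grL': "is_graded_lie L'" and iso: "local_iso L' L f" by auto
  interpret L: graded_lie_algebra L by unfold_locales fact
  interpret M: graded_lie_algebra L' by unfold_locales fact
  define P where "P = lie_prod L' L"
  have sP: "smul P c (a, b) = (smul L' c a, smul L c b)" for c a b
    by (simp add: P_def lie_prod_def)
  have bP: "brkt P (a, b) (c, d) = (brkt L' a c, brkt L b d)" for a b c d
    by (simp add: P_def lie_prod_def)
  have cP: "carr P = carr L' \<times> carr L"
    by (simp add: P_def lie_prod_def)
  have fim: "f ` homog L' i = homog L i" if "i \<in> {-1, 0, 1}" for i
    using iso that unfolding local_iso_def by blast
  have fh: "f a \<in> homog L i" if "i \<in> {-1, 0, 1}" "a \<in> homog L' i" for i a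
    using fim that by blast
  have lin: "lin_map (local_part L') (local_part L) f"
    using iso by (simp add: local_iso_def lin_iso_def)
  have fadd: "f (u + v) = f u + f v"
    if "u \<in> carr (local_part L')" "v \<in> carr (local_part L')" for u v
    using lin that by (simp add: lin_map_def)
  have fscale: "f (smul L' c u) = smul L c (f u)" if "u \<in> carr (local_part L')" for c u
    using lin that by (simp add: lin_map_def L.smul_local_part M.smul_local_part)
  have f0: "f 0 = 0"
    using fscale[of 0 0] M.span_zero M.carr_local_part by simp
  have fbrkt: "f (brkt L' a b) = brkt L (f a) (f b)"
    if "i \<in> {-1, 0, 1}" "j \<in> {-1, 0, 1}" "i + j \<in> {-1, 0, 1}" "a \<in> homog L' i" "b \<in> homog L' j"
    for i j a b
    using iso that unfolding local_iso_def by blast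
  \<comment> \<open>The graph of \<open>f\<close>, degree by degree; \<open>fbrkt\<close> says
    exactly that it is closed under the local brackets of the product.\<close>
  define A where "A i = (\<lambda>a. (a, f a)) ` homog L' i" for i
  interpret P: lie_algebra P
    unfolding P_def by unfold_locales (intro is_lie_alg_lie_prod L.is_lie M.is_lie)
  interpret P: local_lie_algebra P A
  proof unfold_locales
    fix i :: int assume i: "i \<in> {-1, 0, 1}"
    note loc = M.homog_local_part[OF i]
    show "P.subspace (A i)"
    proof (rule P.subspaceI)
      show "0 \<in> A i"
        using f0 M.subspace_0[OF M.subspace_homog] by (auto simp: A_def zero_prod_def image_iff)
    next
      fix x y assume "x \<in> A i" "y \<in> A i"
      then obtain a b where "x = (a, f a)" "y = (b, f b)" "a \<in> homog L' i" "b \<in> homog L' i"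
        unfolding A_def by blast
      then show "x + y \<in> A i"
        using fadd[OF loc loc] M.subspace_add[OF M.subspace_homog] by (auto simp: A_def image_iff)
    next
      fix c x assume "x \<in> A i"
      then obtain a where "x = (a, f a)" "a \<in> homog L' i"
        unfolding A_def by blast
      then show "smul P c x \<in> A i"
        using fscale[OF loc] M.subspace_scale[OF M.subspace_homog] by (auto simp: A_def sP image_iff)
    qed
    show "A i \<subseteq> carr P"
      using L.homog_carr[OF fh[OF i]] M.homog_carr by (auto simp: A_def cP)
  next
    fix i j :: int and a b
    assume ij: "i \<in> {-1, 0, 1}" "j \<in> {-1, 0, 1}" "i + j \<in> {-1, 0, 1}" "a \<in> A i" "b \<in> A j"
    then obtain u v where uv: "u \<in> homog L' i" "v \<in> homog L' j" "a = (u, f u)" "b = (v, f v)"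
      unfolding A_def by blast
    show "brkt P a b \<in> A (i + j)"
      using fbrkt[OF ij(1-3) uv(1,2)] M.brkt_homog[OF uv(1,2)] uv(3,4)
      by (simp add: A_def bP image_iff)
  qed
  have deg: "fst p \<in> homog L' n \<and> snd p \<in> homog L n" if "local_gen P A n p" for n p
    using that
  proof (induction rule: local_gen.induct)
    case (base i a)
    then show ?case using fh[OF base(1)] by (auto simp: A_def)
  next
    case (step s n a p)
    then have "s \<in> {-1, 0, 1}" by blast
    then have "fst a \<in> homog L' s" "snd a \<in> homog L s"
      using step.hyps(3) fh by (auto simp: A_def)
    then have "brkt L' (fst a) (fst p) \<in> homog L' (s + n)" "brkt L (snd a) (snd p) \<in> homog L (s + n)"
      using step.IH M.brkt_homog L.brkt_homog by blast+
    then show ?case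
      using bP[of "fst a" "snd a" "fst p" "snd p"] by (simp add: add.commute)
  qed (auto simp: M.subspace_homog L.subspace_homog M.subspace_0 L.subspace_0 M.subspace_add
      L.subspace_add M.subspace_scale L.subspace_scale sP)
  have sv: "v = 0" if "local_gen P A n (0, v)" for n v
  proof -
    have "(\<lambda>n. {v. local_gen P A n (0, v)}) n \<subseteq> {0}"
    proof (rule transitive_gradedD[OF trans])
      fix n show "{v. local_gen P A n (0, v)} \<subseteq> homog L n"
        using deg by fastforce
    next
      fix i :: int assume i: "i \<in> {-1, 0, 1}"
      then show "{v. local_gen P A i (0, v)} \<subseteq> {0}"
        using P.local_gen_local[OF _ i] f0 by (fastforce simp: A_def)
    next
      fix i n :: int and a u
      assume i: "i \<in> {-1, 0, 1}" and a: "a \<in> homog L i" and u: "u \<in> {v. local_gen P A n (0, v)}"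
      \<comment> \<open>Every \<open>a\<close> lifts to an element \<open>(b, a)\<close> of the
        graph, and a bracket with it keeps the first component 0.\<close>
      from a obtain b where b: "b \<in> homog L' i" "a = f b" using fim[OF i] by blast
      then have "local_gen P A (n + i) (brkt P (b, a) (0, u))"
        using u i by (intro P.local_gen_brkt_local) (auto simp: A_def)
      then show "brkt L a u \<in> {v. local_gen P A (n + i) (0, v)}"
        using M.homog_carr[OF b(1)] by (simp add: bP M.brkt_zero_right)
    qed
    then show ?thesis using that by blast
  qed
  \<comment> \<open>The grading of \<open>L'\<close> is direct, so each homogeneous component of
    \<open>(0, v)\<close> has first component 0 as well, and \<open>sv\<close> applies to
    it.\<close>
  have single: "v = 0" if gv: "(0, v) \<in> P.gen_carr" for v
  proof -
    obtain N w where w: "finite N" "\<And>n. w n \<in> {p. local_gen P A n p}" "(0, v) = (\<Sum>n\<in>N. w n)"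
      using P.span_UN_subspaces[OF P.subspace_local_gen gv[unfolded P.gen_carr_def]] by blast
    have "(\<Sum>n\<in>N. fst (w n)) = 0"
      using arg_cong[OF w(3), of fst] by (simp add: fst_sum)
    then have "fst (w n) = 0" if "n \<in> N" for n
      using M.homog_independent[OF w(1), of "\<lambda>n. fst (w n)"] deg w(2) that by blast
    then have "snd (w n) = 0" if "n \<in> N" for n
      using sv[of n "snd (w n)"] w(2)[of n] that by (metis mem_Collect_eq prod.collapse)
    then show ?thesis
      using arg_cong[OF w(3), of snd] by (simp add: snd_sum)
  qed
  define F where "F u = (THE v. (u, v) \<in> P.gen_carr)" for u
  have uniq: "v = w" if "(u, v) \<in> P.gen_carr" "(u, w) \<in> P.gen_carr" for u v w
    using single[of "v - w"] P.subspace_diff[OF P.subspace_gen_carr that] by simp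
  have Feq: "F u = v" if "(u, v) \<in> P.gen_carr" for u v
    unfolding F_def using that uniq by blast
  \<comment> \<open>Both projections of the generated subalgebra are subalgebras that contain the
    local parts. As \<open>L'\<close> and \<open>L\<close> are generated by these, the relation is
    total on \<open>L'\<close> and onto \<open>L\<close>.\<close>
  have sub1: "lie_subalg L' (fst ` P.gen_carr)"
    unfolding lie_subalg_def
  proof (intro conjI ballI)
    show "fst ` P.gen_carr \<subseteq> carr L'" using P.gen_carr_subset by (auto simp: cP)
    show "M.subspace (fst ` P.gen_carr)"
    proof (rule M.subspaceI)
      show "0 \<in> fst ` P.gen_carr"
        using P.subspace_0[OF P.subspace_gen_carr] by (metis fst_zero image_eqI)
      fix x y assume "x \<in> fst ` P.gen_carr" "y \<in> fst ` P.gen_carr"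
      then show "x + y \<in> fst ` P.gen_carr"
        using P.subspace_add[OF P.subspace_gen_carr] by (metis (no_types, lifting) fst_add imageE image_eqI)
    next
      fix c x assume "x \<in> fst ` P.gen_carr"
      then obtain y where "(x, y) \<in> P.gen_carr" by force
      from P.subspace_scale[OF P.subspace_gen_carr this, of c]
      show "smul L' c x \<in> fst ` P.gen_carr" by (force simp: sP)
    qed
    fix a b assume "a \<in> fst ` P.gen_carr" "b \<in> fst ` P.gen_carr"
    then obtain c d where "(a, c) \<in> P.gen_carr" "(b, d) \<in> P.gen_carr" by force
    from P.gen_carr_brkt[OF this] show "brkt L' a b \<in> fst ` P.gen_carr" by (force simp: bP)
  qed
  have sub2: "lie_subalg L (snd ` P.gen_carr)"
    unfolding lie_subalg_def
  proof (intro conjI ballI)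
    show "snd ` P.gen_carr \<subseteq> carr L" using P.gen_carr_subset by (auto simp: cP)
    show "L.subspace (snd ` P.gen_carr)"
    proof (rule L.subspaceI)
      show "0 \<in> snd ` P.gen_carr"
        using P.subspace_0[OF P.subspace_gen_carr] by (metis snd_zero image_eqI)
      fix x y assume "x \<in> snd ` P.gen_carr" "y \<in> snd ` P.gen_carr"
      then show "x + y \<in> snd ` P.gen_carr"
        using P.subspace_add[OF P.subspace_gen_carr] by (metis (no_types, lifting) snd_add imageE image_eqI)
    next
      fix c x assume "x \<in> snd ` P.gen_carr"
      then obtain y where "(y, x) \<in> P.gen_carr" by force
      from P.subspace_scale[OF P.subspace_gen_carr this, of c]
      show "smul L c x \<in> snd ` P.gen_carr" by (force simp: sP)
    qed
    fix a b assume "a \<in> snd ` P.gen_carr" "b \<in> snd ` P.gen_carr"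
    then obtain c d where "(c, a) \<in> P.gen_carr" "(d, b) \<in> P.gen_carr" by force
    from P.gen_carr_brkt[OF this] show "brkt L a b \<in> snd ` P.gen_carr" by (force simp: bP)
  qed
  have loc: "(a, f a) \<in> P.gen_carr" if "i \<in> {-1, 0, 1}" "a \<in> homog L' i" for i a
    using that by (intro P.local_gen_gen_carr[of i] local_gen.base) (auto simp: A_def)
  have "carr L' \<subseteq> fst ` P.gen_carr"
    by (rule M.carr_subset_subalg[OF sub1]) (use loc in force)
  then have ex: "\<exists>v. (u, v) \<in> P.gen_carr" if "u \<in> carr L'" for u
    using that by force
  have onto: "carr L \<subseteq> snd ` P.gen_carr"
  proof (rule L.carr_subset_subalg[OF sub2])
    fix i :: int assume i: "i \<in> {-1, 0, 1}"
    show "homog L i \<subseteq> snd ` P.gen_carr"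
    proof
      fix b assume "b \<in> homog L i"
      then obtain a where "a \<in> homog L' i" "b = f a" using fim[OF i] by blast
      then show "b \<in> snd ` P.gen_carr" using loc[OF i] by (intro image_eqI[of _ _ "(a, b)"]) auto
    qed
  qed
  have FG: "(u, F u) \<in> P.gen_carr" if "u \<in> carr L'" for u
    using ex[OF that] Feq by blast
  have "lie_hom L' L F"
    unfolding lie_hom_def lin_map_def
  proof (intro conjI ballI allI)
    fix u v c assume u: "u \<in> carr L'"
    show "F u \<in> carr L" using FG[OF u] P.gen_carr_subset by (auto simp: cP)
    show "F (smul L' c u) = smul L c (F u)"
      using P.subspace_scale[OF P.subspace_gen_carr FG[OF u], of c] by (intro Feq) (simp add: sP)
    assume v: "v \<in> carr L'"
    show "F (u + v) = F u + F v"
      using P.subspace_add[OF P.subspace_gen_carr FG[OF u] FG[OF v]] by (intro Feq) simp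
    show "F (brkt L' u v) = brkt L (F u) (F v)"
      using P.gen_carr_brkt[OF FG[OF u] FG[OF v]] by (intro Feq) (simp add: bP)
  qed
  moreover have "F ` carr L' = carr L"
  proof
    show "F ` carr L' \<subseteq> carr L"
      using FG P.gen_carr_subset by (fastforce simp: cP)
    show "carr L \<subseteq> F ` carr L'"
    proof
      fix b assume "b \<in> carr L"
      then obtain a where a: "(a, b) \<in> P.gen_carr" using onto by force
      then show "b \<in> F ` carr L'"
        using Feq[OF a] P.gen_carr_subset by (auto simp: cP)
    qed
  qed
  moreover have "\<forall>a\<in>carr (local_part L'). F a = f a"
  proof
    fix a assume "a \<in> carr (local_part L')"
    then have "a \<in> M.span (\<Union>n\<in>{-1, 0, 1}. homog L' n)" by (simp add: M.carr_local_part)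
    then have "a \<in> carr (local_part L') \<and> (a, f a) \<in> P.gen_carr"
    proof (induction rule: M.span_induct_alt)
      case base
      have "(0, 0) \<in> P.gen_carr"
        using P.subspace_0[OF P.subspace_gen_carr] by (simp add: zero_prod_def)
      then show ?case using f0 by (simp add: M.carr_local_part M.span_zero)
    next
      case (step c x y)
      then obtain i where i: "i \<in> {-1, 0, 1}" "x \<in> homog L' i" by blast
      note x = M.homog_local_part[OF i]
      have cx: "smul L' c x \<in> carr (local_part L')"
        using x by (simp add: M.carr_local_part M.span_scale)
      have "smul P c (x, f x) + (y, f y) \<in> P.gen_carr"
        using step(2) loc[OF i]
        by (intro P.subspace_add[OF P.subspace_gen_carr] P.subspace_scale[OF P.subspace_gen_carr]) auto
      then show ?case
        using step(2) x cx fadd[OF cx] fscale[OF x]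
        by (auto simp: sP M.carr_local_part M.span_add)
    qed
    then show "F a = f a" using Feq by blast
  qed
  ultimately show "\<exists>F. lie_hom L' L F \<and> F ` carr L' = carr L \<and>
      (\<forall>a\<in>carr (local_part L'). F a = f a)" by blast
qed

section \<open>The transitive quotient of a graded Lie algebra\<close>

text \<open>The largest graded ideal that meets the local part trivially, as a greatest fixed point:
  a homogeneous \<open>u\<close> belongs to it when neither \<open>u\<close> nor any iterated
  bracket of it with local elements is nonzero in degree -1, 0 or 1. Stability is demanded under
  local elements; stability under the whole algebra follows because they generate it.\<close>

coinductive local_null :: "('a::ab_group_add, 'm) graded_lie_scheme \<Rightarrow> int \<Rightarrow> 'a \<Rightarrow> bool" for L where
  local_nullI: "u \<in> homog L n \<Longrightarrow> (n \<in> {-1, 0, 1} \<Longrightarrow> u = 0) \<Longrightarrow>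
    (\<And>i a. i \<in> {-1, 0, 1} \<Longrightarrow> a \<in> homog L i \<Longrightarrow> local_null L (n + i) (brkt L a u)) \<Longrightarrow>
    local_null L n u"

context graded_lie_algebra
begin

lemma local_null_homog: "local_null L n u \<Longrightarrow> u \<in> homog L n"
  by (erule local_null.cases) simp

lemma local_null_local: "local_null L n u \<Longrightarrow> n \<in> {-1, 0, 1} \<Longrightarrow> u = 0"
  by (erule local_null.cases) simp

lemma local_null_brkt_local:
  "local_null L n u \<Longrightarrow> i \<in> {-1, 0, 1} \<Longrightarrow> a \<in> homog L i \<Longrightarrow> local_null L (n + i) (brkt L a u)"
  by (erule local_null.cases) simp

lemma local_null_carr: "local_null L n u \<Longrightarrow> u \<in> carr L"
  using local_null_homog homog_carr by blast

lemma local_null_coinduct: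
  assumes "X n u"
    and "\<And>n u. X n u \<Longrightarrow> u \<in> homog L n"
    and "\<And>n u. X n u \<Longrightarrow> n \<in> {-1, 0, 1} \<Longrightarrow> u = 0"
    and "\<And>n u i a. X n u \<Longrightarrow> i \<in> {-1, 0, 1} \<Longrightarrow> a \<in> homog L i \<Longrightarrow> X (n + i) (brkt L a u)"
  shows "local_null L n u"
  using assms(1)
proof (coinduction arbitrary: n u rule: local_null.coinduct)
  case local_null
  then show ?case using assms(2-4)[of n u] by blast
qed

lemma subspace_local_null: "subspace {u. local_null L n u}"
proof (rule subspaceI)
  have "local_null L n 0"
    by (rule local_null_coinduct[where X = "\<lambda>n u. u = 0"])
      (auto simp: subspace_0 subspace_homog homog_carr brkt_zero_right)
  then show "0 \<in> {u. local_null L n u}" by simp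
next
  fix x y assume "x \<in> {u. local_null L n u}" "y \<in> {u. local_null L n u}"
  then have "\<exists>u v. x + y = u + v \<and> local_null L n u \<and> local_null L n v" by blast
  then have "local_null L n (x + y)"
  proof (rule local_null_coinduct[where X = "\<lambda>n w. \<exists>u v. w = u + v \<and> local_null L n u \<and> local_null L n v"])
    fix n w i a
    assume "\<exists>u v. w = u + v \<and> local_null L n u \<and> local_null L n v"
      and i: "i \<in> {-1, 0, 1}" and a: "a \<in> homog L i"
    then obtain u v where w: "w = u + v" "local_null L n u" "local_null L n v" by blast
    then have "brkt L a w = brkt L a u + brkt L a v"
      using homog_carr[OF a] local_null_carr by (simp add: brkt_add_right)
    then show "\<exists>u v. brkt L a w = u + v \<and> local_null L (n + i) u \<and> local_null L (n + i) v"
      using local_null_brkt_local[OF w(2) i a] local_null_brkt_local[OF w(3) i a] by blast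
  next
    fix n w
    assume "\<exists>u v. w = u + v \<and> local_null L n u \<and> local_null L n v"
    then obtain u v where w: "w = u + v" "local_null L n u" "local_null L n v" by blast
    then show "w \<in> homog L n"
      using local_null_homog subspace_add[OF subspace_homog] by blast
    assume "n \<in> {-1, 0, 1}"
    then have "u = 0" "v = 0" using w(2,3) local_null_local by blast+
    then show "w = 0" using w(1) by simp
  qed
  then show "x + y \<in> {u. local_null L n u}" by simp
next
  fix c x assume "x \<in> {u. local_null L n u}"
  then have "\<exists>u. smul L c x = smul L c u \<and> local_null L n u" by blast
  then have "local_null L n (smul L c x)"
  proof (rule local_null_coinduct[where X = "\<lambda>n w. \<exists>u. w = smul L c u \<and> local_null L n u"])
    fix n w i a
    assume "\<exists>u. w = smul L c u \<and> local_null L n u"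
      and i: "i \<in> {-1, 0, 1}" and a: "a \<in> homog L i"
    then obtain u where w: "w = smul L c u" "local_null L n u" by blast
    then have "brkt L a w = smul L c (brkt L a u)"
      using homog_carr[OF a] local_null_carr by (simp add: brkt_scale_right)
    then show "\<exists>u. brkt L a w = smul L c u \<and> local_null L (n + i) u"
      using local_null_brkt_local[OF w(2) i a] by blast
  next
    fix n w
    assume "\<exists>u. w = smul L c u \<and> local_null L n u"
    then obtain u where w: "w = smul L c u" "local_null L n u" by blast
    then show "w \<in> homog L n"
      using local_null_homog subspace_scale[OF subspace_homog] by blast
    assume "n \<in> {-1, 0, 1}"
    then have "u = 0" using w(2) local_null_local by blast
    then show "w = 0" using w(1) by simp
  qed
  then show "smul L c x \<in> {u. local_null L n u}" by simp
qed

lemma local_null_add: "local_null L n u \<Longrightarrow> local_null L n v \<Longrightarrow> local_null L n (u + v)"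
  using subspace_add[OF subspace_local_null, of u n v] by simp

lemma local_null_diff: "local_null L n u \<Longrightarrow> local_null L n v \<Longrightarrow> local_null L n (u - v)"
  using subspace_diff[OF subspace_local_null, of u n v] by simp

lemma local_null_scale: "local_null L n u \<Longrightarrow> local_null L n (smul L c u)"
  using subspace_scale[OF subspace_local_null, of u n c] by simp

lemma local_null_0: "local_null L n 0"
  using subspace_0[OF subspace_local_null, of n] by simp

text \<open>The Jacobi identity peels local elements off \<open>z\<close>. The induction is over all
  \<open>n\<close> and \<open>u\<close>, because the inner bracket \<open>[a, u]\<close> is another
  null element of shifted degree.\<close>

lemma local_null_brkt:
  assumes "local_gen L (homog L) m z" "local_null L n u"
  shows "local_null L (n + m) (brkt L z u)"
  using assms
proof (induction arbitrary: n u rule: local_gen.induct)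
  case (base i a)
  then show ?case using local_null_brkt_local by blast
next
  case (zero m)
  then show ?case by (simp add: local_null_carr brkt_zero_left local_null_0)
next
  case (add m u w)
  then show ?case
    using local_gen_carr local_null_carr by (simp add: brkt_add_left local_null_add)
next
  case (scale m u c)
  then show ?case
    using local_gen_carr local_null_carr by (simp add: brkt_scale_left local_null_scale)
next
  case (step s m a z)
  have s: "s \<in> {-1, 0, 1}" using step.hyps(1) by blast
  have "brkt L (brkt L a z) u = brkt L a (brkt L z u) - brkt L z (brkt L a u)"
    using homog_carr step.hyps(3) local_gen_carr[OF step.hyps(4)] local_null_carr[OF step.prems]
    by (intro jacobi_left)
  moreover have "local_null L (n + m + s) (brkt L a (brkt L z u))"
    using step.IH[OF step.prems] s step.hyps(3) by (rule local_null_brkt_local)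
  moreover have "local_null L (n + s + m) (brkt L z (brkt L a u))"
    using step.IH[OF local_null_brkt_local[OF step.prems s step.hyps(3)]] .
  ultimately show ?case
    using local_null_diff by (simp add: ac_simps)
qed

definition null_carr :: "'a set" where
  "null_carr = span (\<Union>n. {u. local_null L n u})"

lemma subspace_null_carr: "subspace null_carr"
  unfolding null_carr_def by (rule subspace_span)

lemma null_carr_subset: "null_carr \<subseteq> carr L"
  unfolding null_carr_def using local_null_carr subspace_carr by (intro span_minimal) auto

lemma null_carr_ideal:
  assumes "z \<in> carr L" "u \<in> null_carr"
  shows "brkt L z u \<in> null_carr"
proof -
  have 1: "u \<in> carr L \<and> brkt L z u \<in> null_carr" if z: "local_gen L (homog L) m z" for m z
    using assms(2)[unfolded null_carr_def]
  proof (induction rule: span_induct_alt)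
    case base
    then show ?case
      using local_gen_carr[OF z] subspace_0[OF subspace_carr] subspace_0[OF subspace_null_carr]
      by (simp add: brkt_zero_right)
  next
    case (step c x y)
    then obtain n where x: "local_null L n x" by blast
    have "brkt L z (smul L c x + y) = smul L c (brkt L z x) + brkt L z y"
      using local_gen_carr[OF z] local_null_carr[OF x] step subspace_scale[OF subspace_carr]
      by (simp add: brkt_add_right brkt_scale_right)
    moreover have "brkt L z x \<in> null_carr"
      unfolding null_carr_def using local_null_brkt[OF z x] by (intro span_base) blast
    ultimately show ?case
      using step local_null_carr[OF x] subspace_null_carr subspace_carr
      by (simp add: subspace_add subspace_scale)
  qed
  have u: "u \<in> carr L" using assms(2) null_carr_subset by blast
  \<comment> \<open>As \<open>L\<close> is generated by its local part, \<open>z\<close> is a sum of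
    elements built from local ones, which \<open>1\<close> covers.\<close>
  have "z \<in> carr L \<and> brkt L z u \<in> null_carr"
    using assms(1)[folded gen_carr_eq, unfolded gen_carr_def]
  proof (induction rule: span_induct_alt)
    case base
    then show ?case
      using u subspace_0[OF subspace_carr] subspace_0[OF subspace_null_carr]
      by (simp add: brkt_zero_left)
  next
    case (step c x y)
    then obtain n where x: "local_gen L (homog L) n x" by blast
    have "brkt L (smul L c x + y) u = smul L c (brkt L x u) + brkt L y u"
      using local_gen_carr[OF x] step u subspace_scale[OF subspace_carr]
      by (simp add: brkt_add_left brkt_scale_left)
    then show ?case
      using step 1[OF x] local_gen_carr[OF x] subspace_null_carr subspace_carr
      by (simp add: subspace_add subspace_scale)
  qed
  then show ?thesis by blast
qed

text \<open>The sum has a second decomposition, into null elements. Over the union of both index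
  sets the two agree degree by degree, since the grading is direct.\<close>

lemma null_carr_graded:
  assumes "finite N" "\<And>n. n \<in> N \<Longrightarrow> v n \<in> homog L n" "(\<Sum>n\<in>N. v n) \<in> null_carr" "n \<in> N"
  shows "local_null L n (v n)"
proof -
  obtain M w where w: "finite M" "\<And>n. w n \<in> {u. local_null L n u}"
      "(\<Sum>n\<in>N. v n) = (\<Sum>n\<in>M. w n)"
    using span_UN_subspaces[OF subspace_local_null assms(3)[unfolded null_carr_def]] by blast
  let ?z = "\<lambda>n. (if n \<in> N then v n else 0) - (if n \<in> M then w n else 0)"
  have "(\<Sum>n\<in>N. v n) = (\<Sum>n\<in>N \<union> M. if n \<in> N then v n else 0)"
    using assms(1) w(1) by (intro sum.mono_neutral_cong_left) auto
  moreover have "(\<Sum>n\<in>M. w n) = (\<Sum>n\<in>N \<union> M. if n \<in> M then w n else 0)"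
    using assms(1) w(1) by (intro sum.mono_neutral_cong_left) auto
  ultimately have "(\<Sum>n\<in>N \<union> M. ?z n) = 0"
    using w(3) by (simp add: sum_subtractf)
  moreover have "?z n \<in> homog L n" for n
    using w(2)[of n] assms(2)[of n] local_null_homog
    by (intro subspace_diff[OF subspace_homog]) (auto simp: subspace_0[OF subspace_homog])
  ultimately have "?z n = 0"
    using homog_independent[of "N \<union> M" ?z n] assms(1,4) w(1) by blast
  then have "v n = (if n \<in> M then w n else 0)" using assms(4) by simp
  then show ?thesis using w(2)[of n] local_null_0 by simp
qed

lemma null_carr_homog: "u \<in> homog L n \<Longrightarrow> u \<in> null_carr \<Longrightarrow> local_null L n u"
  using null_carr_graded[of "{n}" "\<lambda>_. u" n] by simp

end

section \<open>Quotients of countable dimension inside spaces of finitely supported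
  functions\<close>

definition pm_scale :: "complex \<Rightarrow> ('k \<Rightarrow>\<^sub>0 complex) \<Rightarrow> ('k \<Rightarrow>\<^sub>0 complex)" where
  "pm_scale c = Poly_Mapping.map ((*) c)"

lemma lookup_pm_scale [simp]:
  "Poly_Mapping.lookup (pm_scale c f) k = c * Poly_Mapping.lookup f k"
  by (simp add: pm_scale_def map.rep_eq when_def)

lemma vector_space_pm_scale: "vector_space pm_scale"
  by unfold_locales (auto intro!: poly_mapping_eqI simp: lookup_add algebra_simps)

text \<open>A substitute for the quotient by \<open>J\<close>: a basis \<open>BJ\<close> of
  \<open>J\<close> is extended by elements of \<open>C\<close>; the vectors of \<open>BJ\<close> go
  to 0 and the remaining ones, countably many, to distinct unit vectors, for which an infinite
  \<open>'k\<close> has room. The kernel is controlled on the span of \<open>C\<close>, which will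
  contain the whole algebra.\<close>

lemma linear_map_with_kernel:
  fixes s :: "complex \<Rightarrow> 'a::ab_group_add \<Rightarrow> 'a"
  assumes vs: "vector_space s" and inf: "infinite (UNIV :: 'k set)" and C: "countable C"
    and J: "module.subspace s J"
  obtains q :: "'a \<Rightarrow> ('k \<Rightarrow>\<^sub>0 complex)" where
    "Vector_Spaces.linear s pm_scale q"
    "\<And>u. u \<in> J \<Longrightarrow> q u = 0"
    "\<And>u. u \<in> module.span s C \<Longrightarrow> q u = 0 \<Longrightarrow> u \<in> J"
proof -
  interpret V: vector_space s by fact
  interpret W: vector_space "pm_scale :: complex \<Rightarrow> ('k \<Rightarrow>\<^sub>0 complex) \<Rightarrow> _"
    by (rule vector_space_pm_scale)
  interpret VW: vector_space_pair s "pm_scale :: complex \<Rightarrow> ('k \<Rightarrow>\<^sub>0 complex) \<Rightarrow> _" ..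
  obtain BJ where BJ: "BJ \<subseteq> J" "V.independent BJ" "J \<subseteq> V.span BJ"
    by (rule V.basis_exists[of J])
  obtain B where B: "BJ \<subseteq> B" "B \<subseteq> BJ \<union> C" "V.independent B" "BJ \<union> C \<subseteq> V.span B"
    by (rule V.maximal_independent_subset_extend[OF Un_upper1[of BJ C] BJ(2)])
  have "countable (B - BJ)"
    using B(2) C by (intro countable_subset[of "B - BJ" C]) auto
  then have inj1: "inj_on (to_nat_on (B - BJ)) (B - BJ)" by (rule inj_on_to_nat_on)
  obtain g :: "nat \<Rightarrow> 'k" where g: "inj g"
    using infinite_countable_subset[OF inf] by blast
  define code where "code b = g (to_nat_on (B - BJ) b)" for b
  have code: "inj_on code (B - BJ)"
    unfolding code_def using inj1 g by (auto simp: inj_on_def)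
  obtain q where q: "Vector_Spaces.linear s pm_scale q"
    and qB: "\<And>b. b \<in> B \<Longrightarrow> q b = (if b \<in> BJ then 0 else Poly_Mapping.single (code b) 1)"
    using VW.linear_independent_extend[OF B(3),
        of "\<lambda>b. if b \<in> BJ then 0 else Poly_Mapping.single (code b) 1"] by blast
  interpret q: Vector_Spaces.linear s pm_scale q by (rule q)
  have q0: "q u = 0" if "u \<in> V.span BJ" for u
    using that
  proof (induction rule: V.span_induct_alt)
    case base
    show ?case by (rule q.zero)
  next
    case (step c x y)
    then have "q x = 0" using qB[of x] B(1) by auto
    then show ?case using step(2) by (simp add: q.add q.scale)
  qed
  have ker: "u \<in> J" if u: "u \<in> V.span C" and qu: "q u = 0" for u
  proof -
    have "V.span C \<subseteq> V.span (BJ \<union> (B - BJ))"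
      using B(1,4) by (intro V.span_minimal V.subspace_span) (auto simp: Un_absorb1)
    then obtain j c where jc: "u = j + c" "j \<in> V.span BJ" "c \<in> V.span (B - BJ)"
      using u unfolding V.span_Un by blast
    from jc(3) obtain t r where t: "finite t" "t \<subseteq> B - BJ" "c = (\<Sum>b\<in>t. s (r b) b)"
      unfolding V.span_explicit by blast
    have "q c = 0" using qu q0[OF jc(2)] by (simp add: jc(1) q.add)
    moreover have "q c = (\<Sum>b\<in>t. pm_scale (r b) (Poly_Mapping.single (code b) 1))"
      unfolding t(3) q.sum
    proof (rule sum.cong[OF refl])
      fix b assume "b \<in> t"
      then show "q (s (r b) b) = pm_scale (r b) (Poly_Mapping.single (code b) 1)"
        using t(2) qB[of b] by (auto simp: q.scale)
    qed
    ultimately have "(\<Sum>b\<in>t. pm_scale (r b) (Poly_Mapping.single (code b) 1)) = 0" by simp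
    from arg_cong[OF this, of "\<lambda>p. Poly_Mapping.lookup p k" for k]
    have z: "(\<Sum>b\<in>t. r b * (if code b = k then 1 else 0)) = 0" for k
      by (simp add: lookup_sum lookup_single when_def)
    \<comment> \<open>The coefficient at \<open>code b\<close> isolates \<open>r b\<close>, as
      \<open>code\<close> is injective on \<open>B - BJ\<close>.\<close>
    have "r b = 0" if b: "b \<in> t" for b
    proof -
      have "(\<Sum>b'\<in>t. r b' * (if code b' = code b then 1 else 0)) = (\<Sum>b'\<in>t. if b' = b then r b' else 0)"
        using b t(2) code by (intro sum.cong) (auto simp: inj_on_def)
      then show ?thesis using z[of "code b"] b t(1) by simp
    qed
    then have "c = 0" using t(3) by simp
    then have "u \<in> V.span BJ" using jc by simp
    then show ?thesis using V.span_minimal[OF BJ(1) J] by blast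
  qed
  show thesis
    using that[OF q _ ker] q0 BJ(3) by blast
qed

text \<open>The bracket goes through arbitrary preimages under \<open>q\<close>; it does not depend
  on them once the kernel of \<open>q\<close> on the carrier is an ideal.\<close>

definition image_graded_lie ::
  "('a::ab_group_add, 'm) graded_lie_scheme \<Rightarrow> (complex \<Rightarrow> 'b \<Rightarrow> 'b) \<Rightarrow> ('a \<Rightarrow> 'b) \<Rightarrow> 'b graded_lie"
where
  "image_graded_lie L s q =
     \<lparr>smul = s, carr = q ` carr L,
      brkt = (\<lambda>u v. q (brkt L (inv_into (carr L) q u) (inv_into (carr L) q v))),
      homog = (\<lambda>n. q ` homog L n)\<rparr>"

locale graded_quotient = graded_lie_algebra L + W: vector_space s
  for L :: "('a::ab_group_add, 'm) graded_lie_scheme" and s :: "complex \<Rightarrow> 'b::ab_group_add \<Rightarrow> 'b" +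
  fixes q :: "'a \<Rightarrow> 'b"
  assumes linear: "Vector_Spaces.linear (smul L) s q"
    and ker_iff: "u \<in> carr L \<Longrightarrow> q u = 0 \<longleftrightarrow> u \<in> null_carr"
begin

sublocale q: Vector_Spaces.linear "smul L" s q by (rule linear)

abbreviation Q :: "'b graded_lie" where "Q \<equiv> image_graded_lie L s q"

lemma Q_simps [simp]: "smul Q = s" "carr Q = q ` carr L" "homog Q n = q ` homog L n"
  by (simp_all add: image_graded_lie_def)

lemma q_eq_iff: "u \<in> carr L \<Longrightarrow> v \<in> carr L \<Longrightarrow> q u = q v \<longleftrightarrow> u - v \<in> null_carr"
  using ker_iff[of "u - v"] subspace_diff[OF subspace_carr] by (simp add: q.diff)

lemma brkt_Q:
  assumes "u \<in> carr L" "v \<in> carr L"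
  shows "brkt Q (q u) (q v) = q (brkt L u v)"
proof -
  define u' v' where "u' = inv_into (carr L) q (q u)" and "v' = inv_into (carr L) q (q v)"
  have u': "u' \<in> carr L" "q u' = q u" and v': "v' \<in> carr L" "q v' = q v"
    unfolding u'_def v'_def using assms by (auto intro: inv_into_into f_inv_into_f)
  \<comment> \<open>The two brackets differ by \<open>[u', v' - v] - [v, u' - u]\<close>, and
    preimages of the same element differ by an element of the ideal.\<close>
  have "brkt L u' (v' - v) \<in> null_carr" "brkt L v (u' - u) \<in> null_carr"
    using assms u' v' q_eq_iff null_carr_ideal by auto
  then have "brkt L u' (v' - v) - brkt L v (u' - u) \<in> null_carr"
    by (rule subspace_diff[OF subspace_null_carr])
  also have "brkt L u' (v' - v) - brkt L v (u' - u) = brkt L u' v' - brkt L u v"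
    using assms u' v' by (simp add: brkt_diff_right brkt_swap[of v])
  finally have "q (brkt L u' v') = q (brkt L u v)"
    using q_eq_iff assms u' v' by (simp add: brkt_closed)
  then show ?thesis by (simp add: image_graded_lie_def u'_def v'_def)
qed

lemma subspace_image_q: "subspace S \<Longrightarrow> W.subspace (q ` S)"
  by (rule q.subspace_image)

text \<open>Here the triviality of the null ideal in the local degrees enters: dividing it out
  leaves the local part intact.\<close>

lemma q_local_inj: "i \<in> {-1, 0, 1} \<Longrightarrow> inj_on q (homog L i)"
proof (rule inj_onI)
  fix u v assume i: "i \<in> {-1, 0, 1}" and uv: "u \<in> homog L i" "v \<in> homog L i" "q u = q v"
  then have "u - v \<in> null_carr" using q_eq_iff homog_carr by blast
  moreover have "u - v \<in> homog L i" using uv subspace_diff[OF subspace_homog] by blast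
  ultimately show "u = v" using null_carr_homog local_null_local[OF _ i] by fastforce
qed

lemma is_lie_alg_Q: "is_lie_alg Q"
  unfolding is_lie_alg_def
proof (intro conjI)
  show "is_cspace Q"
    using subspace_image_q[OF subspace_carr] by (simp add: is_cspace_def W.vector_space_axioms)
  show "bilin_map Q Q Q (brkt Q)"
    unfolding bilin_map_def lin_map_def
    by (auto simp: brkt_Q brkt_closed brkt_add_left brkt_add_right brkt_scale_left brkt_scale_right
        subspace_add[OF subspace_carr] subspace_scale[OF subspace_carr]
        simp flip: q.add q.scale)
  show "\<forall>a\<in>carr Q. brkt Q a a = 0"
    by (auto simp: brkt_Q brkt_self)
  show "\<forall>a\<in>carr Q. \<forall>b\<in>carr Q. \<forall>c\<in>carr Q.
        brkt Q a (brkt Q b c) + brkt Q b (brkt Q c a) + brkt Q c (brkt Q a b) = 0"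
    using is_lie by (auto simp: brkt_Q brkt_closed is_lie_alg_def simp flip: q.add)
qed

lemma lie_hom_q: "lie_hom L Q q"
  by (auto simp: lie_hom_def lin_map_def brkt_Q q.add q.scale)

lemma is_graded_lie_Q: "is_graded_lie Q"
  unfolding is_graded_lie_def
proof (intro conjI allI impI ballI)
  show "is_lie_alg Q" by (rule is_lie_alg_Q)
next
  fix n show "module.subspace (smul Q) (homog Q n)"
    using subspace_image_q[OF subspace_homog] by simp
next
  show "carr Q = module.span (smul Q) (\<Union>n. homog Q n)"
    by (simp add: carr_eq q.span_image image_UN[symmetric])
next
  fix N v n
  assume *: "finite N \<and> (\<forall>n\<in>N. v n \<in> homog Q n) \<and> sum v N = 0" and n: "n \<in> N"
  then have "\<forall>n\<in>N. \<exists>u. u \<in> homog L n \<and> v n = q u" by auto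
  then obtain u where u: "\<And>n. n \<in> N \<Longrightarrow> u n \<in> homog L n \<and> v n = q (u n)" by metis
  \<comment> \<open>A relation among homogeneous elements lifts to a sum in the null ideal. This
    ideal is graded, so each lifted component is null and maps to 0.\<close>
  have "q (\<Sum>n\<in>N. u n) = 0" using * u by (simp add: q.sum)
  moreover have "(\<Sum>n\<in>N. u n) \<in> carr L"
    using u homog_carr by (intro subspace_sum[OF subspace_carr]) blast
  ultimately have "(\<Sum>n\<in>N. u n) \<in> null_carr" using ker_iff by blast
  then have "local_null L n (u n)" using null_carr_graded[of N u] * u n by blast
  then have "u n \<in> null_carr" unfolding null_carr_def by (intro span_base) blast
  then show "v n = 0" using u[OF n] ker_iff[of "u n"] homog_carr[of "u n" n] by simp
next
  fix n m a b assume "a \<in> homog Q n" "b \<in> homog Q m"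
  then show "brkt Q a b \<in> homog Q (n + m)"
    using brkt_homog homog_carr by (auto simp: brkt_Q)
next
  have loc: "carr (local_part Q) = q ` carr (local_part L)"
    by (simp add: local_part_def image_Un flip: q.span_image)
  have "carr Q \<subseteq> S" if S: "lie_subalg Q S" "carr (local_part Q) \<subseteq> S" for S
  proof -
    have sS: "W.subspace S" using S(1) by (simp add: lie_subalg_def)
    \<comment> \<open>Generation is inherited because the preimage of a subalgebra of the image is a
      subalgebra of \<open>L\<close>.\<close>
    have "lie_subalg L {u \<in> carr L. q u \<in> S}"
      unfolding lie_subalg_def
    proof (intro conjI ballI)
      show "subspace {u \<in> carr L. q u \<in> S}"
        using sS subspace_carr
        by (intro subspaceI)
          (auto simp: subspace_0 W.subspace_0 subspace_add W.subspace_add subspace_scale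
            W.subspace_scale q.add q.scale)
      fix a b assume "a \<in> {u \<in> carr L. q u \<in> S}" "b \<in> {u \<in> carr L. q u \<in> S}"
      then have ab: "a \<in> carr L" "b \<in> carr L" "q a \<in> S" "q b \<in> S" by auto
      then have "brkt Q (q a) (q b) \<in> S" using S(1) by (simp add: lie_subalg_def)
      then show "brkt L a b \<in> {u \<in> carr L. q u \<in> S}"
        using ab by (simp add: brkt_Q brkt_closed)
    qed auto
    moreover have "homog L i \<subseteq> {u \<in> carr L. q u \<in> S}" if "i \<in> {-1, 0, 1}" for i
      using S(2) homog_local_part[OF that] homog_carr unfolding loc by blast
    ultimately have "carr L \<subseteq> {u \<in> carr L. q u \<in> S}" by (rule carr_subset_subalg)
    then show ?thesis by auto
  qed
  moreover have "lie_subalg Q (carr Q)"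
    using lie_algebra.lie_subalg_carr[of Q] is_lie_alg_Q by (simp add: lie_algebra_def)
  moreover have "carr (local_part Q) \<subseteq> carr Q"
  proof -
    have "carr (local_part L) \<subseteq> carr L"
      unfolding carr_local_part using subspace_carr homog_carr by (intro span_minimal) auto
    then show ?thesis unfolding loc by auto
  qed
  ultimately show "lie_generated Q (carr (local_part Q)) = carr Q"
    unfolding lie_generated_def by blast
qed

text \<open>Pulled back along \<open>q\<close>, a family \<open>K\<close> as in
  \<open>transitive_graded\<close> is an invariant for coinduction, as \<open>q\<close> is injective
  in the local degrees. So the elements of \<open>K\<close> come from null elements and are
  0.\<close>

lemma transitive_Q: "transitive_graded Q"
  unfolding transitive_graded_def
proof (intro allI impI)
  fix K n
  assume K: "(\<forall>n. K n \<subseteq> homog Q n) \<and> (\<forall>i\<in>{-1, 0, 1}. K i \<subseteq> {0}) \<and>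
    (\<forall>i\<in>{-1, 0, 1}. \<forall>n. \<forall>a\<in>homog Q i. \<forall>u\<in>K n. brkt Q a u \<in> K (n + i))"
  show "K n \<subseteq> {0}"
  proof
    fix w assume w: "w \<in> K n"
    then obtain u where u: "u \<in> homog L n" "w = q u" using K by auto
    have "local_null L n u"
    proof (rule local_null_coinduct[where X = "\<lambda>n u. u \<in> homog L n \<and> q u \<in> K n"])
      show "u \<in> homog L n \<and> q u \<in> K n" using u w by simp
    next
      fix n v assume v: "v \<in> homog L n \<and> q v \<in> K n" and n: "n \<in> {-1, 0, 1}"
      then have "q v = 0" using K by blast
      then show "v = 0"
        using inj_onD[OF q_local_inj[OF n], of v 0] v subspace_0[OF subspace_homog] by (simp add: q.zero)
    next
      fix n v i a assume v: "v \<in> homog L n \<and> q v \<in> K n" and i: "i \<in> {-1, 0, 1}" and a: "a \<in> homog L i"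
      have "brkt Q (q a) (q v) \<in> K (n + i)" using K v i a by auto
      then have "q (brkt L a v) \<in> K (n + i)" using brkt_Q homog_carr v a by metis
      then show "brkt L a v \<in> homog L (n + i) \<and> q (brkt L a v) \<in> K (n + i)"
        using brkt_homog[of a i v n] v a by (simp add: add.commute)
    qed auto
    then have "u \<in> null_carr" unfolding null_carr_def by (intro span_base) blast
    then show "w \<in> {0}" using u ker_iff homog_carr by blast
  qed
qed

end

lemma transitive_quotient_exists:
  fixes G :: "('a::ab_group_add, 'm) graded_lie_scheme"
  assumes "is_graded_lie G" and "infinite (UNIV :: 'k set)"
    and "countable C" and "carr G \<subseteq> module.span (smul G) C"
  obtains L :: "('k \<Rightarrow>\<^sub>0 complex) graded_lie" and q where
    "is_graded_lie L" "transitive_graded L" "lie_hom G L q" "\<And>n. homog L n = q ` homog G n"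
    "\<And>i. i \<in> {-1, 0, 1} \<Longrightarrow> inj_on q (homog G i)"
proof -
  interpret G: graded_lie_algebra G by unfold_locales fact
  obtain q :: "'a \<Rightarrow> ('k \<Rightarrow>\<^sub>0 complex)" where q: "Vector_Spaces.linear (smul G) pm_scale q"
    "\<And>u. u \<in> G.null_carr \<Longrightarrow> q u = 0" "\<And>u. u \<in> G.span C \<Longrightarrow> q u = 0 \<Longrightarrow> u \<in> G.null_carr"
    using linear_map_with_kernel[OF G.is_vector_space assms(2,3) G.subspace_null_carr] by blast
  interpret W: vector_space "pm_scale :: complex \<Rightarrow> ('k \<Rightarrow>\<^sub>0 complex) \<Rightarrow> _"
    by (rule vector_space_pm_scale)
  interpret quot: graded_quotient G pm_scale q
  proof (intro graded_quotient.intro graded_quotient_axioms.intro)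
    fix u assume "u \<in> carr G"
    then show "q u = 0 \<longleftrightarrow> u \<in> G.null_carr" using q(2,3) assms(4) by blast
  qed (fact G.graded_lie_algebra_axioms W.vector_space_axioms q(1))+
  show thesis
    by (rule that[of quot.Q q])
      (simp_all add: quot.is_graded_lie_Q quot.transitive_Q quot.lie_hom_q quot.q_local_inj)
qed

section \<open>The generated subalgebra as a graded Lie algebra, and its dimension\<close>

context local_lie_algebra
begin

definition gen_graded :: "'a graded_lie" where
  "gen_graded = \<lparr>smul = smul L, carr = gen_carr, brkt = brkt L, homog = (\<lambda>n. {u. local_gen L A n u})\<rparr>"

lemma homog_gen_graded_local: "i \<in> {-1, 0, 1} \<Longrightarrow> homog gen_graded i = A i"
  using local_gen_local[of i] local_gen.base[of i _ A L] by (auto simp: gen_graded_def)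

text \<open>Directness has to be supplied from outside: the ambient algebra is not graded, and an
  element could a priori be generated in several degrees. All other axioms follow from the way the
  subalgebra is generated.\<close>

lemma is_graded_lie_gen_graded:
  assumes indep: "\<And>N v n. finite N \<Longrightarrow> (\<And>n. n \<in> N \<Longrightarrow> local_gen L A n (v n)) \<Longrightarrow>
    (\<Sum>n\<in>N. v n) = 0 \<Longrightarrow> n \<in> N \<Longrightarrow> v n = 0"
  shows "is_graded_lie gen_graded"
  unfolding is_graded_lie_def
proof (intro conjI allI impI ballI)
  have c: "u \<in> carr L" if "u \<in> gen_carr" for u using that gen_carr_subset by blast
  show lie: "is_lie_alg gen_graded"
    unfolding is_lie_alg_def
  proof (intro conjI)
    show "is_cspace gen_graded"
      using is_vector_space subspace_gen_carr by (simp add: is_cspace_def gen_graded_def)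
    show "bilin_map gen_graded gen_graded gen_graded (brkt gen_graded)"
      by (simp add: bilin_map_def lin_map_def gen_graded_def c gen_carr_brkt
          brkt_add_left brkt_add_right brkt_scale_left brkt_scale_right)
    show "\<forall>a\<in>carr gen_graded. brkt gen_graded a a = 0"
      by (simp add: gen_graded_def c brkt_self)
    show "\<forall>a\<in>carr gen_graded. \<forall>b\<in>carr gen_graded. \<forall>d\<in>carr gen_graded.
        brkt gen_graded a (brkt gen_graded b d) + brkt gen_graded b (brkt gen_graded d a) +
        brkt gen_graded d (brkt gen_graded a b) = 0"
      using is_lie_alg c by (simp add: gen_graded_def is_lie_alg_def)
  qed
  fix n show "module.subspace (smul gen_graded) (homog gen_graded n)"
    using subspace_local_gen by (simp add: gen_graded_def)
next
  show "carr gen_graded = module.span (smul gen_graded) (\<Union>n. homog gen_graded n)"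
    by (simp add: gen_graded_def gen_carr_def)
next
  fix N v n
  assume "finite N \<and> (\<forall>n\<in>N. v n \<in> homog gen_graded n) \<and> sum v N = 0" "n \<in> N"
  then show "v n = 0" using indep[of N v n] by (simp add: gen_graded_def)
next
  fix n m a b assume "a \<in> homog gen_graded n" "b \<in> homog gen_graded m"
  then show "brkt gen_graded a b \<in> homog gen_graded (n + m)"
    using local_gen_brkt by (simp add: gen_graded_def)
next
  have loc: "A i \<subseteq> carr (local_part gen_graded)" if "i \<in> {-1, 0, 1}" for i
  proof -
    have "A i \<subseteq> (\<Union>n\<in>{-1, 0, 1}. homog gen_graded n)" using homog_gen_graded_local[OF that] that by blast
    also have "\<dots> \<subseteq> carr (local_part gen_graded)"
      using span_superset by (simp add: local_part_def gen_graded_def)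
    finally show ?thesis .
  qed
  have "gen_carr \<subseteq> S" if S: "lie_subalg gen_graded S" "carr (local_part gen_graded) \<subseteq> S" for S
  proof (rule gen_carr_minimal)
    show "lie_subalg L S"
      using S(1) gen_carr_subset by (auto simp: lie_subalg_def gen_graded_def)
    fix i :: int assume "i \<in> {-1, 0, 1}"
    then show "A i \<subseteq> S" using loc S(2) by blast
  qed
  moreover have "lie_subalg gen_graded gen_carr"
    using lie_subalg_gen_carr by (simp add: lie_subalg_def gen_graded_def)
  moreover have "carr (local_part gen_graded) \<subseteq> gen_carr"
  proof -
    have "span (\<Union>n\<in>{-1, 0, 1}. {u. local_gen L A n u}) \<subseteq> gen_carr"
      using subspace_gen_carr local_gen_gen_carr by (intro span_minimal) auto
    then show ?thesis by (simp add: local_part_def gen_graded_def)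
  qed
  ultimately show "lie_generated gen_graded (carr (local_part gen_graded)) = carr gen_graded"
    unfolding lie_generated_def gen_graded_def by simp blast
qed

text \<open>The countable spanning set consists of the right-normed brackets of elements of \<open>C\<close>.\<close>

lemma gen_carr_countable_span:
  assumes "countable C" "C \<subseteq> carr L" "\<And>i. i \<in> {-1, 0, 1} \<Longrightarrow> A i \<subseteq> span C"
  obtains C' where "countable C'" "gen_carr \<subseteq> span C'"
proof -
  let ?C' = "(\<lambda>(as, b). foldr (brkt L) as b) ` (lists C \<times> C)"
  have C'_carr: "foldr (brkt L) as b \<in> carr L" if "as \<in> lists C" "b \<in> C" for as b
    using that assms(2) by (induction as) (auto simp: brkt_closed)
  \<comment> \<open>Linearity in both arguments reduces this to an element of \<open>C\<close> and a
    right-normed bracket over \<open>C\<close>, which becomes longer by one entry.\<close>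
  have step: "brkt L a u \<in> span ?C'" if a: "a \<in> span C" and u: "u \<in> span ?C'" for a u
  proof -
    have sC: "x \<in> carr L" if "x \<in> span C" for x
      using that span_minimal[OF assms(2) subspace_carr] by blast
    have 1: "u \<in> carr L \<and> brkt L x u \<in> span ?C'" if x: "x \<in> C" for x
      using u
    proof (induction rule: span_induct_alt)
      case base
      then show ?case
        using x assms(2) by (auto simp: brkt_zero_right span_zero subspace_0[OF subspace_carr])
    next
      case (step c y z)
      then obtain as b where y: "y = foldr (brkt L) as b" "as \<in> lists C" "b \<in> C" by auto
      have yc: "y \<in> carr L" using y C'_carr by blast
      have xc: "x \<in> carr L" using x assms(2) by blast
      have "brkt L x y \<in> ?C'"
        using y x by (intro image_eqI[of _ _ "(x # as, b)"]) auto
      then have "brkt L x y \<in> span ?C'" by (rule span_base)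
      then show ?case
        using step(2) yc xc
        by (simp add: brkt_add_right brkt_scale_right span_add span_scale
            subspace_add[OF subspace_carr] subspace_scale[OF subspace_carr])
    qed
    have uc: "u \<in> carr L"
    proof -
      have "?C' \<subseteq> carr L" using C'_carr by auto
      then show ?thesis using u span_minimal[OF _ subspace_carr] by blast
    qed
    have "a \<in> carr L \<and> brkt L a u \<in> span ?C'"
      using a
    proof (induction rule: span_induct_alt)
      case base
      then show ?case
        using uc by (auto simp: brkt_zero_left span_zero subspace_0[OF subspace_carr])
    next
      case (step c y z)
      have yc: "y \<in> carr L" using step(1) assms(2) by blast
      show ?case
        using step(2) 1[OF step(1)] yc uc
        by (simp add: brkt_add_left brkt_scale_left span_add span_scale
            subspace_add[OF subspace_carr] subspace_scale[OF subspace_carr])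
    qed
    then show ?thesis by blast
  qed
  have CC': "span C \<subseteq> span ?C'"
  proof (rule span_mono)
    show "C \<subseteq> ?C'"
    proof
      fix b assume "b \<in> C"
      then show "b \<in> ?C'" by (intro image_eqI[of _ _ "([], b)"]) auto
    qed
  qed
  have "u \<in> span ?C'" if "local_gen L A n u" for n u
    using that
  proof (induction rule: local_gen.induct)
    case (base i a)
    then show ?case using assms(3) CC' by blast
  next
    case (step s n a u)
    then have "a \<in> span C" using assms(3)[of s] by blast
    then show ?case using step.IH by (rule \<open>\<And>u a. a \<in> span C \<Longrightarrow> u \<in> span ?C' \<Longrightarrow> brkt L a u \<in> span ?C'\<close>)
  qed (auto simp: span_zero span_add span_scale)
  then have "gen_carr \<subseteq> span ?C'"
    unfolding gen_carr_def by (intro span_minimal subspace_span) auto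
  moreover have "countable ?C'" using assms(1) by (intro countable_image countable_SIGMA) auto
  ultimately show thesis using that by blast
qed

end

section \<open>A graded Lie algebra of operators with the prescribed local part\<close>

type_synonym 'p operator = "('p \<Rightarrow> complex) \<Rightarrow> ('p \<Rightarrow> complex)"

definition linear_op :: "'p operator \<Rightarrow> bool" where
  "linear_op S \<longleftrightarrow> (\<forall>\<phi> \<psi>. S (\<phi> + \<psi>) = S \<phi> + S \<psi>) \<and> (\<forall>c \<phi>. S (\<lambda>p. c * \<phi> p) = (\<lambda>p. c * S \<phi> p))"

text \<open>
  Operators act on functions, the dual of the space that the vectors of the free module live in;
  transposition reverses products, so the bracket has the opposite sign of the commutator.
\<close>

definition op_lie :: "'p operator lie_alg" where
  "op_lie = \<lparr>smul = (\<lambda>c S \<phi> p. c * S \<phi> p), carr = {S. linear_op S},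
     brkt = (\<lambda>S T \<phi>. T (S \<phi>) - S (T \<phi>))\<rparr>"

lemma linear_op_add: "linear_op S \<Longrightarrow> S (\<phi> + \<psi>) = S \<phi> + S \<psi>"
  and linear_op_scale: "linear_op S \<Longrightarrow> S (\<lambda>p. c * \<phi> p) = (\<lambda>p. c * S \<phi> p)"
  by (simp_all add: linear_op_def)

lemma linear_op_diff:
  assumes "linear_op S"
  shows "S (\<phi> - \<psi>) = S \<phi> - S \<psi>"
  using linear_op_add[OF assms, of "\<phi> - \<psi>" \<psi>] by (simp add: eq_diff_eq)

lemma vector_space_op: "vector_space (\<lambda>c (S :: 'p operator) \<phi> p. c * S \<phi> p)"
  by unfold_locales (auto simp: fun_eq_iff algebra_simps)

lemma is_lie_alg_op_lie: "is_lie_alg (op_lie :: 'p operator lie_alg)"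
proof -
  interpret vector_space "\<lambda>c (S :: 'p operator) \<phi> p. c * S \<phi> p" by (rule vector_space_op)
  have br: "linear_op (\<lambda>\<phi>. T (S \<phi>) - S (T \<phi>))" if "linear_op S" "linear_op T" for S T :: "'p operator"
    unfolding linear_op_def
    by (auto simp: linear_op_add[OF that(1)] linear_op_add[OF that(2)] linear_op_scale[OF that(1)]
        linear_op_scale[OF that(2)] fun_eq_iff algebra_simps)
  have "subspace {S :: 'p operator. linear_op S}"
    by (intro subspaceI) (auto simp: linear_op_def fun_eq_iff algebra_simps)
  then have "is_cspace (op_lie :: 'p operator lie_alg)"
    by (simp add: is_cspace_def op_lie_def vector_space_axioms)
  moreover have "bilin_map (op_lie :: 'p operator lie_alg) op_lie op_lie (brkt op_lie)"
    unfolding bilin_map_def lin_map_def op_lie_def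
    by (auto simp: br linear_op_add linear_op_scale fun_eq_iff algebra_simps)
  moreover have "\<forall>S\<in>carr op_lie. brkt op_lie S S = (0 :: 'p operator)"
    by (auto simp: op_lie_def fun_eq_iff)
  moreover have "\<forall>S\<in>carr op_lie. \<forall>T\<in>carr op_lie. \<forall>U\<in>carr op_lie.
      brkt op_lie S (brkt op_lie T U) + brkt op_lie T (brkt op_lie U S) +
      brkt op_lie U (brkt op_lie S T) = (0 :: 'p operator)"
    by (auto simp: op_lie_def linear_op_diff fun_eq_iff)
  ultimately show ?thesis by (simp add: is_lie_alg_def)
qed

section \<open>Words, coordinates and contraction\<close>

type_synonym letter = "(nat \<times> nat) option"

text \<open>
  The letter \<open>None\<close> stands for \<open>x\<close> or \<open>y\<close> and \<open>Some (i, j)\<close> for \<open>e\<^sub>i\<^sub>,\<^sub>j\<^sup>-\<close> or \<open>e\<^sub>i\<^sub>,\<^sub>j\<^sup>+\<close>.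
  In all cases the bracket of dual letters is half the weight times \<open>h\<close>.
\<close>

fun lwt :: "letter \<Rightarrow> complex" where
  "lwt None = 2"
| "lwt (Some (i, j)) = - of_nat i"

fun coef :: "complex \<times> espace \<Rightarrow> letter \<Rightarrow> complex" where
  "coef v None = fst v"
| "coef v (Some k) = Poly_Mapping.lookup (snd v) k"

definition wsum :: "letter list \<Rightarrow> complex" where
  "wsum l = (\<Sum>a\<leftarrow>l. lwt a)"

text \<open>The linear extension of \<open>g\<close> from letters to vectors; it exists for every
  function \<open>g\<close>, because a vector has finite support.\<close>

definition coef_sum :: "complex \<times> espace \<Rightarrow> (letter \<Rightarrow> complex) \<Rightarrow> complex" where
  "coef_sum v g = fst v * g None +
     (\<Sum>k\<in>Poly_Mapping.keys (snd v). Poly_Mapping.lookup (snd v) k * g (Some k))"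

text \<open>Transpose of the operator by which \<open>v\<close>, placed in the degree opposite to
  the letters, acts on the tensor algebra. It kills the empty word and otherwise obeys
  \<open>v (b l) = b (v l) - [b, v] l\<close>. On the first copy \<open>[b, v]\<close> is
  \<open>coef v b * lwt b / 2\<close> times \<open>h\<close>, and \<open>h\<close> multiplies
  \<open>l\<close> by its weight \<open>wsum l\<close>; on the second copy both signs
  change.\<close>

primrec contract :: "complex \<times> espace \<Rightarrow> letter list \<Rightarrow> (letter list \<Rightarrow> complex) \<Rightarrow> complex" where
  "contract v [] = (\<lambda>\<phi>. 0)"
| "contract v (b # l) = (\<lambda>\<phi>. contract v l (\<lambda>m. \<phi> (b # m)) - coef v b * lwt b / 2 * wsum l * \<phi> l)"

definition vscale :: "complex \<Rightarrow> complex \<times> espace \<Rightarrow> complex \<times> espace" where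
  "vscale c v = (c * fst v, pm_scale c (snd v))"

text \<open>The action of \<open>h\<close> on degree 1 in coordinates; on degree -1 the same map
  occurs with the opposite sign.\<close>

definition wact :: "complex \<times> espace \<Rightarrow> complex \<times> espace" where
  "wact v = (2 * fst v, Poly_Mapping.mapp (\<lambda>(i, j) c. - (of_nat i * c)) (snd v))"

text \<open>The coefficient of \<open>h\<close> in the bracket of degree 1 with degree -1. The half
  is the factor 4 of the pairing divided by the value 8 of the Killing form at
  \<open>(h, h)\<close>.\<close>

definition vpair :: "complex \<times> espace \<Rightarrow> complex \<times> espace \<Rightarrow> complex" where
  "vpair v w = coef_sum v (\<lambda>a. coef w a * lwt a / 2)"

lemma coef_add [simp]: "coef (v + w) a = coef v a + coef w a"
  by (cases a) (simp_all add: lookup_add)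

lemma coef_vscale [simp]: "coef (vscale c v) a = c * coef v a"
  by (cases a) (simp_all add: vscale_def)

lemma coef_wact [simp]: "coef (wact v) a = lwt a * coef v a"
  by (cases a) (auto simp: wact_def lookup_mapp when_def in_keys_iff)

lemma coef_inject: "(\<And>a. coef v a = coef w a) \<Longrightarrow> v = w"
  by (metis coef.simps poly_mapping_eqI prod_eqI)

text \<open>Serves to write sums over the supports of different vectors over one common index
  set.\<close>

lemma coef_sum_eq:
  assumes "finite K" "Poly_Mapping.keys (snd v) \<subseteq> K"
  shows "coef_sum v g = coef v None * g None + (\<Sum>k\<in>K. coef v (Some k) * g (Some k))"
proof -
  have "(\<Sum>k\<in>Poly_Mapping.keys (snd v). Poly_Mapping.lookup (snd v) k * g (Some k)) =
      (\<Sum>k\<in>K. Poly_Mapping.lookup (snd v) k * g (Some k))"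
    using assms by (intro sum.mono_neutral_left) (auto simp: in_keys_iff)
  then show ?thesis by (simp add: coef_sum_def)
qed

lemma coef_sum_add: "coef_sum (v + w) g = coef_sum v g + coef_sum w g"
proof -
  let ?K = "Poly_Mapping.keys (snd v) \<union> Poly_Mapping.keys (snd w) \<union> Poly_Mapping.keys (snd (v + w))"
  have "coef_sum u g = coef u None * g None + (\<Sum>k\<in>?K. coef u (Some k) * g (Some k))"
    if "u \<in> {v, w, v + w}" for u
    using that by (intro coef_sum_eq) auto
  then show ?thesis by (simp add: ring_distribs sum.distrib del: coef.simps)
qed

text \<open>Treats scaling and the weight action together: both multiply coefficients letter by
  letter.\<close>

lemma coef_sum_mult:
  assumes "\<And>a. coef w a = m a * coef v a"
  shows "coef_sum w g = coef_sum v (\<lambda>a. m a * g a)"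
proof -
  let ?K = "Poly_Mapping.keys (snd v) \<union> Poly_Mapping.keys (snd w)"
  have "coef_sum u g = coef u None * g None + (\<Sum>k\<in>?K. coef u (Some k) * g (Some k))"
    if "u \<in> {v, w}" for u g
    using that by (intro coef_sum_eq) auto
  then show ?thesis by (simp add: assms ac_simps del: coef.simps)
qed

lemma coef_sum_fun_add: "coef_sum v (\<lambda>a. f a + g a) = coef_sum v f + coef_sum v g"
  by (simp add: coef_sum_def ring_distribs sum.distrib)

lemma coef_sum_fun_diff: "coef_sum v (\<lambda>a. f a - g a) = coef_sum v f - coef_sum v g"
  by (simp add: coef_sum_def right_diff_distrib sum_subtractf)

lemma coef_sum_fun_scale: "coef_sum v (\<lambda>a. c * g a) = c * coef_sum v g"
  by (simp add: coef_sum_def ring_distribs sum_distrib_left ac_simps)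

lemma coef_sum_vscale: "coef_sum (vscale c v) g = c * coef_sum v g"
  by (simp add: coef_sum_mult[of "vscale c v" "\<lambda>_. c" v] coef_sum_fun_scale)

lemma coef_sum_wact: "coef_sum (wact v) g = coef_sum v (\<lambda>a. lwt a * g a)"
  by (rule coef_sum_mult) simp

lemma coef_sum_delta: "coef_sum v (\<lambda>b. if b = a then 1 else 0) = coef v a"
  by (cases a) (auto simp: coef_sum_def if_distrib in_keys_iff cong: if_cong)

lemma vpair_commute: "vpair v w = vpair w v"
proof -
  let ?K = "Poly_Mapping.keys (snd v) \<union> Poly_Mapping.keys (snd w)"
  have "coef_sum u g = coef u None * g None + (\<Sum>k\<in>?K. coef u (Some k) * g (Some k))"
    if "u \<in> {v, w}" for u g
    using that by (intro coef_sum_eq) auto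
  then show ?thesis by (simp add: vpair_def ac_simps del: coef.simps)
qed

lemma contract_add_left: "contract (v + w) l \<phi> = contract v l \<phi> + contract w l \<phi>"
  by (induction l arbitrary: \<phi>) (simp_all add: algebra_simps add_divide_distrib)

lemma contract_vscale: "contract (vscale c v) l \<phi> = c * contract v l \<phi>"
  by (induction l arbitrary: \<phi>) (simp_all add: algebra_simps)

lemma contract_add: "contract v l (\<lambda>m. \<phi> m + \<psi> m) = contract v l \<phi> + contract v l \<psi>"
  by (induction l arbitrary: \<phi> \<psi>) (simp_all add: algebra_simps)

lemma contract_scale: "contract v l (\<lambda>m. c * \<phi> m) = c * contract v l \<phi>"
  by (induction l arbitrary: \<phi>) (simp_all add: algebra_simps)

lemma contract_sum: "contract v l (\<lambda>m. \<Sum>k\<in>K. \<phi> k m) = (\<Sum>k\<in>K. contract v l (\<phi> k))"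
proof (induction K rule: infinite_finite_induct)
  case (insert k K)
  then show ?case by (simp add: contract_add)
qed (use contract_scale[of v l 0] in simp_all)

text \<open>The transposed form of \<open>[h, v] = - wact v\<close> for \<open>v\<close> in degree
  -1. The shift \<open>c\<close> is for the induction, where the letter split off adds its weight to
  that of the rest.\<close>

lemma contract_wsum:
  "contract v l (\<lambda>m. (wsum m + c) * \<phi> m) = (wsum l + c) * contract v l \<phi> - contract (wact v) l \<phi>"
proof (induction l arbitrary: c \<phi>)
  case (Cons b l)
  have "contract v l (\<lambda>m. (wsum (b # m) + c) * \<phi> (b # m)) =
      contract v l (\<lambda>m. (wsum m + (lwt b + c)) * \<phi> (b # m))"
    by (simp add: wsum_def ac_simps)
  then show ?case
    by (simp add: Cons.IH) (simp add: wsum_def field_simps)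
qed simp

lemma contract_wsum_0:
  "contract v l (\<lambda>m. wsum m * \<phi> m) = wsum l * contract v l \<phi> - contract (wact v) l \<phi>"
  using contract_wsum[of v l 0 \<phi>] by simp

text \<open>Contraction removes exactly one letter. For the empty word \<open>length l - 1\<close>
  truncates to 0, which is harmless because both sides vanish there.\<close>

lemma contract_restrict:
  "contract v l (\<lambda>m. if P (length m) then \<phi> m else 0) =
    (if P (length l - 1) then contract v l \<phi> else 0)"
proof (induction l arbitrary: P \<phi>)
  case (Cons b l)
  have "contract v l (\<lambda>m. if P (Suc (length m)) then \<phi> (b # m) else 0) =
      (if P (Suc (length l - 1)) then contract v l (\<lambda>m. \<phi> (b # m)) else 0)"
    by (rule Cons.IH[of "\<lambda>n. P (Suc n)"])
  then show ?case by (cases l) simp_all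
qed simp

text \<open>The commutator of left multiplication and contraction. The recursion of
  \<open>contract\<close> is made for it: once the sum is moved inside, everything cancels except
  the last term of the recursive clause.\<close>

lemma contract_shift:
  "contract w l (\<lambda>m. coef_sum v (\<lambda>a. \<phi> (a # m))) - coef_sum v (\<lambda>a. contract w (a # l) \<phi>) =
    vpair v w * wsum l * \<phi> l"
proof -
  have "contract w l (\<lambda>m. coef_sum v (\<lambda>a. \<phi> (a # m))) = coef_sum v (\<lambda>a. contract w l (\<lambda>m. \<phi> (a # m)))"
    by (simp add: coef_sum_def contract_add contract_scale contract_sum)
  moreover have "coef_sum v (\<lambda>a. coef w a * lwt a / 2 * wsum l * \<phi> l) = vpair v w * wsum l * \<phi> l"
    using coef_sum_fun_scale[of v "wsum l * \<phi> l" "\<lambda>a. coef w a * lwt a / 2"]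
    by (simp add: vpair_def ac_simps)
  ultimately show ?thesis by (simp add: coef_sum_fun_diff)
qed

text \<open>
  On the first summand \<open>raise_op\<close> is dual to left multiplication on the tensor algebra and
  \<open>lower_op\<close> is its contragredient partner; on the second summand the roles are exchanged. Both
  summands are needed, as letters of weight \<open>0\<close> act by zero through \<open>contract\<close>.
\<close>

definition raise_op :: "complex \<times> espace \<Rightarrow> (bool \<times> letter list) operator" where
  "raise_op v \<phi> = (\<lambda>(b, l). if b then coef_sum v (\<lambda>a. \<phi> (b, a # l)) else contract v l (\<lambda>m. \<phi> (b, m)))"

definition lower_op :: "complex \<times> espace \<Rightarrow> (bool \<times> letter list) operator" where
  "lower_op v \<phi> = (\<lambda>(b, l). if b then contract v l (\<lambda>m. \<phi> (b, m)) else coef_sum v (\<lambda>a. \<phi> (b, a # l)))"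

definition weight_op :: "complex \<Rightarrow> (bool \<times> letter list) operator" where
  "weight_op c \<phi> = (\<lambda>(b, l). c * (if b then wsum l else - wsum l) * \<phi> (b, l))"

section \<open>Bracket relations and injectivity of the local operators\<close>

lemma linear_op_raise: "linear_op (raise_op v)"
  by (auto simp: linear_op_def raise_op_def fun_eq_iff coef_sum_fun_add coef_sum_fun_scale
      contract_add contract_scale)

lemma linear_op_lower: "linear_op (lower_op v)"
  by (auto simp: linear_op_def lower_op_def fun_eq_iff coef_sum_fun_add coef_sum_fun_scale
      contract_add contract_scale)

lemma linear_op_weight: "linear_op (weight_op c)"
  by (auto simp: linear_op_def weight_op_def fun_eq_iff algebra_simps)

lemma raise_op_add: "raise_op (v + w) = raise_op v + raise_op w"
  by (auto simp: raise_op_def fun_eq_iff coef_sum_add contract_add_left)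

lemma lower_op_add: "lower_op (v + w) = lower_op v + lower_op w"
  by (auto simp: lower_op_def fun_eq_iff coef_sum_add contract_add_left)

lemma weight_op_add: "weight_op (c + d) = weight_op c + weight_op d"
  by (auto simp: weight_op_def fun_eq_iff algebra_simps)

lemma raise_op_scale: "raise_op (vscale c v) = smul op_lie c (raise_op v)"
  by (auto simp: raise_op_def op_lie_def fun_eq_iff coef_sum_vscale contract_vscale)

lemma lower_op_scale: "lower_op (vscale c v) = smul op_lie c (lower_op v)"
  by (auto simp: lower_op_def op_lie_def fun_eq_iff coef_sum_vscale contract_vscale)

lemma weight_op_scale: "weight_op (c * d) = smul op_lie c (weight_op d)"
  by (auto simp: weight_op_def op_lie_def fun_eq_iff)

text \<open>On the second copy \<open>v\<close> and \<open>w\<close> exchange roles, so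
  \<open>contract_shift\<close> enters with the opposite sign. This is why \<open>weight_op\<close>
  acts there by \<open>- wsum\<close>, and why the symmetry of \<open>vpair\<close> matters.\<close>

lemma brkt_raise_lower: "brkt op_lie (raise_op v) (lower_op w) = weight_op (vpair v w)"
proof -
  have "lower_op w (raise_op v \<phi>) (b, l) - raise_op v (lower_op w \<phi>) (b, l) =
      weight_op (vpair v w) \<phi> (b, l)" for \<phi> b l
  proof (cases b)
    case True
    then show ?thesis
      using contract_shift[of w l v "\<lambda>m. \<phi> (True, m)"]
      by (simp add: raise_op_def lower_op_def weight_op_def)
  next
    case False
    then show ?thesis
      using contract_shift[of v l w "\<lambda>m. \<phi> (False, m)"]
      by (simp add: raise_op_def lower_op_def weight_op_def vpair_commute[of v w] algebra_simps)
  qed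
  then show ?thesis by (auto simp: op_lie_def fun_eq_iff)
qed

lemma coef_sum_wsum:
  "coef_sum v (\<lambda>a. wsum (a # l) * g a) = coef_sum (wact v) g + wsum l * coef_sum v g"
  by (simp add: coef_sum_wact wsum_def ring_distribs coef_sum_fun_add coef_sum_fun_scale)

lemma brkt_weight_raise: "brkt op_lie (weight_op c) (raise_op v) = raise_op (vscale c (wact v))"
proof -
  have "raise_op v (weight_op c \<phi>) (b, l) - weight_op c (raise_op v \<phi>) (b, l) =
      raise_op (vscale c (wact v)) \<phi> (b, l)" for \<phi> b l
  proof (cases b)
    case True
    then show ?thesis
      using coef_sum_wsum[of v l "\<lambda>a. \<phi> (True, a # l)"]
        coef_sum_fun_scale[of v c "\<lambda>a. wsum (a # l) * \<phi> (True, a # l)"]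
      by (simp add: raise_op_def weight_op_def coef_sum_vscale algebra_simps)
  next
    case False
    then show ?thesis
      using contract_scale[of v l "- c" "\<lambda>m. wsum m * \<phi> (False, m)"]
      by (simp add: raise_op_def weight_op_def contract_vscale contract_wsum_0 algebra_simps)
  qed
  then show ?thesis by (auto simp: op_lie_def fun_eq_iff)
qed

lemma brkt_weight_lower: "brkt op_lie (weight_op c) (lower_op v) = lower_op (vscale (- c) (wact v))"
proof -
  have "lower_op v (weight_op c \<phi>) (b, l) - weight_op c (lower_op v \<phi>) (b, l) =
      lower_op (vscale (- c) (wact v)) \<phi> (b, l)" for \<phi> b l
  proof (cases b)
    case True
    then show ?thesis
      using contract_scale[of v l c "\<lambda>m. wsum m * \<phi> (True, m)"]
      by (simp add: lower_op_def weight_op_def contract_vscale contract_wsum_0 algebra_simps)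
  next
    case False
    then show ?thesis
      using coef_sum_wsum[of v l "\<lambda>a. \<phi> (False, a # l)"]
        coef_sum_fun_scale[of v "- c" "\<lambda>a. wsum (a # l) * \<phi> (False, a # l)"]
      by (simp add: lower_op_def weight_op_def coef_sum_vscale algebra_simps)
  qed
  then show ?thesis by (auto simp: op_lie_def fun_eq_iff)
qed

lemma brkt_weight_weight: "brkt op_lie (weight_op c) (weight_op d) = 0"
  by (auto simp: op_lie_def weight_op_def fun_eq_iff)

lemma inj_raise_op: "inj raise_op"
proof (rule injI, rule coef_inject)
  fix v w a assume "raise_op v = raise_op w"
  \<comment> \<open>The indicator of \<open>[a]\<close>, evaluated at the empty word of the copy on
    which \<open>raise_op\<close> is dual to left multiplication, returns the coefficient of
    \<open>a\<close>. On the other copy the empty word would give 0.\<close>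
  from fun_cong[OF fun_cong[OF this, of "\<lambda>(b, l). if l = [a] then 1 else 0"], of "(True, [])"]
  show "coef v a = coef w a" by (simp add: raise_op_def coef_sum_delta)
qed

lemma inj_lower_op: "inj lower_op"
proof (rule injI, rule coef_inject)
  fix v w a assume "lower_op v = lower_op w"
  from fun_cong[OF fun_cong[OF this, of "\<lambda>(b, l). if l = [a] then 1 else 0"], of "(False, [])"]
  show "coef v a = coef w a" by (simp add: lower_op_def coef_sum_delta)
qed

lemma inj_weight_op: "inj weight_op"
proof (rule injI)
  fix c d assume "weight_op c = weight_op d"
  \<comment> \<open>The word \<open>[None]\<close> has weight 2; at the empty word every
    \<open>weight_op\<close> vanishes.\<close>
  from fun_cong[OF fun_cong[OF this, of "\<lambda>_. 1"], of "(True, [None])"]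
  show "c = d" by (simp add: weight_op_def wsum_def)
qed

definition op_local :: "int \<Rightarrow> (bool \<times> letter list) operator set" where
  "op_local i = (if i = 1 then range raise_op else if i = -1 then range lower_op else range weight_op)"

interpretation op: lie_algebra "op_lie :: 'p operator lie_alg"
  by unfold_locales (rule is_lie_alg_op_lie)

interpretation op_local: local_lie_algebra op_lie op_local
proof unfold_locales
  fix i :: int assume i: "i \<in> {-1, 0, 1}"
  have z: "weight_op 0 = 0" "raise_op 0 = 0" "lower_op 0 = 0"
    using weight_op_add[of 0 0] raise_op_add[of 0 0] lower_op_add[of 0 0] by simp_all
  show "op.subspace (op_local i)"
  proof (rule op.subspaceI)
    show "0 \<in> op_local i"
      unfolding op_local_def using rangeI[of weight_op 0] rangeI[of raise_op 0] rangeI[of lower_op 0]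
      by (simp add: z)
  qed (auto simp: op_local_def simp flip: raise_op_add lower_op_add weight_op_add
      raise_op_scale lower_op_scale weight_op_scale)
  show "op_local i \<subseteq> carr op_lie"
    by (auto simp: op_local_def op_lie_def linear_op_raise linear_op_lower linear_op_weight)
next
  fix i j :: int and a b
  assume ij: "i \<in> {-1, 0, 1}" "j \<in> {-1, 0, 1}" "i + j \<in> {-1, 0, 1}"
    and ab: "a \<in> op_local i" "b \<in> op_local j"
  have carr: "raise_op v \<in> carr op_lie" "lower_op v \<in> carr op_lie" "weight_op c \<in> carr op_lie" for v c
    by (simp_all add: op_lie_def linear_op_raise linear_op_lower linear_op_weight)
  have minus: "- raise_op v = raise_op (vscale (-1) v)" "- lower_op v = lower_op (vscale (-1) v)"
      "- weight_op c = weight_op ((-1) * c)" for v c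
    unfolding raise_op_scale lower_op_scale weight_op_scale by (simp_all add: op_lie_def fun_eq_iff)
  have swapped: "brkt op_lie (lower_op w) (raise_op v) = weight_op (- vpair v w)"
      "brkt op_lie (raise_op v) (weight_op c) = raise_op (vscale (-1) (vscale c (wact v)))"
      "brkt op_lie (lower_op v) (weight_op c) = lower_op (vscale (-1) (vscale (- c) (wact v)))" for v w c
    using op.brkt_swap[OF carr(2) carr(1), of w v] op.brkt_swap[OF carr(1) carr(3), of v c]
      op.brkt_swap[OF carr(2) carr(3), of v c]
    by (simp_all add: brkt_raise_lower brkt_weight_raise brkt_weight_lower minus)
  have w0: "0 = weight_op 0" using weight_op_add[of 0 0] by simp
  show "brkt op_lie a b \<in> op_local (i + j)"
    using ij ab
    by (auto simp: op_local_def brkt_raise_lower brkt_weight_raise brkt_weight_lower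
        brkt_weight_weight swapped w0)
qed

text \<open>Lengths count negatively on the second copy, because there the operators of degree 1
  contract. With this sign \<open>raise_op\<close> shifts the degree in the same way on both copies,
  and so does \<open>lower_op\<close>.\<close>

definition word_deg :: "bool \<times> letter list \<Rightarrow> int" where
  "word_deg p = (if fst p then int (length (snd p)) else - int (length (snd p)))"

definition deg_part :: "int \<Rightarrow> (bool \<times> letter list \<Rightarrow> complex) \<Rightarrow> (bool \<times> letter list \<Rightarrow> complex)" where
  "deg_part k \<phi> = (\<lambda>p. if word_deg p = k then \<phi> p else 0)"

text \<open>Acting on functions, an operator of degree \<open>i\<close> shifts degrees by
  \<open>- i\<close>. Facts \<open>1\<close> and \<open>2\<close> treat contraction on the two
  copies; the empty word gives 0 on both of their sides.\<close>

lemma op_local_deg_part: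
  assumes "i \<in> {-1, 0, 1}" "S \<in> op_local i"
  shows "S (deg_part k \<phi>) = deg_part (k - i) (S \<phi>)"
proof -
  have 1: "contract v l (\<lambda>m. if int (length m) = k then \<phi> m else 0) =
      (if int (length l) = k + 1 then contract v l \<phi> else 0)" for v l k \<phi>
    using contract_restrict[of v l "\<lambda>n. int n = k" \<phi>] by (cases l) auto
  have 2: "contract v l (\<lambda>m. if - int (length m) = k then \<phi> m else 0) =
      (if int (length l) = 1 - k then contract v l \<phi> else 0)" for v l k \<phi>
    using contract_restrict[of v l "\<lambda>n. - int n = k" \<phi>] by (cases l) auto
  have 3: "coef_sum v (\<lambda>a. if c then g a else 0) = (if c then coef_sum v g else 0)" for c v g
    by (simp add: coef_sum_def)
  show ?thesis
    using assms
    by (auto simp: op_local_def deg_part_def raise_op_def lower_op_def weight_op_def word_deg_def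
        fun_eq_iff 1 2 3 split: if_splits)
qed

lemma local_gen_deg_part:
  assumes "local_gen op_lie op_local n S"
  shows "S (deg_part k \<phi>) = deg_part (k - n) (S \<phi>)"
  using assms
proof (induction arbitrary: k \<phi> rule: local_gen.induct)
  case (base i a)
  then show ?case by (rule op_local_deg_part)
next
  case (zero n)
  then show ?case by (simp add: deg_part_def fun_eq_iff)
next
  case (add n S T)
  then show ?case by (auto simp: deg_part_def fun_eq_iff)
next
  case (scale n S c)
  then show ?case by (auto simp: op_lie_def deg_part_def fun_eq_iff)
next
  case (step s n a S)
  then have "s \<in> {-1, 0, 1}" by blast
  then have a: "a (deg_part k \<phi>) = deg_part (k - s) (a \<phi>)" for k \<phi>
    using op_local_deg_part step.hyps(3) by blast
  have d: "deg_part k (\<phi> - \<psi>) = deg_part k \<phi> - deg_part k \<psi>" for k \<phi> \<psi>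
    by (auto simp: deg_part_def fun_eq_iff)
  have "brkt op_lie a S \<psi> = S (a \<psi>) - a (S \<psi>)" for \<psi>
    by (simp add: op_lie_def)
  then show ?case
    using d[of "k - (n + s)" "S (a \<phi>)" "a (S \<phi>)"] by (simp only: step.IH a) (simp add: algebra_simps)
qed

lemma sum_op_apply: "(\<Sum>n\<in>N. v n) \<phi> p = (\<Sum>n\<in>N. v n \<phi> p)" for v :: "'n \<Rightarrow> 'p operator"
  by (induction N rule: infinite_finite_induct) auto

lemma is_graded_lie_op: "is_graded_lie op_local.gen_graded"
proof (rule op_local.is_graded_lie_gen_graded)
  fix N :: "int set" and v and m
  assume N: "finite N" "\<And>n. n \<in> N \<Longrightarrow> local_gen op_lie op_local n (v n)" "sum v N = 0" "m \<in> N"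
  have "v m \<phi> p = 0" for \<phi> p
  proof -
    \<comment> \<open>Applied to the part of \<phi> of degree \<open>word_deg p + m\<close>, the
      operator \<open>v n\<close> yields degree \<open>word_deg p + m - n\<close>, so at
      \<open>p\<close> only the summand \<open>n = m\<close> survives.\<close>
    have "(\<Sum>n\<in>N. v n (deg_part (word_deg p + m) \<phi>) p) = 0"
      using N(3) by (simp flip: sum_op_apply)
    also have "(\<Sum>n\<in>N. v n (deg_part (word_deg p + m) \<phi>) p) = (\<Sum>n\<in>N. if n = m then v n \<phi> p else 0)"
      using local_gen_deg_part[OF N(2)] by (intro sum.cong) (auto simp: deg_part_def)
    finally show ?thesis using N(1,4) by simp
  qed
  then show "v m = 0" by (simp add: fun_eq_iff)
qed

section \<open>A countable spanning set of the local operators and the resulting transitive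
  algebra\<close>

definition op_basis :: "(bool \<times> letter list) operator set" where
  "op_basis = insert (weight_op 1) (\<Union>u\<in>insert (1, 0) (range (\<lambda>k. (0, Poly_Mapping.single k 1))).
     {raise_op u, lower_op u})"

lemma vec_induct [case_names basis add scale]:
  assumes "\<And>u. u \<in> insert (1, 0) (range (\<lambda>k. (0, Poly_Mapping.single k 1))) \<Longrightarrow> P u"
    and "\<And>u v. P u \<Longrightarrow> P v \<Longrightarrow> P (u + v)" and "\<And>c v. P v \<Longrightarrow> P (vscale c v)"
  shows "P v"
proof -
  have "P (0, f)" for f
  proof (induction f rule: update_induct)
    case const
    \<comment> \<open>The induction rule has no case for the zero vector, which is obtained as the
      multiple of a basis vector by 0.\<close>
    have "(0, 0) = vscale 0 (1, 0)"
      by (auto simp: vscale_def intro!: poly_mapping_eqI)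
    then show ?case using assms(1)[of "(1, 0)"] assms(3)[of "(1, 0)" 0] by simp
  next
    case (update f k c)
    have "(0, Poly_Mapping.update k c f) = vscale c (0, Poly_Mapping.single k 1) + (0, f)"
      using update(1)
      by (auto simp: vscale_def in_keys_iff lookup_update lookup_add lookup_single when_def
          intro!: poly_mapping_eqI)
    then show ?case
      using assms(2)[OF assms(3)[OF assms(1)[of "(0, Poly_Mapping.single k 1)"], of c] update(3)]
      by simp
  qed
  from assms(2)[OF assms(3)[OF assms(1), of "(1, 0)" "fst v"] this[of "snd v"]]
  have "P (vscale (fst v) (1, 0) + (0, snd v))" by blast
  moreover have "vscale (fst v) (1, 0) + (0, snd v) = v"
    by (rule coef_inject) (simp, case_tac a, simp_all)
  ultimately show ?thesis by simp
qed

lemma op_local_span: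
  assumes "i \<in> {-1, 0, 1}"
  shows "op_local i \<subseteq> op.span op_basis"
proof -
  have "raise_op v \<in> op.span op_basis" for v
  proof (induction v rule: vec_induct)
    case (basis u)
    then show ?case by (intro op.span_base) (auto simp: op_basis_def)
  next
    case (add u v)
    then show ?case unfolding raise_op_add by (rule op.span_add)
  next
    case (scale c v)
    then show ?case unfolding raise_op_scale by (rule op.span_scale)
  qed
  moreover have "lower_op v \<in> op.span op_basis" for v
  proof (induction v rule: vec_induct)
    case (basis u)
    then show ?case by (intro op.span_base) (auto simp: op_basis_def)
  next
    case (add u v)
    then show ?case unfolding lower_op_add by (rule op.span_add)
  next
    case (scale c v)
    then show ?case unfolding lower_op_scale by (rule op.span_scale)
  qed
  moreover have "weight_op c \<in> op.span op_basis" for c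
    using weight_op_scale[of c 1] op.span_base[of "weight_op 1" op_basis]
    by (simp add: op_basis_def op.span_scale)
  ultimately show ?thesis by (auto simp: op_local_def)
qed

text \<open>The construction in coordinates, free of matrices: \<open>H\<close> parametrises degree
  0 by \<open>complex\<close>, while \<open>E\<close> and \<open>F\<close> parametrise degrees 1 and
  -1 by \<open>complex * espace\<close>. The key type stays arbitrary so that it can be specialised
  to that of \<open>assoc_lie\<close>.\<close>

lemma sl2_graded_exists:
  assumes "infinite (UNIV :: 'k set)"
  obtains L :: "('k \<Rightarrow>\<^sub>0 complex) graded_lie" and H E F where
    "is_graded_lie L" "transitive_graded L"
    "bij_betw H UNIV (homog L 0)" "bij_betw E UNIV (homog L 1)" "bij_betw F UNIV (homog L (-1))"
    "\<And>c d. H (c + d) = H c + H d" "\<And>c d. H (c * d) = smul L c (H d)"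
    "\<And>v w. E (v + w) = E v + E w" "\<And>c v. E (vscale c v) = smul L c (E v)"
    "\<And>v w. F (v + w) = F v + F w" "\<And>c v. F (vscale c v) = smul L c (F v)"
    "\<And>c d. brkt L (H c) (H d) = 0"
    "\<And>c v. brkt L (H c) (E v) = E (vscale c (wact v))"
    "\<And>c v. brkt L (H c) (F v) = F (vscale (- c) (wact v))"
    "\<And>v w. brkt L (E v) (F w) = H (vpair v w)"
proof -
  let ?G = op_local.gen_graded
  interpret G: graded_lie_algebra ?G by unfold_locales (rule is_graded_lie_op)
  have "countable op_basis" by (auto simp: op_basis_def)
  moreover have "op_basis \<subseteq> carr op_lie"
    by (auto simp: op_basis_def op_lie_def linear_op_raise linear_op_lower linear_op_weight)
  ultimately obtain C where C: "countable C" "op_local.gen_carr \<subseteq> op.span C"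
    using op_local.gen_carr_countable_span op_local_span by blast
  then have "carr ?G \<subseteq> module.span (smul ?G) C"
    by (simp add: op_local.gen_graded_def)
  from transitive_quotient_exists[OF is_graded_lie_op assms C(1) this]
  obtain L :: "('k \<Rightarrow>\<^sub>0 complex) graded_lie" and q where L: "is_graded_lie L" "transitive_graded L"
    and q: "lie_hom ?G L q" and hom: "\<And>n. homog L n = q ` homog ?G n"
    and inj: "\<And>i. i \<in> {-1, 0, 1} \<Longrightarrow> inj_on q (homog ?G i)"
    by blast
  have h: "homog ?G 0 = range weight_op" "homog ?G 1 = range raise_op" "homog ?G (-1) = range lower_op"
    using op_local.homog_gen_graded_local[of 0] op_local.homog_gen_graded_local[of 1]
      op_local.homog_gen_graded_local[of "-1"] by (simp_all add: op_local_def)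
  have carr: "weight_op c \<in> carr ?G" "raise_op v \<in> carr ?G" "lower_op v \<in> carr ?G" for c v
    using G.homog_subset[of 0] G.homog_subset[of 1] G.homog_subset[of "-1"] by (auto simp: h)
  have sG: "smul ?G = smul op_lie" and bG: "brkt ?G = brkt op_lie"
    by (simp_all add: op_local.gen_graded_def)
  have qadd: "q (u + v) = q u + q v" if "u \<in> carr ?G" "v \<in> carr ?G" for u v
    using q that by (simp add: lie_hom_def lin_map_def)
  have qscale: "q (smul op_lie c u) = smul L c (q u)" if "u \<in> carr ?G" for c u
    using q that by (simp add: lie_hom_def lin_map_def sG)
  have qbrkt: "brkt L (q u) (q v) = q (brkt op_lie u v)" if "u \<in> carr ?G" "v \<in> carr ?G" for u v
    using q that by (simp add: lie_hom_def bG)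
  have "q 0 = 0"
    using qadd[of 0 0] G.subspace_0[OF G.subspace_carr] by simp
  moreover have "bij_betw (q \<circ> weight_op) UNIV (homog L 0)" "bij_betw (q \<circ> raise_op) UNIV (homog L 1)"
      "bij_betw (q \<circ> lower_op) UNIV (homog L (-1))"
    using inj[of 0] inj[of 1] inj[of "-1"] inj_weight_op inj_raise_op inj_lower_op
    by (auto simp: bij_betw_def hom h image_comp intro!: comp_inj_on)
  ultimately show thesis
    using L carr
    by (intro that[of L "q \<circ> weight_op" "q \<circ> raise_op" "q \<circ> lower_op"])
      (simp_all add: qadd qscale qbrkt weight_op_add raise_op_add lower_op_add weight_op_scale
        raise_op_scale lower_op_scale brkt_weight_weight brkt_weight_raise brkt_weight_lower
        brkt_raise_lower del: o_apply add: o_def)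
qed

section \<open>Uniqueness of the associated Lie algebra\<close>

lemma is_cspace_0:
  assumes "is_cspace V"
  shows "0 \<in> carr V"
proof -
  interpret vector_space "smul V" using assms by (simp add: is_cspace_def)
  show ?thesis using assms by (simp add: is_cspace_def subspace_0)
qed

context graded_lie_algebra
begin

lemma local_part_decomp:
  assumes "a \<in> carr (local_part L)"
  obtains v where "\<And>i. i \<in> {-1, 0, 1} \<Longrightarrow> v i \<in> homog L i" "a = (\<Sum>i\<in>{-1, 0, 1}. v i)"
proof -
  \<comment> \<open>Zero outside the local degrees, so that the decomposition of a span of subspaces
    applies with all integers as indices.\<close>
  let ?D = "\<lambda>n. if n \<in> {-1, 0, 1} then homog L n else {0}"
  have sub: "subspace (?D n)" for n
    using subspace_homog by (simp add: subspace_single_0)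
  have "span (\<Union>n\<in>{-1, 0, 1}. homog L n) \<subseteq> span (\<Union>n. ?D n)"
    by (rule span_mono) force
  then have "a \<in> span (\<Union>n. ?D n)" using assms[unfolded carr_local_part] by (rule subsetD)
  from span_UN_subspaces[OF sub this]
  obtain N v where v: "finite N" "\<And>n. v n \<in> ?D n" "a = sum v N" by blast
  let ?w = "\<lambda>n. if n \<in> N then v n else 0"
  have "v n = 0" if "n \<notin> {-1, 0, 1}" for n
    using v(2)[of n] that by (simp split: if_splits)
  then have "sum v N = (\<Sum>i\<in>N \<inter> {-1, 0, 1}. v i)"
    using v(1) by (intro sum.mono_neutral_right) auto
  also have "\<dots> = (\<Sum>i\<in>{-1, 0, 1}. ?w i)"
    by (intro sum.mono_neutral_cong_left) auto
  finally have sum: "a = (\<Sum>i\<in>{-1, 0, 1}. ?w i)" unfolding v(3) .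
  have mem: "?w i \<in> homog L i" if "i \<in> {-1, 0, 1}" for i
    using v(2)[of i] that subspace_0[OF subspace_homog] by simp
  show thesis by (rule that[OF mem sum])
qed

lemma local_part_sum:
  assumes "\<And>i. i \<in> {-1, 0, 1} \<Longrightarrow> v i \<in> homog L i"
  shows "(\<Sum>i\<in>{-1, 0, 1}. v i) \<in> carr (local_part L)"
  unfolding carr_local_part using assms by (intro span_sum span_base) blast

lemma local_part_decomp_unique:
  assumes "\<And>i. i \<in> {-1, 0, 1} \<Longrightarrow> v i \<in> homog L i" "\<And>i. i \<in> {-1, 0, 1} \<Longrightarrow> w i \<in> homog L i"
    and "(\<Sum>i\<in>{-1, 0, 1}. v i) = (\<Sum>i\<in>{-1, 0, 1}. w i)" and i: "i \<in> {-1, 0, 1}"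
  shows "v i = w i"
proof -
  have "v i - w i = 0"
  proof (rule homog_independent[of "{-1, 0, 1}" "\<lambda>i. v i - w i"])
    show "(\<Sum>i\<in>{-1, 0, 1}. v i - w i) = 0" using assms(3) by (simp only: sum_subtractf diff_self)
  qed (use assms subspace_diff[OF subspace_homog] in auto)
  then show ?thesis by simp
qed

end

text \<open>Antisymmetry supplies the brackets in the opposite order, so four pairs of degrees
  suffice. The map sends a sum of components to the sum of their images, which is well defined
  because the grading is direct.\<close>

lemma local_iso_of_components:
  fixes L :: "('a::ab_group_add, 'm) graded_lie_scheme" and M :: "('b::ab_group_add, 'n) graded_lie_scheme"
  assumes L: "is_graded_lie L" and M: "is_graded_lie M"
    and iso: "\<And>i. i \<in> {-1, 0, 1} \<Longrightarrow> lin_iso (homog_space L i) (homog_space M i) (F i)"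
    and brkt: "\<And>i j a b. (i, j) \<in> {(0, 0), (0, 1), (0, -1), (1, -1)} \<Longrightarrow> a \<in> homog L i \<Longrightarrow>
      b \<in> homog L j \<Longrightarrow> F (i + j) (brkt L a b) = brkt M (F i a) (F j b)"
  shows "\<exists>f. local_iso L M f"
proof -
  interpret L: graded_lie_algebra L by unfold_locales fact
  interpret M: graded_lie_algebra M by unfold_locales fact
  let ?I = "{-1, 0, 1} :: int set"
  have bij: "bij_betw (F i) (homog L i) (homog M i)" if "i \<in> ?I" for i
    using iso[OF that] by (simp add: lin_iso_def homog_space_def)
  have Fh: "F i a \<in> homog M i" if "i \<in> ?I" "a \<in> homog L i" for i a
    using bij[OF that(1)] that(2) by (rule bij_betw_apply)
  have Fadd: "F i (a + b) = F i a + F i b" if "i \<in> ?I" "a \<in> homog L i" "b \<in> homog L i" for i a b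
    using iso[OF that(1)] that by (simp add: lin_iso_def lin_map_def homog_space_def)
  have Fscale: "F i (smul L c a) = smul M c (F i a)" if "i \<in> ?I" "a \<in> homog L i" for i a c
    using iso[OF that(1)] that by (simp add: lin_iso_def lin_map_def homog_space_def)
  have F0: "F i 0 = 0" if "i \<in> ?I" for i
    using Fadd[OF that, of 0 0] L.subspace_0[OF L.subspace_homog] by simp
  have Fminus: "F i (- a) = - F i a" if "i \<in> ?I" "a \<in> homog L i" for i a
    using Fscale[OF that, of "-1"] by simp
  have swapped: "F (i + j) (brkt L a b) = brkt M (F i a) (F j b)"
    if ji: "(j, i) \<in> {(0, 0), (0, 1), (0, -1), (1, -1)}" and ab: "a \<in> homog L i" "b \<in> homog L j" for i j a b
  proof -
    have ij: "i \<in> ?I" "j \<in> ?I" "j + i \<in> ?I" using ji by auto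
    have "F (i + j) (brkt L a b) = - F (j + i) (brkt L b a)"
      using L.brkt_swap[of a b] L.homog_carr ab Fminus[OF ij(3)] L.brkt_homog[OF ab(2,1)]
      by (simp add: add.commute)
    also have "\<dots> = - brkt M (F j b) (F i a)" using brkt[OF ji ab(2,1)] by simp
    also have "\<dots> = brkt M (F i a) (F j b)"
      using M.brkt_swap[of "F i a" "F j b"] M.homog_carr[OF Fh[OF ij(1) ab(1)]]
        M.homog_carr[OF Fh[OF ij(2) ab(2)]] by simp
    finally show ?thesis .
  qed
  have br: "F (i + j) (brkt L a b) = brkt M (F i a) (F j b)"
    if "i \<in> ?I" "j \<in> ?I" "i + j \<in> ?I" "a \<in> homog L i" "b \<in> homog L j" for i j a b
  proof -
    have "(i, j) \<in> {(0, 0), (0, 1), (0, -1), (1, -1)} \<or> (j, i) \<in> {(0, 0), (0, 1), (0, -1), (1, -1)}"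
      using that(1-3) by auto
    then show ?thesis using brkt[of i j a b] swapped[of j i a b] that(4,5) by blast
  qed
  define dec where "dec a = (SOME v. (\<forall>i\<in>?I. v i \<in> homog L i) \<and> a = (\<Sum>i\<in>?I. v i))" for a
  define f where "f a = (\<Sum>i\<in>?I. F i (dec a i))" for a
  have f_sum: "f (\<Sum>i\<in>?I. v i) = (\<Sum>i\<in>?I. F i (v i))" if v: "\<And>i. i \<in> ?I \<Longrightarrow> v i \<in> homog L i" for v
  proof -
    let ?a = "\<Sum>i\<in>?I. v i"
    have "\<exists>v. (\<forall>i\<in>?I. v i \<in> homog L i) \<and> ?a = (\<Sum>i\<in>?I. v i)" using v by blast
    then have d: "(\<forall>i\<in>?I. dec ?a i \<in> homog L i) \<and> ?a = (\<Sum>i\<in>?I. dec ?a i)"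
      unfolding dec_def by (rule someI_ex)
    have "dec ?a i = v i" if "i \<in> ?I" for i
      by (rule L.local_part_decomp_unique[OF _ v _ that]) (use d in auto)
    then show ?thesis unfolding f_def by (intro sum.cong) auto
  qed
  have f_homog: "f a = F i a" if i: "i \<in> ?I" and a: "a \<in> homog L i" for i a
  proof -
    let ?v = "\<lambda>j. if j = i then a else 0"
    have "f (\<Sum>j\<in>?I. ?v j) = (\<Sum>j\<in>?I. F j (?v j))"
      using a L.subspace_0[OF L.subspace_homog] by (intro f_sum) auto
    also have "(\<Sum>j\<in>?I. F j (?v j)) = (\<Sum>j\<in>?I. if j = i then F i a else 0)"
      using F0 by (intro sum.cong) auto
    finally show ?thesis using i by (simp add: sum.delta del: sum.insert)
  qed
  have lin: "lin_map (local_part L) (local_part M) f"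
    unfolding lin_map_def L.smul_local_part M.smul_local_part
  proof (intro conjI ballI allI)
    fix a assume "a \<in> carr (local_part L)"
    then obtain v where v: "\<And>i. i \<in> ?I \<Longrightarrow> v i \<in> homog L i" "a = (\<Sum>i\<in>?I. v i)"
      by (rule L.local_part_decomp) blast
    have fa: "f a = (\<Sum>i\<in>?I. F i (v i))" unfolding v(2) by (rule f_sum) (rule v(1))
    show "f a \<in> carr (local_part M)"
      unfolding fa by (rule M.local_part_sum) (rule Fh[OF _ v(1)])
    fix c
    have "smul L c a = (\<Sum>i\<in>?I. smul L c (v i))" unfolding v(2) by (rule L.scale_sum_right)
    then have "f (smul L c a) = (\<Sum>i\<in>?I. F i (smul L c (v i)))"
      using f_sum[of "\<lambda>i. smul L c (v i)"] v(1) L.subspace_scale[OF L.subspace_homog] by metis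
    also have "\<dots> = (\<Sum>i\<in>?I. smul M c (F i (v i)))"
      using Fscale v(1) by (intro sum.cong) auto
    also have "\<dots> = smul M c (f a)"
      unfolding fa by (rule M.scale_sum_right[symmetric])
    finally show "f (smul L c a) = smul M c (f a)" .
  next
    fix a b assume "a \<in> carr (local_part L)" "b \<in> carr (local_part L)"
    then obtain v w where v: "\<And>i. i \<in> ?I \<Longrightarrow> v i \<in> homog L i" "a = (\<Sum>i\<in>?I. v i)"
      and w: "\<And>i. i \<in> ?I \<Longrightarrow> w i \<in> homog L i" "b = (\<Sum>i\<in>?I. w i)"
      using L.local_part_decomp by metis
    have fa: "f a = (\<Sum>i\<in>?I. F i (v i))" unfolding v(2) by (rule f_sum) (rule v(1))
    have fb: "f b = (\<Sum>i\<in>?I. F i (w i))" unfolding w(2) by (rule f_sum) (rule w(1))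
    have "a + b = (\<Sum>i\<in>?I. v i + w i)" unfolding v(2) w(2) by (rule sum.distrib[symmetric])
    then have "f (a + b) = (\<Sum>i\<in>?I. F i (v i + w i))"
      using f_sum[of "\<lambda>i. v i + w i"] v(1) w(1) L.subspace_add[OF L.subspace_homog] by metis
    also have "\<dots> = (\<Sum>i\<in>?I. F i (v i) + F i (w i))"
      using Fadd v(1) w(1) by (intro sum.cong) auto
    also have "\<dots> = f a + f b"
      unfolding fa fb by (rule sum.distrib)
    finally show "f (a + b) = f a + f b" .
  qed
  have inj: "inj_on f (carr (local_part L))"
  proof (rule inj_onI)
    fix a b assume "a \<in> carr (local_part L)" "b \<in> carr (local_part L)" and eq: "f a = f b"
    then obtain v w where v: "\<And>i. i \<in> ?I \<Longrightarrow> v i \<in> homog L i" "a = (\<Sum>i\<in>?I. v i)"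
      and w: "\<And>i. i \<in> ?I \<Longrightarrow> w i \<in> homog L i" "b = (\<Sum>i\<in>?I. w i)"
      using L.local_part_decomp by metis
    have fa: "f a = (\<Sum>i\<in>?I. F i (v i))" unfolding v(2) by (rule f_sum) (rule v(1))
    have fb: "f b = (\<Sum>i\<in>?I. F i (w i))" unfolding w(2) by (rule f_sum) (rule w(1))
    have eq': "(\<Sum>i\<in>?I. F i (v i)) = (\<Sum>i\<in>?I. F i (w i))"
      using eq unfolding fa fb .
    have "v i = w i" if i: "i \<in> ?I" for i
    proof -
      have "F i (v i) = F i (w i)"
        by (rule M.local_part_decomp_unique[OF _ _ eq' i]) (use Fh v(1) w(1) in blast)+
      then show ?thesis using bij[OF i] v(1)[OF i] w(1)[OF i] by (auto simp: bij_betw_def inj_on_def)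
    qed
    then show "a = b" unfolding v(2) w(2) by (intro sum.cong) auto
  qed
  have surj: "carr (local_part M) \<subseteq> f ` carr (local_part L)"
  proof
    fix b assume "b \<in> carr (local_part M)"
    then obtain w where w: "\<And>i. i \<in> ?I \<Longrightarrow> w i \<in> homog M i" "b = (\<Sum>i\<in>?I. w i)"
      by (rule M.local_part_decomp) blast
    have "\<exists>v. v \<in> homog L i \<and> F i v = w i" if "i \<in> ?I" for i
      using bij[OF that] w(1)[OF that] unfolding bij_betw_def by (metis imageE)
    then obtain v where v: "\<And>i. i \<in> ?I \<Longrightarrow> v i \<in> homog L i \<and> F i (v i) = w i" by metis
    then have "f (\<Sum>i\<in>?I. v i) = b" unfolding w(2) using f_sum[of v] by (simp cong: sum.cong)
    moreover have "(\<Sum>i\<in>?I. v i) \<in> carr (local_part L)" using L.local_part_sum v by blast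
    ultimately show "b \<in> f ` carr (local_part L)" by blast
  qed
  have "f ` carr (local_part L) \<subseteq> carr (local_part M)" using lin unfolding lin_map_def by blast
  then have "lin_iso (local_part L) (local_part M) f"
    using lin inj surj unfolding lin_iso_def bij_betw_def by blast
  moreover have "f ` homog L i = homog M i" if "i \<in> ?I" for i
    using bij[OF that] f_homog[OF that] unfolding bij_betw_def by (simp cong: image_cong)
  moreover have "f (brkt L a b) = brkt M (f a) (f b)"
    if "i \<in> ?I" "j \<in> ?I" "i + j \<in> ?I" "a \<in> homog L i" "b \<in> homog L j" for i j a b
    using br[OF that] f_homog[OF that(3) L.brkt_homog[OF that(4,5)]] f_homog[OF that(1,4)]
      f_homog[OF that(2,5)] by simp
  ultimately have "local_iso L M f" unfolding local_iso_def by blast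
  then show ?thesis by blast
qed

lemma local_iso_inv_comp:
  assumes N: "is_graded_lie N" and L: "is_graded_lie L" and M: "is_graded_lie M"
    and f: "local_iso N L f" and g: "local_iso M L g"
  shows "local_iso N M (\<lambda>a. inv_into (carr (local_part M)) g (f a))"
proof -
  interpret N: graded_lie_algebra N by unfold_locales fact
  interpret L: graded_lie_algebra L by unfold_locales fact
  interpret M: graded_lie_algebra M by unfold_locales fact
  define k where "k = inv_into (carr (local_part M)) g"
  have gb: "bij_betw g (carr (local_part M)) (carr (local_part L))"
    and gl: "lin_map (local_part M) (local_part L) g"
    and fb: "bij_betw f (carr (local_part N)) (carr (local_part L))"
    and fl: "lin_map (local_part N) (local_part L) f"
    using f g by (simp_all add: local_iso_def lin_iso_def)
  have kb: "bij_betw k (carr (local_part L)) (carr (local_part M))"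
    unfolding k_def by (rule bij_betw_inv_into[OF gb])
  have gk: "g (k a) = a" if "a \<in> carr (local_part L)" for a
    unfolding k_def using gb that by (auto simp: bij_betw_def f_inv_into_f)
  have kg: "k (g a) = a" if "a \<in> carr (local_part M)" for a
    unfolding k_def using gb that by (auto simp: bij_betw_def inv_into_f_f)
  have kc: "k a \<in> carr (local_part M)" if "a \<in> carr (local_part L)" for a
    using kb that by (rule bij_betw_apply)
  have fc: "f a \<in> carr (local_part L)" if "a \<in> carr (local_part N)" for a
    using fb that by (rule bij_betw_apply)
  have kadd: "k (a + b) = k a + k b" if "a \<in> carr (local_part L)" "b \<in> carr (local_part L)" for a b
  proof -
    have "g (k a + k b) = a + b" using gl kc gk that by (simp add: lin_map_def)
    moreover have "k a + k b \<in> carr (local_part M)"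
      using kc[OF that(1)] kc[OF that(2)] by (simp add: M.carr_local_part M.span_add)
    ultimately show ?thesis using kg by metis
  qed
  have kscale: "k (smul L c a) = smul M c (k a)" if "a \<in> carr (local_part L)" for c a
  proof -
    have "g (smul M c (k a)) = smul L c a"
      using gl kc gk that by (simp add: lin_map_def M.smul_local_part L.smul_local_part)
    moreover have "smul M c (k a) \<in> carr (local_part M)"
      using kc[OF that(1)] by (simp add: M.carr_local_part M.span_scale)
    ultimately show ?thesis using kg by metis
  qed
  have gim: "g ` homog M i = homog L i" if "i \<in> {-1, 0, 1}" for i
    using g that unfolding local_iso_def by blast
  have fim: "f ` homog N i = homog L i" if "i \<in> {-1, 0, 1}" for i
    using f that unfolding local_iso_def by blast
  have kim: "k ` homog L i = homog M i" if "i \<in> {-1, 0, 1}" for i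
    unfolding gim[OF that, symmetric] image_image using kg M.homog_local_part[OF that]
    by (simp cong: image_cong)
  have kh: "k a \<in> homog M i" if "i \<in> {-1, 0, 1}" "a \<in> homog L i" for i a
    using kim that by blast
  have fh: "f a \<in> homog L i" if "i \<in> {-1, 0, 1}" "a \<in> homog N i" for i a
    using fim that by blast
  have kbr: "k (brkt L a b) = brkt M (k a) (k b)"
    if ij: "i \<in> {-1, 0, 1}" "j \<in> {-1, 0, 1}" "i + j \<in> {-1, 0, 1}" and ab: "a \<in> homog L i" "b \<in> homog L j"
    for i j a b
  proof -
    have "g (brkt M (k a) (k b)) = brkt L (g (k a)) (g (k b))"
      using g ij kh[OF ij(1) ab(1)] kh[OF ij(2) ab(2)] unfolding local_iso_def by blast
    also have "\<dots> = brkt L a b"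
      using gk L.homog_local_part[OF ij(1) ab(1)] L.homog_local_part[OF ij(2) ab(2)] by simp
    finally show ?thesis
      using kg[OF M.homog_local_part[OF ij(3) M.brkt_homog[OF kh[OF ij(1) ab(1)] kh[OF ij(2) ab(2)]]]]
      by simp
  qed
  have "local_iso N M (\<lambda>a. k (f a))"
    unfolding local_iso_def
  proof (intro conjI ballI impI)
    have "lin_map (local_part N) (local_part M) (\<lambda>a. k (f a))"
      using fl fc kc kadd kscale
      by (simp add: lin_map_def N.smul_local_part L.smul_local_part M.smul_local_part)
    moreover have "bij_betw (\<lambda>a. k (f a)) (carr (local_part N)) (carr (local_part M))"
      using bij_betw_trans[OF fb kb] by (simp add: o_def)
    ultimately show "lin_iso (local_part N) (local_part M) (\<lambda>a. k (f a))"
      by (simp add: lin_iso_def)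
  next
    fix i :: int assume "i \<in> {-1, 0, 1}"
    then show "(\<lambda>a. k (f a)) ` homog N i = homog M i"
      using fim kim by (metis image_image)
  next
    fix i j :: int and a b
    assume ij: "i \<in> {-1, 0, 1}" "j \<in> {-1, 0, 1}" "i + j \<in> {-1, 0, 1}"
      and ab: "a \<in> homog N i" "b \<in> homog N j"
    have "f (brkt N a b) = brkt L (f a) (f b)"
      using f ij ab unfolding local_iso_def by blast
    then show "k (f (brkt N a b)) = brkt M (k (f a)) (k (f b))"
      using kbr[OF ij fh[OF ij(1) ab(1)] fh[OF ij(2) ab(2)]] by simp
  qed
  then show ?thesis unfolding k_def .
qed

text \<open>Both values have the same prescribed product with every \<open>a\<close>, so their
  difference is orthogonal to the whole algebra and vanishes by non-degeneracy of
  \<open>pB\<close>.\<close>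

lemma is_Phi_unique:
  assumes P: "is_pentad P" and \<Phi>: "is_Phi P \<Phi>" "is_Phi P \<Psi>"
    and v: "v \<in> carr (pV P)" and w: "w \<in> carr (pW P)"
  shows "\<Phi> v w = \<Psi> v w"
proof -
  have "is_lie_alg (pg P)" using P by (simp add: is_pentad_def)
  then interpret g: lie_algebra "pg P" by unfold_locales
  have c: "\<Phi> v w \<in> carr (pg P)" "\<Psi> v w \<in> carr (pg P)"
    using \<Phi> v w by (simp_all add: is_Phi_def bilin_map_def lin_map_def)
  have d: "\<Phi> v w - \<Psi> v w \<in> carr (pg P)"
    using g.subspace_diff[OF g.subspace_carr c] .
  have bil: "bilin_map (pg P) (pg P) complex_line (pB P)" using P by (simp add: is_pentad_def)
  have "pB P a (\<Phi> v w - \<Psi> v w) = 0" if a: "a \<in> carr (pg P)" for a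
  proof -
    have "pB P a (\<Phi> v w - \<Psi> v w + \<Psi> v w) = pB P a (\<Phi> v w - \<Psi> v w) + pB P a (\<Psi> v w)"
      using bil a c d unfolding bilin_map_def lin_map_def by blast
    moreover have "pB P a (\<Phi> v w) = pB P a (\<Psi> v w)"
      using \<Phi> a v w by (simp add: is_Phi_def)
    ultimately show ?thesis by simp
  qed
  then have "\<Phi> v w - \<Psi> v w = 0"
    using P d unfolding is_pentad_def nondegenerate_def by blast
  then show ?thesis by simp
qed

text \<open>In each degree the isomorphism goes back to the pentad by the inverse of one
  parametrisation and forth by the other. The two structures may come with different maps \<Phi> and
  \<Psi>; the brackets of degree 1 with degree -1 match because these agree on the carriers.\<close>

lemma is_assoc_lie_local_iso:
  assumes "is_assoc_lie P L" "is_assoc_lie P M"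
  shows "\<exists>f. local_iso L M f"
proof -
  have gr: "is_graded_lie L" "is_graded_lie M" and P: "is_pentad P"
    using assms by (simp_all add: is_assoc_lie_def minimal_graded_lie_def standard_pentad_def)
  from assms(1) obtain \<Phi> i0 i1 im where i:
      "is_Phi P \<Phi>"
      "lin_iso (pg P) (homog_space L 0) i0"
      "lin_iso (pV P) (homog_space L 1) i1"
      "lin_iso (pW P) (homog_space L (-1)) im"
      "\<forall>a\<in>carr (pg P). \<forall>b\<in>carr (pg P). brkt L (i0 a) (i0 b) = i0 (brkt (pg P) a b)"
      "\<forall>a\<in>carr (pg P). \<forall>v\<in>carr (pV P). brkt L (i0 a) (i1 v) = i1 (prho P a v)"
      "\<forall>a\<in>carr (pg P). \<forall>\<phi>\<in>carr (pW P). brkt L (i0 a) (im \<phi>) = im (pvarrho P a \<phi>)"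
      "\<forall>v\<in>carr (pV P). \<forall>\<phi>\<in>carr (pW P). brkt L (i1 v) (im \<phi>) = i0 (\<Phi> v \<phi>)"
    unfolding is_assoc_lie_def by (elim conjE exE)
  from assms(2) obtain \<Psi> k0 k1 km where k:
      "is_Phi P \<Psi>"
      "lin_iso (pg P) (homog_space M 0) k0"
      "lin_iso (pV P) (homog_space M 1) k1"
      "lin_iso (pW P) (homog_space M (-1)) km"
      "\<forall>a\<in>carr (pg P). \<forall>b\<in>carr (pg P). brkt M (k0 a) (k0 b) = k0 (brkt (pg P) a b)"
      "\<forall>a\<in>carr (pg P). \<forall>v\<in>carr (pV P). brkt M (k0 a) (k1 v) = k1 (prho P a v)"
      "\<forall>a\<in>carr (pg P). \<forall>\<phi>\<in>carr (pW P). brkt M (k0 a) (km \<phi>) = km (pvarrho P a \<phi>)"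
      "\<forall>v\<in>carr (pV P). \<forall>\<phi>\<in>carr (pW P). brkt M (k1 v) (km \<phi>) = k0 (\<Psi> v \<phi>)"
    unfolding is_assoc_lie_def by (elim conjE exE)
  have lie: "is_lie_alg (pg P)" and V: "is_cspace (pV P)" and W: "is_cspace (pW P)"
    using P by (simp_all add: is_pentad_def)
  have g: "is_cspace (pg P)" using lie by (simp add: is_lie_alg_def)
  have step: "lin_iso (homog_space L n) (homog_space M n) (\<lambda>a. kk (inv_into (carr U) ii a))"
    if "is_cspace U" "lin_iso U (homog_space L n) ii" "lin_iso U (homog_space M n) kk"
    for n ii kk and U :: "('u::ab_group_add, 'o) cspace_scheme"
  proof -
    interpret U: vector_space "smul U" using that(1) by (simp add: is_cspace_def)
    have sU: "U.subspace (carr U)" using that(1) by (simp add: is_cspace_def)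
    have ib: "bij_betw ii (carr U) (homog L n)" and kb: "bij_betw kk (carr U) (homog M n)"
      and il: "lin_map U (homog_space L n) ii" and kl: "lin_map U (homog_space M n) kk"
      using that by (simp_all add: lin_iso_def homog_space_def)
    have inv: "inv_into (carr U) ii (ii u) = u" if "u \<in> carr U" for u
      using ib that by (auto simp: bij_betw_def inv_into_f_f)
    have im: "homog L n = ii ` carr U" using ib by (simp add: bij_betw_def)
    have add: "ii u + ii v = ii (u + v)" "u + v \<in> carr U" if "u \<in> carr U" "v \<in> carr U" for u v
      using il that U.subspace_add[OF sU] by (simp_all add: lin_map_def)
    have scale: "smul L c (ii u) = ii (smul U c u)" "smul U c u \<in> carr U" if "u \<in> carr U" for c u
      using il that U.subspace_scale[OF sU] by (simp_all add: lin_map_def homog_space_def)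
    have "lin_map (homog_space L n) (homog_space M n) (\<lambda>a. kk (inv_into (carr U) ii a))"
      using kl by (auto simp: lin_map_def homog_space_def im inv add scale)
    moreover have "bij_betw (\<lambda>a. kk (inv_into (carr U) ii a)) (homog L n) (homog M n)"
      using bij_betw_trans[OF bij_betw_inv_into[OF ib] kb] by (simp add: o_def)
    ultimately show ?thesis by (simp add: lin_iso_def homog_space_def)
  qed
  have inv: "inv_into (carr U) ii (ii u) = u"
    if "lin_iso U N ii" "u \<in> carr U" for U :: "('u::ab_group_add, 'o) cspace_scheme"
      and N :: "('n::ab_group_add) cspace" and ii u
    using that by (auto simp: lin_iso_def bij_betw_def inv_into_f_f)
  define F where "F n = (if n = 0 then (\<lambda>a. k0 (inv_into (carr (pg P)) i0 a))
      else if n = 1 then (\<lambda>a. k1 (inv_into (carr (pV P)) i1 a))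
      else (\<lambda>a. km (inv_into (carr (pW P)) im a)))" for n :: int
  show ?thesis
  proof (rule local_iso_of_components[OF gr])
    fix n :: int assume "n \<in> {-1, 0, 1}"
    then show "lin_iso (homog_space L n) (homog_space M n) (F n)"
      using step[OF g i(2) k(2)] step[OF V i(3) k(3)] step[OF W i(4) k(4)] by (auto simp: F_def)
  next
    have F0: "F 0 (i0 a) = k0 a" if "a \<in> carr (pg P)" for a using inv[OF i(2) that] by (simp add: F_def)
    have F1: "F 1 (i1 v) = k1 v" if "v \<in> carr (pV P)" for v using inv[OF i(3) that] by (simp add: F_def)
    have Fm: "F (-1) (im w) = km w" if "w \<in> carr (pW P)" for w using inv[OF i(4) that] by (simp add: F_def)
    have im: "homog L 0 = i0 ` carr (pg P)" "homog L 1 = i1 ` carr (pV P)" "homog L (-1) = im ` carr (pW P)"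
      using i(2-4) by (simp_all add: lin_iso_def bij_betw_def homog_space_def)
    have c: "brkt (pg P) a b \<in> carr (pg P)" "prho P a v \<in> carr (pV P)" "pvarrho P a w \<in> carr (pW P)"
        "\<Phi> v w \<in> carr (pg P)"
      if "a \<in> carr (pg P)" "b \<in> carr (pg P)" "v \<in> carr (pV P)" "w \<in> carr (pW P)" for a b v w
      using that P i(1)
      by (simp_all add: is_pentad_def is_lie_alg_def lie_rep_def is_Phi_def bilin_map_def lin_map_def)
    \<comment> \<open>Values for those arguments of \<open>c\<close> that a case does not
      involve.\<close>
    have z: "0 \<in> carr (pg P)" "0 \<in> carr (pV P)" "0 \<in> carr (pW P)"
      using g V W by (simp_all add: is_cspace_0)
    fix n m a b
    assume "(n, m) \<in> {(0::int, 0::int), (0, 1), (0, -1), (1, -1)}" "a \<in> homog L n" "b \<in> homog L m"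
    then consider u v where "n = 0" "m = 0" "u \<in> carr (pg P)" "v \<in> carr (pg P)" "a = i0 u" "b = i0 v"
      | u v where "n = 0" "m = 1" "u \<in> carr (pg P)" "v \<in> carr (pV P)" "a = i0 u" "b = i1 v"
      | u v where "n = 0" "m = -1" "u \<in> carr (pg P)" "v \<in> carr (pW P)" "a = i0 u" "b = im v"
      | u v where "n = 1" "m = -1" "u \<in> carr (pV P)" "v \<in> carr (pW P)" "a = i1 u" "b = im v"
      by (auto simp: im)
    then show "F (n + m) (brkt L a b) = brkt M (F n a) (F m b)"
    proof cases
      case 1
      then show ?thesis using i(5) k(5) c[OF 1(3,4) z(2,3)] F0 by simp
    next
      case 2
      then show ?thesis using i(6) k(6) c[OF 2(3,3,4) z(3)] F0 F1 by simp
    next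
      case 3
      then show ?thesis using i(7) k(7) c[OF 3(3,3) z(2) 3(4)] F0 Fm by simp
    next
      case 4
      then show ?thesis
        using i(8) k(8) c[OF z(1,1) 4(3,4)] F0 F1 Fm is_Phi_unique[OF P i(1) k(1) 4(3,4)] by simp
    qed
  qed
qed

text \<open>\<open>L\<close> is known to be minimal only on its own type. \<open>M\<close> lives
  there too, so a local isomorphism \<open>g\<close> from \<open>M\<close> to \<open>L\<close>
  extends to an epimorphism \<open>G\<close>. A competitor \<open>N\<close> on any type is mapped
  onto \<open>M\<close> by an extension \<open>F\<close> of \<open>f\<close> followed by the inverse
  of \<open>g\<close>, because \<open>M\<close> is transitive; \<open>F\<close> followed by
  \<open>G\<close> then restricts to \<open>f\<close>.\<close>

lemma is_assoc_lie_minimal: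
  fixes L M :: "('l::ab_group_add) graded_lie"
  assumes M: "is_assoc_lie P M" "transitive_graded M" and L: "is_assoc_lie P L"
  shows "minimal_graded_lie TYPE('d::ab_group_add) L"
  unfolding minimal_graded_lie_def
proof (intro conjI allI impI)
  have gr: "is_graded_lie L" "is_graded_lie M"
    using L M by (simp_all add: is_assoc_lie_def minimal_graded_lie_def)
  show "is_graded_lie L" by fact
  fix N :: "'d graded_lie" and f
  assume "is_graded_lie N \<and> local_iso N L f"
  then have N: "is_graded_lie N" "local_iso N L f" by auto
  obtain g where g: "local_iso M L g" using is_assoc_lie_local_iso[OF M(1) L] by blast
  obtain G where G: "lie_hom M L G" "G ` carr M = carr L" "\<forall>a\<in>carr (local_part M). G a = g a"
    using L gr(2) g unfolding is_assoc_lie_def minimal_graded_lie_def by blast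
  let ?k = "\<lambda>a. inv_into (carr (local_part M)) g (f a)"
  have k: "local_iso N M ?k"
    by (rule local_iso_inv_comp[OF N(1) gr N(2) g])
  have "minimal_graded_lie TYPE('d) M"
    by (rule transitive_graded_imp_minimal[OF gr(2) M(2)])
  then obtain F where F: "lie_hom N M F" "F ` carr N = carr M" "\<forall>a\<in>carr (local_part N). F a = ?k a"
    using N(1) k unfolding minimal_graded_lie_def by blast
  have "lie_hom N L (\<lambda>a. G (F a))"
    using G(1) F(1) by (simp add: lie_hom_def lin_map_def)
  moreover have "(\<lambda>a. G (F a)) ` carr N = carr L"
    using G(2) F(2) by (metis image_image)
  moreover have "\<forall>a\<in>carr (local_part N). G (F a) = f a"
  proof
    fix a assume a: "a \<in> carr (local_part N)"
    have "f a \<in> carr (local_part L)"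
      using N(2) a by (auto simp: local_iso_def lin_iso_def lin_map_def)
    then have "f a \<in> g ` carr (local_part M)"
      using g by (simp add: local_iso_def lin_iso_def bij_betw_def)
    then have "g (?k a) = f a" "?k a \<in> carr (local_part M)"
      by (rule f_inv_into_f, rule inv_into_into)
    then show "G (F a) = f a" using F(3) G(3) a by simp
  qed
  ultimately show "\<exists>F. lie_hom N L F \<and> F ` carr N = carr L \<and> (\<forall>a\<in>carr (local_part N). F a = f a)"
    by blast
qed

section \<open>The pentad\<close>

lemma mat_smul_nth [simp]: "mat_smul c A $ i $ j = c * A $ i $ j"
  by (simp add: mat_smul_def)

lemma vector_space_mat_smul: "vector_space mat_smul"
  by unfold_locales (simp_all add: vec_eq_iff algebra_simps)

interpretation mat: vector_space mat_smul
  by (rule vector_space_mat_smul)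

lemma mat_smul_mult: "mat_smul c A ** B = mat_smul c (A ** B)" "A ** mat_smul c B = mat_smul c (A ** B)"
  by (simp_all add: vec_eq_iff matrix_matrix_mult_def sum_distrib_left ac_simps)

lemma smul_sl2 [simp]: "smul sl2 = mat_smul"
  by (simp add: sl2_def)

lemma brkt_sl2: "brkt sl2 A B = A ** B - B ** A"
  by (simp add: sl2_def)

lemma brkt_sl2_smul:
  "brkt sl2 (mat_smul c A) B = mat_smul c (brkt sl2 A B)" "brkt sl2 A (mat_smul c B) = mat_smul c (brkt sl2 A B)"
  by (simp_all add: brkt_sl2 mat_smul_mult mat.scale_right_diff_distrib)

lemma brkt_sl2_self: "brkt sl2 A A = 0"
  by (simp add: brkt_sl2)

lemma brkt_sl2_add: "brkt sl2 A (B + C) = brkt sl2 A B + brkt sl2 A C"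
  by (simp add: brkt_sl2 vec_eq_iff matrix_matrix_mult_def sum.distrib algebra_simps)

lemma brkt_sl2_minus: "brkt sl2 A (- B) = - brkt sl2 A B"
  using brkt_sl2_smul(2)[of A "-1" B] by simp

lemma brkt_sl2_0: "brkt sl2 A 0 = 0"
  using brkt_sl2_smul(2)[of A 0 0] by simp

text \<open>The Killing form is a trace in an unspecified basis \<open>B\<close>; the eigenbasis \<open>B'\<close> evaluates it.\<close>

lemma (in vector_space) sum_representation_eigenbasis:
  assumes B: "independent B" and B': "independent B'" "finite B'" and sp: "span B = span B'"
    and lin: "Vector_Spaces.linear scale scale T" and eig: "\<And>b. b \<in> B' \<Longrightarrow> T b = scale (ev b) b"
  shows "(\<Sum>e\<in>B. representation B (T e) e) = (\<Sum>b\<in>B'. ev b)"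
proof -
  interpret T: Vector_Spaces.linear scale scale T by fact
  have Bf: "finite B"
    using independent_span_bound[OF B'(2) B] sp span_superset by blast
  have inB: "b \<in> span B" if "b \<in> B'" for b using that sp span_base by blast
  have inB': "e \<in> span B'" if "e \<in> B" for e using that sp span_base by blast
  have "(\<Sum>e\<in>B. representation B (T e) e) =
      (\<Sum>e\<in>B. \<Sum>b\<in>B'. representation B' e b * ev b * representation B b e)"
  proof (rule sum.cong[OF refl])
    fix e assume e: "e \<in> B"
    have "T e = T (\<Sum>b\<in>B'. scale (representation B' e b) b)"
      using sum_representation_eq[OF B'(1) inB'[OF e] B'(2) order_refl] by simp
    also have "\<dots> = (\<Sum>b\<in>B'. scale (representation B' e b * ev b) b)"
      by (simp add: T.sum T.scale eig)
    finally have "representation B (T e) = (\<lambda>d. \<Sum>b\<in>B'. representation B (scale (representation B' e b * ev b) b) d)"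
      using representation_sum[OF B, of B' "\<lambda>b. scale (representation B' e b * ev b) b"] inB
      by (simp add: span_scale)
    then show "representation B (T e) e = (\<Sum>b\<in>B'. representation B' e b * ev b * representation B b e)"
      using inB by (simp add: representation_scale[OF B])
  qed
  \<comment> \<open>After the exchange of sums the factor of \<open>ev b\<close> is a diagonal entry
    of the product of the two base change matrices, hence 1.\<close>
  also have "\<dots> = (\<Sum>b\<in>B'. \<Sum>e\<in>B. representation B' e b * ev b * representation B b e)"
    by (rule sum.swap)
  also have "\<dots> = (\<Sum>b\<in>B'. ev b)"
  proof (rule sum.cong[OF refl])
    fix b assume b: "b \<in> B'"
    have "representation B' b b = representation B' (\<Sum>e\<in>B. scale (representation B b e) e) b"
      using sum_representation_eq[OF B inB[OF b] Bf order_refl] by simp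
    also have "\<dots> = (\<Sum>e\<in>B. representation B b e * representation B' e b)"
      using representation_sum[OF B'(1), of B "\<lambda>e. scale (representation B b e) e"] inB'
      by (simp add: span_scale representation_scale[OF B'(1)])
    finally have "(\<Sum>e\<in>B. representation B b e * representation B' e b) = 1"
      using representation_basis[OF B'(1) b] by simp
    then have "ev b * (\<Sum>e\<in>B. representation B b e * representation B' e b) = ev b" by simp
    then show "(\<Sum>e\<in>B. representation B' e b * ev b * representation B b e) = ev b"
      by (simp add: sum_distrib_left ac_simps)
  qed
  finally show ?thesis .
qed

section \<open>Coordinates in \<open>complex * espace\<close> for the two spaces of the
  pentad\<close>

definition lvec :: "cmat2 \<Rightarrow> complex \<times> espace \<Rightarrow> cmat2 \<times> espace" where
  "lvec z v = (mat_smul (fst v) z, snd v)"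

definition lcoords :: "cmat2 \<Rightarrow> cmat2 \<times> espace \<Rightarrow> complex \<times> espace" where
  "lcoords z p = (line_coord z (fst p), snd p)"

lemma line_coord: "z \<noteq> 0 \<Longrightarrow> line_coord z (mat_smul c z) = c"
  unfolding line_coord_def by (rule the_equality) (auto simp: mat.scale_cancel_right)

lemma line_iff: "u \<in> line z \<longleftrightarrow> (\<exists>c. u = mat_smul c z)"
  by (simp add: line_def)

lemma subspace_line: "mat.subspace (line z)"
  by (rule mat.subspaceI)
    (auto simp: line_iff mat.scale_left_distrib[symmetric] intro: exI[of _ 0])

lemma lcoords_lvec: "z \<noteq> 0 \<Longrightarrow> lcoords z (lvec z v) = v"
  by (simp add: lcoords_def lvec_def line_coord)

lemma carr_line_plus_espace: "carr (line_plus_espace z) = range (lvec z)"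
  by (auto simp: line_plus_espace_def lvec_def line_iff image_iff)

lemma lvec_add: "lvec z v + lvec z w = lvec z (v + w)"
  by (simp add: lvec_def mat.scale_left_distrib)

lemma smul_lvec: "smul (line_plus_espace z) c (lvec z v) = lvec z (vscale c v)"
  by (simp add: line_plus_espace_def lvec_def vscale_def pm_scale_def)

lemma is_cspace_line_plus_espace: "is_cspace (line_plus_espace z)"
proof -
  interpret pm: vector_space "pm_scale :: complex \<Rightarrow> espace \<Rightarrow> espace" by (rule vector_space_pm_scale)
  have s: "smul (line_plus_espace z) = (\<lambda>c p. (mat_smul c (fst p), pm_scale c (snd p)))"
    by (auto simp: line_plus_espace_def pm_scale_def fun_eq_iff)
  interpret vector_space "smul (line_plus_espace z)"
    unfolding s
    by unfold_locales
      (simp_all add: prod_eq_iff mat.scale_right_distrib mat.scale_left_distrib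
        pm.scale_right_distrib pm.scale_left_distrib)
  have "subspace (carr (line_plus_espace z))"
  proof (rule subspaceI)
    have "lvec z 0 = 0" by (simp add: lvec_def zero_prod_def)
    then show "0 \<in> carr (line_plus_espace z)" unfolding carr_line_plus_espace by (metis rangeI)
  qed (auto simp: carr_line_plus_espace lvec_add smul_lvec)
  then show ?thesis by (simp add: is_cspace_def vector_space_axioms)
qed

text \<open>The pairing of the pentad in coordinates, without its factor 4.\<close>

definition dot :: "complex \<times> espace \<Rightarrow> complex \<times> espace \<Rightarrow> complex" where
  "dot v w = coef_sum v (coef w)"

lemma dot_commute: "dot v w = dot w v"
proof -
  let ?K = "Poly_Mapping.keys (snd v) \<union> Poly_Mapping.keys (snd w)"
  have "coef_sum u g = coef u None * g None + (\<Sum>k\<in>?K. coef u (Some k) * g (Some k))"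
    if "u \<in> {v, w}" for u g
    using that by (intro coef_sum_eq) auto
  then show ?thesis by (simp add: dot_def ac_simps del: coef.simps)
qed

lemma dot_add: "dot (u + v) w = dot u w + dot v w" "dot w (u + v) = dot w u + dot w v"
proof -
  show "dot (u + v) w = dot u w + dot v w" for u v w
    by (simp add: dot_def coef_sum_add)
  then show "dot w (u + v) = dot w u + dot w v"
    using dot_commute by metis
qed

lemma dot_vscale: "dot (vscale c v) w = c * dot v w" "dot w (vscale c v) = c * dot w v"
proof -
  show "dot (vscale c v) w = c * dot v w" for v w
    by (simp add: dot_def coef_sum_vscale)
  then show "dot w (vscale c v) = c * dot w v"
    using dot_commute by metis
qed

text \<open>Links bracket and pairing: this is the defining equation of \<Phi> at
  \<open>a = h\<close>, divided by 4.\<close>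

lemma dot_wact: "dot (wact v) w = 2 * vpair v w"
proof -
  have "vpair v w = coef_sum v (\<lambda>a. (1 / 2) * (lwt a * coef w a))"
    by (simp add: vpair_def ac_simps)
  then show ?thesis unfolding coef_sum_fun_scale by (simp add: dot_def coef_sum_wact mult.commute)
qed

lemma vpair_wact: "dot v (wact w) = 2 * vpair v w"
  using dot_commute[of v "wact w"] dot_wact[of w v] vpair_commute[of v w] by simp

lemma coef_delta_exists: "\<exists>w. coef w = (\<lambda>b. if b = a then 1 else 0)"
proof (cases a)
  case None
  have "coef (1, 0) b = (if b = a then 1 else 0)" for b by (cases b) (simp_all add: None)
  then show ?thesis by blast
next
  case (Some k)
  have "coef (0, Poly_Mapping.single k 1) b = (if b = a then 1 else 0)" for b
    by (cases b) (auto simp: Some lookup_single when_def)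
  then show ?thesis by blast
qed

lemma dot_nondegenerate: "(\<And>w. dot v w = 0) \<Longrightarrow> v = 0"
proof (rule coef_inject)
  fix a assume 0: "\<And>w. dot v w = 0"
  obtain w where "coef w = (\<lambda>b. if b = a then 1 else 0)" using coef_delta_exists by blast
  then have "coef v a = dot v w" by (simp add: dot_def coef_sum_delta)
  moreover have "coef 0 a = 0" by (cases a) simp_all
  ultimately show "coef v a = coef 0 a" using 0 by simp
qed

lemma wact_add: "wact (v + w) = wact v + wact w"
  and wact_vscale: "wact (vscale c v) = vscale c (wact v)"
  and vscale_add: "vscale c (v + w) = vscale c v + vscale c w"
  and vscale_add_left: "vscale (c + d) v = vscale c v + vscale d v"
  and vscale_vscale: "vscale c (vscale d v) = vscale (c * d) v"
  by (rule coef_inject, simp add: algebra_simps)+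

section \<open>The Killing form on the Cartan subalgebra and the axioms of a standard pentad\<close>

locale sl2_triple =
  fixes y h x :: cmat2
  assumes dist: "distinct [y, h, x]" and basis: "is_basis sl2 {y, h, x}"
    and hy: "brkt sl2 h y = mat_smul (-2) y" and hx: "brkt sl2 h x = mat_smul 2 x"
    and xy: "brkt sl2 x y = h"
begin

abbreviation P :: "(cmat2, cmat2 \<times> espace, cmat2 \<times> espace) pentad" where
  "P \<equiv> sl2_pentad y h x"

lemma nonzero: "y \<noteq> 0" "h \<noteq> 0" "x \<noteq> 0"
proof -
  have "\<not> mat.dependent {y, h, x}" using basis by (simp add: is_basis_def)
  then show "y \<noteq> 0" "h \<noteq> 0" "x \<noteq> 0" using mat.dependent_zero[of "{y, h, x}"] by auto
qed

text \<open>\<open>y\<close>, \<open>h\<close>, \<open>x\<close> are eigenvectors of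
  \<open>ad h\<close> with eigenvalues -2, 0, 2, so the trace is \<open>c * d * (4 + 0 + 4)\<close>.
  The basis in \<open>endo_trace\<close> is an unspecified choice and is compared with this
  eigenbasis.\<close>

lemma killing_h: "killing_form sl2 (mat_smul c h) (mat_smul d h) = 8 * c * d"
proof -
  define B where "B = (SOME B. is_basis sl2 B)"
  have "is_basis sl2 B" unfolding B_def using basis by (rule someI)
  then have B: "mat.independent B" "mat.span B = mat.span {y, h, x}" and B': "mat.independent {y, h, x}"
    using basis by (simp_all add: is_basis_def)
  let ?T = "\<lambda>u. brkt sl2 (mat_smul c h) (brkt sl2 (mat_smul d h) u)"
  let ?ev = "\<lambda>b. if b = h then 0 else 4 * c * d"
  have "Vector_Spaces.linear mat_smul mat_smul ?T"
    by unfold_locales (simp_all add: brkt_sl2_add brkt_sl2_smul mat.scale_right_distrib ac_simps)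
  moreover have "?T b = mat_smul (?ev b) b" if "b \<in> {y, h, x}" for b
    using that dist by (auto simp: brkt_sl2_smul brkt_sl2_minus brkt_sl2_0 hy hx brkt_sl2_self ac_simps)
  ultimately have "(\<Sum>e\<in>B. mat.representation B (?T e) e) = (\<Sum>b\<in>{y, h, x}. ?ev b)"
    using mat.sum_representation_eigenbasis[OF B(1) B' _ B(2), of ?T ?ev] by blast
  also have "\<dots> = 8 * c * d" using dist by auto
  finally show ?thesis
    by (simp add: killing_form_def endo_trace_def B_def[symmetric] Let_def)
qed

lemma P_simps: "pg P = cartan h" "pV P = line_plus_espace x" "pW P = line_plus_espace y" "pB P = killing_form sl2"
  by (simp_all add: sl2_pentad_def)

lemma carr_cartan: "carr (cartan h) = range (\<lambda>c. mat_smul c h)"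
  and smul_cartan: "smul (cartan h) = mat_smul" and brkt_cartan: "brkt (cartan h) = brkt sl2"
  by (auto simp: cartan_def sl2_def line_def)

lemma brkt_line: "brkt sl2 (mat_smul c h) (mat_smul d h) = 0"
  by (simp add: brkt_sl2_smul brkt_sl2_self)

lemma prho_lvec: "prho P (mat_smul c h) (lvec x v) = lvec x (vscale c (wact v))"
proof -
  have "rho_minus h (mat_smul c h) (snd v) = pm_scale c (snd (wact v))"
    by (rule poly_mapping_eqI)
      (auto simp: rho_minus_def wact_def lookup_mapp when_def in_keys_iff line_coord[OF nonzero(2)]
        split: prod.splits)
  then show ?thesis
    by (simp add: sl2_pentad_def lvec_def brkt_sl2_smul hx vscale_def wact_def ac_simps)
qed

lemma pvarrho_lvec: "pvarrho P (mat_smul c h) (lvec y v) = lvec y (vscale (- c) (wact v))"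
proof -
  have "rho_plus h (mat_smul c h) (snd v) = pm_scale (- c) (snd (wact v))"
    by (rule poly_mapping_eqI)
      (auto simp: rho_plus_def wact_def lookup_mapp when_def in_keys_iff line_coord[OF nonzero(2)]
        split: prod.splits)
  then show ?thesis
    by (simp add: sl2_pentad_def lvec_def brkt_sl2_smul hy vscale_def wact_def ac_simps)
qed

lemma ppair_lvec: "ppair P (lvec x v) (lvec y w) = 4 * dot v w"
  by (simp add: sl2_pentad_def lvec_def line_coord nonzero dot_def coef_sum_def sum_distrib_left)

lemma is_lie_alg_cartan: "is_lie_alg (cartan h)"
  unfolding is_lie_alg_def
proof (intro conjI)
  have "carr (cartan h) = line h" by (simp add: cartan_def)
  then show "is_cspace (cartan h)"
    by (simp add: is_cspace_def smul_cartan vector_space_mat_smul subspace_line)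
  have z: "0 \<in> range (\<lambda>c. mat_smul c h)" using rangeI[of "\<lambda>c. mat_smul c h" 0] by simp
  show "bilin_map (cartan h) (cartan h) (cartan h) (brkt (cartan h))"
    using z by (auto simp: bilin_map_def lin_map_def carr_cartan smul_cartan brkt_cartan brkt_line
        simp flip: mat.scale_left_distrib)
  have b0: "brkt sl2 (mat_smul c h) 0 = 0" for c using brkt_line[of c 0] by simp
  show "\<forall>a\<in>carr (cartan h). brkt (cartan h) a a = 0"
    by (simp add: brkt_cartan brkt_sl2_self)
  show "\<forall>a\<in>carr (cartan h). \<forall>b\<in>carr (cartan h). \<forall>c\<in>carr (cartan h).
      brkt (cartan h) a (brkt (cartan h) b c) + brkt (cartan h) b (brkt (cartan h) c a) +
      brkt (cartan h) c (brkt (cartan h) a b) = 0"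
    by (auto simp: carr_cartan brkt_cartan brkt_line b0)
qed

lemma lie_rep_P: "lie_rep (pg P) (pV P) (prho P)" "lie_rep (pg P) (pW P) (pvarrho P)"
proof -
  have 0: "prho P 0 (lvec x v) = 0" "pvarrho P 0 (lvec y v) = 0" for v
  proof -
    have "vscale 0 u = 0" for u by (rule coef_inject) (simp, case_tac a, simp_all)
    then show "prho P 0 (lvec x v) = 0" "pvarrho P 0 (lvec y v) = 0"
      using prho_lvec[of 0 v] pvarrho_lvec[of 0 v] by (simp_all add: lvec_def zero_prod_def)
  qed
  show "lie_rep (pg P) (pV P) (prho P)" "lie_rep (pg P) (pW P) (pvarrho P)"
    unfolding lie_rep_def bilin_map_def lin_map_def P_simps carr_cartan carr_line_plus_espace
      smul_cartan brkt_cartan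
    by (auto simp: prho_lvec pvarrho_lvec lvec_add smul_lvec brkt_line 0 wact_add wact_vscale vscale_add
        vscale_vscale vscale_add_left[symmetric] ac_simps simp del: add_Pair simp flip: mat.scale_left_distrib)
qed

text \<open>Forced by the case \<open>a = h\<close> of the condition on \<Phi>: for a value
  \<open>mat_smul c h\<close> it reads \<open>8 * c = 4 * dot (wact v) w\<close>, so that
  \<open>c\<close> is \<open>vpair v w\<close>.\<close>

definition Phi :: "cmat2 \<times> espace \<Rightarrow> cmat2 \<times> espace \<Rightarrow> cmat2" where
  "Phi p r = mat_smul (vpair (lcoords x p) (lcoords y r)) h"

lemma Phi_lvec: "Phi (lvec x v) (lvec y w) = mat_smul (vpair v w) h"
  by (simp add: Phi_def lcoords_lvec nonzero)

lemma is_pentad_P: "is_pentad P"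
  unfolding is_pentad_def
proof (intro conjI)
  have z: "killing_form sl2 0 (mat_smul c h) = 0" "killing_form sl2 (mat_smul c h) 0 = 0" for c
    using killing_h[of 0 c] killing_h[of c 0] by simp_all
  show "is_lie_alg (pg P)" by (simp add: P_simps is_lie_alg_cartan)
  show "bilin_map (pg P) (pg P) complex_line (pB P)"
    unfolding bilin_map_def lin_map_def P_simps carr_cartan smul_cartan
    by (auto simp: complex_line_def killing_h algebra_simps simp flip: mat.scale_left_distrib)
  have "mat_smul c h = 0" if "\<forall>b\<in>range (\<lambda>d. mat_smul d h). killing_form sl2 (mat_smul c h) b = 0" for c
    using bspec[OF that rangeI[of _ 1]] by (simp only: killing_h) simp
  moreover have "mat_smul c h = 0" if "\<forall>a\<in>range (\<lambda>d. mat_smul d h). killing_form sl2 a (mat_smul c h) = 0" for c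
    using bspec[OF that rangeI[of _ 1]] by (simp only: killing_h) simp
  ultimately show "nondegenerate (pg P) (pg P) (pB P)"
    unfolding nondegenerate_def P_simps carr_cartan by blast
  show "\<forall>a\<in>carr (pg P). \<forall>b\<in>carr (pg P). \<forall>c\<in>carr (pg P).
        pB P (brkt (pg P) a b) c = pB P a (brkt (pg P) b c)"
    by (auto simp: P_simps carr_cartan brkt_cartan brkt_line z)
  show "is_cspace (pV P)" "is_cspace (pW P)"
    by (simp_all add: P_simps is_cspace_line_plus_espace)
  show "lie_rep (pg P) (pV P) (prho P)" "lie_rep (pg P) (pW P) (pvarrho P)" by (rule lie_rep_P)+
  show "bilin_map (pV P) (pW P) complex_line (ppair P)"
    unfolding bilin_map_def lin_map_def P_simps carr_line_plus_espace
    by (auto simp: complex_line_def ppair_lvec lvec_add smul_lvec dot_add dot_vscale algebra_simps simp del: add_Pair)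
  show "inj_on (\<lambda>\<phi>. restrict (\<lambda>v. ppair P v \<phi>) (carr (pV P))) (carr (pW P))"
  proof (rule inj_onI)
    fix p r
    assume "p \<in> carr (pW P)" "r \<in> carr (pW P)"
      and eq: "restrict (\<lambda>v. ppair P v p) (carr (pV P)) = restrict (\<lambda>v. ppair P v r) (carr (pV P))"
    then obtain v w where vw: "p = lvec y v" "r = lvec y w" by (auto simp: P_simps carr_line_plus_espace)
    have "dot u v = dot u w" for u
      using fun_cong[OF eq, of "lvec x u"] by (simp add: P_simps carr_line_plus_espace vw ppair_lvec)
    \<comment> \<open>The difference is written with \<open>vscale (-1)\<close>, as additivity and
      homogeneity of \<open>dot\<close> are at hand in this form.\<close>
    then have "dot (v + vscale (-1) w) u = 0" for u
      using dot_commute by (simp add: dot_add dot_vscale)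
    then have "v + vscale (-1) w = 0" by (rule dot_nondegenerate)
    then have "coef v a + coef (vscale (-1) w) a = coef 0 a" for a by (metis coef_add)
    moreover have "coef 0 a = 0" for a by (cases a) simp_all
    ultimately have "v = w" by (intro coef_inject) simp
    then show "p = r" using vw by simp
  qed
  show "\<forall>a\<in>carr (pg P). \<forall>v\<in>carr (pV P). \<forall>\<phi>\<in>carr (pW P).
        ppair P v (pvarrho P a \<phi>) = - ppair P (prho P a v) \<phi>"
    by (auto simp: P_simps carr_cartan carr_line_plus_espace prho_lvec pvarrho_lvec ppair_lvec
        dot_vscale dot_wact vpair_wact)
qed

lemma is_Phi_Phi: "is_Phi P Phi"
  unfolding is_Phi_def
proof (intro conjI)
  have vp: "vpair v w = dot (wact v) w / 2" "vpair v w = dot v (wact w) / 2" for v w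
    by (simp_all add: dot_wact vpair_wact)
  have "vpair (u + v) w = vpair u w + vpair v w" "vpair (vscale c v) w = c * vpair v w" for u v w c
    by (simp_all add: vp(1) wact_add wact_vscale dot_add dot_vscale add_divide_distrib)
  moreover have "vpair w (u + v) = vpair w u + vpair w v" "vpair w (vscale c v) = c * vpair w v" for u v w c
    by (simp_all add: vp(2) wact_add wact_vscale dot_add dot_vscale add_divide_distrib)
  ultimately show "bilin_map (pV P) (pW P) (pg P) Phi"
    unfolding bilin_map_def lin_map_def P_simps carr_line_plus_espace carr_cartan smul_cartan
    by (auto simp: Phi_lvec lvec_add smul_lvec simp flip: mat.scale_left_distrib)
  show "\<forall>a\<in>carr (pg P). \<forall>v\<in>carr (pV P). \<forall>\<phi>\<in>carr (pW P).
        pB P a (Phi v \<phi>) = ppair P (prho P a v) \<phi> \<and>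
        ppair P (prho P a v) \<phi> = - ppair P v (pvarrho P a \<phi>)"
    by (auto simp: P_simps carr_cartan carr_line_plus_espace prho_lvec pvarrho_lvec ppair_lvec Phi_lvec killing_h
        dot_vscale dot_wact vpair_wact)
qed

lemma standard_P: "standard_pentad P"
  unfolding standard_pentad_def
proof (intro conjI exI)
  have z: "lvec z 0 = 0" for z by (simp add: lvec_def zero_prod_def)
  have "lvec x v = 0" if "\<forall>r\<in>range (lvec y). ppair P (lvec x v) r = 0" for v
  proof -
    have "ppair P (lvec x v) (lvec y w) = 0" for w using that by blast
    then have "dot v w = 0" for w by (simp add: ppair_lvec)
    then show ?thesis using dot_nondegenerate[of v] z by simp
  qed
  moreover have "lvec y w = 0" if "\<forall>p\<in>range (lvec x). ppair P p (lvec y w) = 0" for w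
  proof -
    have "ppair P (lvec x v) (lvec y w) = 0" for v using that by blast
    then have "dot w v = 0" for v by (simp add: ppair_lvec dot_commute[of w])
    then show ?thesis using dot_nondegenerate[of w] z by simp
  qed
  ultimately show "nondegenerate (pV P) (pW P) (ppair P)"
    unfolding nondegenerate_def P_simps carr_line_plus_espace by blast
qed (rule is_pentad_P is_Phi_Phi)+

section \<open>The constructed algebra and the chosen representative\<close>

lemma transitive_assoc_lie_exists:
  assumes "infinite (UNIV :: 'k set)"
  shows "\<exists>L :: ('k \<Rightarrow>\<^sub>0 complex) graded_lie. is_assoc_lie P L \<and> transitive_graded L"
proof (rule sl2_graded_exists[OF assms])
  fix L :: "('k \<Rightarrow>\<^sub>0 complex) graded_lie" and H E F
  assume L: "is_graded_lie L" "transitive_graded L"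
    and bij: "bij_betw H UNIV (homog L 0)" "bij_betw E UNIV (homog L 1)" "bij_betw F UNIV (homog L (-1))"
    and lin: "\<And>c d. H (c + d) = H c + H d" "\<And>c d. H (c * d) = smul L c (H d)"
      "\<And>v w. E (v + w) = E v + E w" "\<And>c v. E (vscale c v) = smul L c (E v)"
      "\<And>v w. F (v + w) = F v + F w" "\<And>c v. F (vscale c v) = smul L c (F v)"
    and br: "\<And>c d. brkt L (H c) (H d) = 0"
      "\<And>c v. brkt L (H c) (E v) = E (vscale c (wact v))"
      "\<And>c v. brkt L (H c) (F v) = F (vscale (- c) (wact v))"
      "\<And>v w. brkt L (E v) (F w) = H (vpair v w)"
  have lc: "line_coord h (mat_smul c h) = c" for c by (rule line_coord[OF nonzero(2)])
  have uv: "lcoords x (lvec x v) = v" "lcoords y (lvec y v) = v" for v using lcoords_lvec nonzero by auto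
  have H0: "H 0 = 0" using lin(1)[of 0 0] by simp
  have l0: "line_coord h 0 = 0" using lc[of 0] by simp
  have b0: "bij_betw (line_coord h) (range (\<lambda>c. mat_smul c h)) UNIV"
    by (rule bij_betwI[where g = "\<lambda>c. mat_smul c h"]) (auto simp: lc)
  have b1: "bij_betw (lcoords x) (range (lvec x)) UNIV"
    by (rule bij_betwI[where g = "lvec x"]) (auto simp: uv)
  have bm: "bij_betw (lcoords y) (range (lvec y)) UNIV"
    by (rule bij_betwI[where g = "lvec y"]) (auto simp: uv)
  have hom: "H c \<in> homog L 0" "E v \<in> homog L 1" "F v \<in> homog L (-1)" for c v
    using bij by (auto simp: bij_betw_def)
  have "lin_iso (pg P) (homog_space L 0) (\<lambda>a. H (line_coord h a))"
    using bij_betw_trans[OF b0 bij(1)]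
    by (auto simp: lin_iso_def lin_map_def P_simps carr_cartan smul_cartan homog_space_def lc lin hom o_def
        simp flip: mat.scale_left_distrib)
  moreover have "lin_iso (pV P) (homog_space L 1) (\<lambda>p. E (lcoords x p))"
    using bij_betw_trans[OF b1 bij(2)]
    by (auto simp: lin_iso_def lin_map_def P_simps carr_line_plus_espace homog_space_def lvec_add smul_lvec uv lin hom o_def)
  moreover have "lin_iso (pW P) (homog_space L (-1)) (\<lambda>p. F (lcoords y p))"
    using bij_betw_trans[OF bm bij(3)]
    by (auto simp: lin_iso_def lin_map_def P_simps carr_line_plus_espace homog_space_def lvec_add smul_lvec uv lin hom o_def)
  moreover have "\<forall>a\<in>carr (pg P). \<forall>b\<in>carr (pg P).
      brkt L (H (line_coord h a)) (H (line_coord h b)) = H (line_coord h (brkt (pg P) a b))"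
    by (auto simp: P_simps carr_cartan brkt_cartan brkt_line l0 H0 br)
  moreover have "\<forall>a\<in>carr (pg P). \<forall>v\<in>carr (pV P).
      brkt L (H (line_coord h a)) (E (lcoords x v)) = E (lcoords x (prho P a v))"
    by (auto simp: P_simps carr_cartan carr_line_plus_espace lc uv prho_lvec br)
  moreover have "\<forall>a\<in>carr (pg P). \<forall>v\<in>carr (pW P).
      brkt L (H (line_coord h a)) (F (lcoords y v)) = F (lcoords y (pvarrho P a v))"
    by (auto simp: P_simps carr_cartan carr_line_plus_espace lc uv pvarrho_lvec br)
  moreover have "\<forall>v\<in>carr (pV P). \<forall>w\<in>carr (pW P).
      brkt L (E (lcoords x v)) (F (lcoords y w)) = H (line_coord h (Phi v w))"
    by (auto simp: P_simps carr_line_plus_espace lc uv Phi_lvec br)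
  ultimately have "is_assoc_lie P L"
    unfolding is_assoc_lie_def
    using standard_P transitive_graded_imp_minimal[OF L] is_Phi_Phi
    by (intro conjI exI[of _ Phi] exI[of _ "\<lambda>a. H (line_coord h a)"] exI[of _ "\<lambda>p. E (lcoords x p)"]
        exI[of _ "\<lambda>p. F (lcoords y p)"])
  then show ?thesis using L(2) by blast
qed

text \<open>Lists over the disjoint sum are an infinite key type, so an associated Lie algebra
  exists on the very type of \<open>assoc_lie\<close> and the choice has its property. Being
  transitive, the constructed algebra also transfers minimality against arbitrary types to the
  chosen one.\<close>

lemma assoc_lie_P: "is_assoc_lie P (assoc_lie P)" "minimal_graded_lie TYPE('d::ab_group_add) (assoc_lie P)"
proof -
  have "infinite (UNIV :: (cmat2 + cmat2 \<times> espace + cmat2 \<times> espace) list set)"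
    by (rule infinite_UNIV_listI)
  from transitive_assoc_lie_exists[OF this]
  obtain M :: "((cmat2 + cmat2 \<times> espace + cmat2 \<times> espace) list \<Rightarrow>\<^sub>0 complex) graded_lie"
    where M: "is_assoc_lie P M" "transitive_graded M" by blast
  show 1: "is_assoc_lie P (assoc_lie P)"
    unfolding assoc_lie_def using M(1) by (rule someI)
  show "minimal_graded_lie TYPE('d) (assoc_lie P)"
    by (rule is_assoc_lie_minimal[OF M 1])
qed

end

theorem theorem3p16:
  fixes y h x :: cmat2
  assumes "distinct [y, h, x]" and "is_basis sl2 {y, h, x}"
    and "brkt sl2 h y = mat_smul (-2) y"
    and "brkt sl2 h x = mat_smul 2 x"
    and "brkt sl2 x y = h"
  shows "let L = assoc_lie (sl2_pentad y h x) in
    minimal_graded_lie TYPE('d::ab_group_add) L \<and>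
    (\<exists>\<iota>\<^sub>1 \<iota>\<^sub>0 \<iota>\<^sub>m.
       lin_iso (line_plus_espace x) (homog_space L 1) \<iota>\<^sub>1 \<and>
       lin_iso (cartan h) (homog_space L 0) \<iota>\<^sub>0 \<and>
       lin_iso (line_plus_espace y) (homog_space L (-1)) \<iota>\<^sub>m \<and>
       (let X = \<iota>\<^sub>1 (x, 0); H = \<iota>\<^sub>0 h; Y = \<iota>\<^sub>m (y, 0);
            Em = (\<lambda>i j. \<iota>\<^sub>1 (0, ebasis i j)); Ep = (\<lambda>i j. \<iota>\<^sub>m (0, ebasis i j))
        in brkt L H Y = smul L (-2) Y \<and>
           brkt L H X = smul L 2 X \<and>
           brkt L X Y = H \<and>
           (\<forall>i j. brkt L H (Em i j) = smul L (- of_nat i) (Em i j)) \<and>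
           (\<forall>i j. brkt L H (Ep i j) = smul L (of_nat i) (Ep i j)) \<and>
           (\<forall>i j. brkt L Y (Em i j) = 0) \<and>
           (\<forall>i j. brkt L X (Ep i j) = 0) \<and>
           (\<forall>i j k l. brkt L (Em i j) (Ep k l) =
              smul L (- of_nat i / 2 * (if (i, j) = (k, l) then 1 else 0)) H)))"
proof -
  interpret sl2_triple y h x by unfold_locales fact+
  define L where "L = assoc_lie P"
  have assoc: "is_assoc_lie P L" and min: "minimal_graded_lie TYPE('d) L"
    unfolding L_def by (rule assoc_lie_P)+
  have "is_graded_lie L" using min by (simp add: minimal_graded_lie_def)
  then interpret L: graded_lie_algebra L by unfold_locales
  from assoc obtain \<Phi> i0 i1 im where i:
      "is_Phi P \<Phi>"
      "lin_iso (pg P) (homog_space L 0) i0"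
      "lin_iso (pV P) (homog_space L 1) i1"
      "lin_iso (pW P) (homog_space L (-1)) im"
      "\<forall>a\<in>carr (pg P). \<forall>b\<in>carr (pg P). brkt L (i0 a) (i0 b) = i0 (brkt (pg P) a b)"
      "\<forall>a\<in>carr (pg P). \<forall>v\<in>carr (pV P). brkt L (i0 a) (i1 v) = i1 (prho P a v)"
      "\<forall>a\<in>carr (pg P). \<forall>\<phi>\<in>carr (pW P). brkt L (i0 a) (im \<phi>) = im (pvarrho P a \<phi>)"
      "\<forall>v\<in>carr (pV P). \<forall>\<phi>\<in>carr (pW P). brkt L (i1 v) (im \<phi>) = i0 (\<Phi> v \<phi>)"
    unfolding is_assoc_lie_def by (elim conjE exE)
  have hc: "h \<in> carr (pg P)" using rangeI[of "\<lambda>c. mat_smul c h" 1] by (simp add: P_simps carr_cartan)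
  have vc: "lvec x v \<in> carr (pV P)" "lvec y v \<in> carr (pW P)" for v
    by (simp_all add: P_simps carr_line_plus_espace)
  have s0: "i0 (mat_smul c h) = smul L c (i0 h)" for c
    using i(2) hc by (simp add: lin_iso_def lin_map_def P_simps smul_cartan homog_space_def)
  have s1: "i1 (lvec x (vscale c v)) = smul L c (i1 (lvec x v))" for c v
    using i(3) vc(1) by (simp add: lin_iso_def lin_map_def P_simps homog_space_def flip: smul_lvec)
  have sm: "im (lvec y (vscale c v)) = smul L c (im (lvec y v))" for c v
    using i(4) vc(2) by (simp add: lin_iso_def lin_map_def P_simps homog_space_def flip: smul_lvec)
  have h1: "brkt L (i0 h) (i1 (lvec x v)) = i1 (lvec x (wact v))" for v
    using i(6) hc vc(1) prho_lvec[of 1 v] s1[of 1 "wact v"] by simp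
  have hm: "brkt L (i0 h) (im (lvec y v)) = im (lvec y (vscale (-1) (wact v)))" for v
    using i(7) hc vc(2) pvarrho_lvec[of 1 v] by simp
  \<comment> \<open>The chosen algebra comes with a \<Phi> of its own; uniqueness identifies its
    values with those of \<open>Phi\<close>.\<close>
  have vw: "brkt L (i1 (lvec x v)) (im (lvec y w)) = smul L (vpair v w) (i0 h)" for v w
    using i(8) vc is_Phi_unique[OF is_pentad_P i(1) is_Phi_Phi vc, of v w] by (simp add: Phi_lvec s0)
  have c1: "i1 (lvec x v) \<in> carr L" for v
    using i(3) vc(1)[of v] L.homog_carr by (auto simp: lin_iso_def lin_map_def homog_space_def)
  have cm: "im (lvec y v) \<in> carr L" for v
    using i(4) vc(2)[of v] L.homog_carr by (auto simp: lin_iso_def lin_map_def homog_space_def)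
  define e where "e i j = (0 :: complex, ebasis i j)" for i j
  have lvec_e: "i1 (x, 0) = i1 (lvec x (1, 0))" "im (y, 0) = im (lvec y (1, 0))"
      "i1 (0, ebasis i j) = i1 (lvec x (e i j))" "im (0, ebasis i j) = im (lvec y (e i j))" for i j
    by (simp_all add: lvec_def e_def)
  have w1: "wact (1, 0) = vscale 2 (1, 0)"
    by (rule coef_inject) (simp, case_tac a, simp_all)
  have we: "wact (e i j) = vscale (- of_nat i) (e i j)" for i j
    by (rule coef_inject) (simp, case_tac a, auto simp: e_def ebasis_def lookup_single when_def)
  \<comment> \<open>Dual basis vectors give half the weight: \<open>2 / 2\<close> for
    \<open>x\<close> with \<open>y\<close> and \<open>- i / 2\<close> for index
    \<open>(i, j)\<close>.\<close>
  have p: "vpair (1, 0) (1, 0) = 1" "vpair (1, 0) (e i j) = 0" "vpair (e i j) (1, 0) = 0"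
      "vpair (e i j) (e k l) = - of_nat i / 2 * (if (i, j) = (k, l) then 1 else 0)" for i j k l
    by (auto simp: vpair_def coef_sum_def e_def ebasis_def lookup_single when_def)
  \<comment> \<open>\<open>vw\<close> covers degree 1 before degree -1; the opposite order comes
    from antisymmetry.\<close>
  have "brkt L (im (lvec y (1, 0))) (i1 (lvec x (e i j))) = 0" for i j
    using L.brkt_swap[OF cm c1, of "(1, 0)" "e i j"] vw[of "e i j" "(1, 0)"] by (simp add: p)
  then have brackets: "let X = i1 (x, 0); H = i0 h; Y = im (y, 0);
            Em = (\<lambda>i j. i1 (0, ebasis i j)); Ep = (\<lambda>i j. im (0, ebasis i j))
        in brkt L H Y = smul L (-2) Y \<and>
           brkt L H X = smul L 2 X \<and>
           brkt L X Y = H \<and>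
           (\<forall>i j. brkt L H (Em i j) = smul L (- of_nat i) (Em i j)) \<and>
           (\<forall>i j. brkt L H (Ep i j) = smul L (of_nat i) (Ep i j)) \<and>
           (\<forall>i j. brkt L Y (Em i j) = 0) \<and>
           (\<forall>i j. brkt L X (Ep i j) = 0) \<and>
           (\<forall>i j k l. brkt L (Em i j) (Ep k l) =
              smul L (- of_nat i / 2 * (if (i, j) = (k, l) then 1 else 0)) H)"
    unfolding Let_def lvec_e h1 hm vw w1 we s1 sm p by simp
  have isos: "lin_iso (line_plus_espace x) (homog_space L 1) i1" "lin_iso (cartan h) (homog_space L 0) i0"
      "lin_iso (line_plus_espace y) (homog_space L (-1)) im"
    using i(2-4) by (simp_all only: P_simps)
  show ?thesis
    unfolding L_def[symmetric] Let_def[of L]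
    by (rule conjI[OF min], rule exI[of _ i1], rule exI[of _ i0], rule exI[of _ im],
        rule conjI[OF isos(1) conjI[OF isos(2) conjI[OF isos(3) brackets]]])
qed

end
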